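(* Let $D=(V,E)$ be an acyclic directed graph with positive edge weights, let $\mathbf{u}=(u^{(1)},\dots,u^{(r)})$ and $\mathbf{v}=(v^{(1)},\dots,v^{(s)})$ be sequences of vertices, and let $I,J\subset V$ be totally ordered subsets of vertices. Assume that $J\oplus\mathbf{u}$ and $\mathbf{v}\oplus I$ are $D$-compatible and $D$-separated. Put $$Q=\big(Q_I(u^{(i)},u^{(j)})\big)_{1\le i,j\le r},\qquad \tilde Q=\big(\tilde Q_J(v^{(s+1-i)},v^{(s+1-j)})\big)_{1\le i,j\le s},\qquad H=\big(h(u^{(i)},v^{(s+1-j)})\big)_{1\le i\le r,\,1\le j\le s},$$ and the column vectors $Q_I=\big(Q_I(u^{(i)})\big)_{1\le i\le r}$ and $\tilde Q_J=\big(\tilde Q_J(v^{(s+1-j)})\big)_{1\le j\le s}$. For integers $a,b\ge 0$ let $G_{a,b}$ denote the generating function of those families in $\mathscr{P}_0(J\oplus\mathbf{u};\mathbf{v}\oplus I)$ having exactly $a\bmod 2$ parity of paths from $\mathbf{u}$ to $I$ and $b\bmod 2$ parity of paths from $J$ to $\mathbf{v}$; more precisely, write $G_{\mathrm{even},\mathrm{even}}$, $G_{\mathrm{odd},\mathrm{odd}}$, $G_{\mathrm{even},\mathrm{odd}}$, $G_{\mathrm{odd},\mathrm{even}}$ for the generating functions of families whose number of paths from $\mathbf{u}$ to $I$ (first index) and number of paths from $J$ to $\mathbf{v}$ (second index) have the indicated parities. If $r+s$ is even, then $$G_{\mathrm{even},\mathrm{even}}=\operatorname{Pf}\begin{bmatrix}Q&H\\-H^{\top}&\tilde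 Q\end{bmatrix},\qquad G_{\mathrm{odd},\mathrm{odd}}=\operatorname{Pf}\begin{bmatrix}Q&Q_I&H&0\\-Q_I^{\top}&0&0&0\\-H^{\top}&0&\tilde Q&\tilde Q_J\\0&0&-\tilde Q_J^{\top}&0\end{bmatrix}.$$ If $r+s$ is odd, then $$G_{\mathrm{even},\mathrm{odd}}=\operatorname{Pf}\begin{bmatrix}Q&H&0\\-H^{\top}&\tilde Q&\tilde Q_J\\0&-\tilde Q_J^{\top}&0\end{bmatrix},\qquad G_{\mathrm{odd},\mathrm{even}}=\operatorname{Pf}\begin{bmatrix}Q&Q_I&H\\-Q_I^{\top}&0&0\\-H^{\top}&0&\tilde Q\end{bmatrix}.$$
   Context: Paths in $D$ are directed paths (a path may have length zero, with weight $1$); the weight $\omega(P)$ of a path is the product of the weights of its edges, and for vertices $x,y$, $h(x,y)=\sum_{P}\omega(P)$ over all paths $P$ from $x$ to $y$ (all sums are assumed well defined). The vertices of $\mathbf{u}$ and of $\mathbf{v}$ are listed in increasing order. $J\oplus\mathbf{u}$ denotes the totally ordered set consisting of $J$ followed by $u^{(1)}<\dots<u^{(r)}$ (every vertex of $J$ precedes every $u^{(i)}$), and $\mathbf{v}\oplus I$ the totally ordered set $v^{(1)}<\dots<v^{(s)}$ followed by $I$; the sets involved are disjoint. Two ordered sets $X,Y$ are $D$-compatible if for all $x<x'$ in $X$ and $y>y'$ in $Y$, every path from $x$ to $y$ shares a vertex with every path from $x'$ to $y'$. $J\oplus\mathbf{u}$ and $\mathbf{v}\oplus I$ are $D$-separated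 if every path from a vertex of $J$ to a vertex of $\mathbf{v}$ is vertex-disjoint from every path from a vertex of $\mathbf{u}$ to a vertex of $I$. For a totally ordered set $K$ and $x,y\in K$ let $\operatorname{sgn}(y-x)$ be $1,0,-1$ according as $x<y$, $x=y$, $y<x$. Define $Q_I(u)=\sum_{y\in I}h(u,y)$, $Q_I(u,u')=\sum_{x,y\in I}h(u,x)h(u',y)\operatorname{sgn}(y-x)$, $\tilde Q_J(v)=\sum_{x\in J}h(x,v)$, and $\tilde Q_J(v',v)=\sum_{x,y\in J}h(x,v)h(y,v')\operatorname{sgn}(y-x)$. $\mathscr{P}_0(J\oplus\mathbf{u};\mathbf{v}\oplus I)$ is the set of families of pairwise vertex-disjoint paths of the following form: for some integer $\ell$ with $1\le \ell\le s+1$ and $s+1-\ell\le r$, there is a path from $u^{(i+1-\ell)}$ to $v^{(i)}$ for each $i=\ell,\dots,s$; a path from $u^{(i)}$ to some vertex of $I$ for each $i=s+2-\ell,\dots,r$; and a path from some vertex of $J$ to $v^{(j)}$ for each $j=1,\dots,\ell-1$ (no path goes from $J$ to $I$). The generating function of a set of families is the sum over its families of the product of the weights of the paths in the family. $\operatorname{Pf}$ denotes the Pfaffian of a skew-symmetric matrix of even order. *)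

theory Defs
  imports
    "HOL-Analysis.Infinite_Sum"
    "HOL-Combinatorics.Permutations"
    "Graph_Theory.Arc_Walk"
    "Jordan_Normal_Form.Matrix"
begin

section \<open>Paths and their weights\<close>

definition path_weight :: "('e \<Rightarrow> real) \<Rightarrow> 'e list \<Rightarrow> real" where
  "path_weight w p = prod_list (map w p)"

definition path_sum :: "('v, 'e) pre_digraph \<Rightarrow> ('e \<Rightarrow> real) \<Rightarrow> 'v \<Rightarrow> 'v \<Rightarrow> real" where
  "path_sum D w x y = (\<Sum>\<^sub>\<infinity>p | pre_digraph.apath D x p y. path_weight w p)"

text \<open>A path in a family is a triple (start vertex, list of arcs, end vertex); the start vertex
  has to be recorded because a path of length zero has no arcs.\<close>

definition path_vertices :: "('v, 'e) pre_digraph \<Rightarrow> 'v \<times> 'e list \<times> 'v \<Rightarrow> 'v set" where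
  "path_vertices D = (\<lambda>(x, p, y). set (pre_digraph.awalk_verts D x p))"

section \<open>Totally ordered sets of vertices\<close>

text \<open>A totally ordered set is given by its reflexive order relation. Finite sequences
  are indexed from \<open>1\<close>.\<close>

definition seq_order :: "nat \<Rightarrow> (nat \<Rightarrow> 'v) \<Rightarrow> 'v rel" where
  "seq_order n u = {(u i, u j) | i j. 1 \<le> i \<and> i \<le> j \<and> j \<le> n}"

definition order_concat :: "'v rel \<Rightarrow> 'v rel \<Rightarrow> 'v rel" where
  "order_concat R S = R \<union> S \<union> Field R \<times> Field S"

definition order_sgn :: "'v rel \<Rightarrow> 'v \<Rightarrow> 'v \<Rightarrow> real" where
  "order_sgn R x y = (if x = y then 0 else if (x, y) \<in> R then 1 else - 1)"

definition D_compatible :: "('v, 'e) pre_digraph \<Rightarrow> 'v rel \<Rightarrow> 'v rel \<Rightarrow> bool" where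
  "D_compatible D X Y \<longleftrightarrow>
     (\<forall>x x' y y' p p'.
        (x, x') \<in> X \<and> x \<noteq> x' \<and> (y', y) \<in> Y \<and> y' \<noteq> y \<and>
        pre_digraph.apath D x p y \<and> pre_digraph.apath D x' p' y' \<longrightarrow>
        path_vertices D (x, p, y) \<inter> path_vertices D (x', p', y') \<noteq> {})"

definition D_separated ::
  "('v, 'e) pre_digraph \<Rightarrow> 'v set \<Rightarrow> 'v set \<Rightarrow> 'v set \<Rightarrow> 'v set \<Rightarrow> bool" where
  "D_separated D J U W I \<longleftrightarrow>
     (\<forall>x\<in>J. \<forall>y\<in>W. \<forall>x'\<in>U. \<forall>y'\<in>I. \<forall>p p'.
        pre_digraph.apath D x p y \<and> pre_digraph.apath D x' p' y' \<longrightarrow>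
        path_vertices D (x, p, y) \<inter> path_vertices D (x', p', y') = {})"

section \<open>The entries of the matrices\<close>

definition Q_one :: "('v, 'e) pre_digraph \<Rightarrow> ('e \<Rightarrow> real) \<Rightarrow> 'v set \<Rightarrow> 'v \<Rightarrow> real" where
  "Q_one D w I a = (\<Sum>\<^sub>\<infinity>y\<in>I. path_sum D w a y)"

definition Q_two ::
  "('v, 'e) pre_digraph \<Rightarrow> ('e \<Rightarrow> real) \<Rightarrow> 'v set \<Rightarrow> 'v rel \<Rightarrow> 'v \<Rightarrow> 'v \<Rightarrow> real" where
  "Q_two D w I leI a a' =
     (\<Sum>\<^sub>\<infinity>(x, y)\<in>I \<times> I. path_sum D w a x * path_sum D w a' y * order_sgn leI x y)"

definition Qt_one :: "('v, 'e) pre_digraph \<Rightarrow> ('e \<Rightarrow> real) \<Rightarrow> 'v set \<Rightarrow> 'v \<Rightarrow> real" where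
  "Qt_one D w J b = (\<Sum>\<^sub>\<infinity>x\<in>J. path_sum D w x b)"

text \<open>In \<open>sgn (y - x)\<close> the vertex \<open>y\<close> belongs to the \<^emph>\<open>first\<close> argument, unlike in \<open>Q_two\<close>.\<close>

definition Qt_two ::
  "('v, 'e) pre_digraph \<Rightarrow> ('e \<Rightarrow> real) \<Rightarrow> 'v set \<Rightarrow> 'v rel \<Rightarrow> 'v \<Rightarrow> 'v \<Rightarrow> real" where
  "Qt_two D w J leJ b' b =
     (\<Sum>\<^sub>\<infinity>(x, y)\<in>J \<times> J. path_sum D w x b * path_sum D w y b' * order_sgn leJ x y)"

section \<open>Families of vertex-disjoint paths\<close>

text \<open>A family is a set of paths. When \<open>u\<close> and \<open>v\<close> are injective on their index ranges, \<open>J\<close> is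
  disjoint from \<open>u\<close> and \<open>I\<close> is disjoint from \<open>v\<close>, no two of the indexed paths below
  coincide, so nothing is lost by forgetting the indexing.\<close>

definition P_zero ::
  "('v, 'e) pre_digraph \<Rightarrow> 'v set \<Rightarrow> nat \<Rightarrow> (nat \<Rightarrow> 'v) \<Rightarrow> nat \<Rightarrow> (nat \<Rightarrow> 'v) \<Rightarrow> 'v set \<Rightarrow>
     ('v \<times> 'e list \<times> 'v) set set" where
  "P_zero D J r u s v I =
     {F. \<exists>l P A a B b.
        1 \<le> l \<and> l \<le> s + 1 \<and> s + 1 - l \<le> r \<and>
        (\<forall>i\<in>{l..s}. pre_digraph.apath D (u (i + 1 - l)) (P i) (v i)) \<and>
        (\<forall>i\<in>{s + 2 - l..r}. a i \<in> I \<and> pre_digraph.apath D (u i) (A i) (a i)) \<and>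
        (\<forall>j\<in>{1..l - 1}. b j \<in> J \<and> pre_digraph.apath D (b j) (B j) (v j)) \<and>
        F = (\<lambda>i. (u (i + 1 - l), P i, v i)) ` {l..s}
            \<union> (\<lambda>i. (u i, A i, a i)) ` {s + 2 - l..r}
            \<union> (\<lambda>j. (b j, B j, v j)) ` {1..l - 1} \<and>
        pairwise (\<lambda>p q. disjnt (path_vertices D p) (path_vertices D q)) F}"

definition num_paths :: "('v \<times> 'e list \<times> 'v) set \<Rightarrow> 'v set \<Rightarrow> 'v set \<Rightarrow> nat" where
  "num_paths F X Y = card {(x, p, y). (x, p, y) \<in> F \<and> x \<in> X \<and> y \<in> Y}"

definition gen_fun :: "('e \<Rightarrow> real) \<Rightarrow> ('v \<times> 'e list \<times> 'v) set set \<Rightarrow> real" where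
  "gen_fun w \<F> = (\<Sum>\<^sub>\<infinity>F\<in>\<F>. \<Prod>(x, p, y)\<in>F. path_weight w p)"

definition G_parity ::
  "('v, 'e) pre_digraph \<Rightarrow> ('e \<Rightarrow> real) \<Rightarrow> 'v set \<Rightarrow> nat \<Rightarrow> (nat \<Rightarrow> 'v) \<Rightarrow> nat \<Rightarrow> (nat \<Rightarrow> 'v) \<Rightarrow> 'v set \<Rightarrow>
     (nat \<Rightarrow> bool) \<Rightarrow> (nat \<Rightarrow> bool) \<Rightarrow> real" where
  "G_parity D w J r u s v I par1 par2 =
     gen_fun w {F \<in> P_zero D J r u s v I.
        par1 (num_paths F (u ` {1..r}) I) \<and> par2 (num_paths F J (v ` {1..s}))}"

section \<open>Pfaffians\<close>

text \<open>For a skew-symmetric matrix of order \<open>2n\<close> each perfect matching is counted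
  \<open>2^n n!\<close> times by the permutations.\<close>

definition pfaffian :: "real mat \<Rightarrow> real" where
  "pfaffian M = (let n = dim_row M div 2 in
     (\<Sum>\<sigma> | \<sigma> permutes {..<2 * n}.
        of_int (sign \<sigma>) * (\<Prod>i<n. M $$ (\<sigma> (2 * i), \<sigma> (2 * i + 1)))) / (2 ^ n * fact n))"

end

theory Submission
  imports Defs
begin

text \<open>Each Pfaffian is expanded over configurations that attach to every \<open>u i\<close> a path to \<open>v\<close> or \<open>I\<close> and
  to every \<open>v j\<close> a path from \<open>u\<close> or \<open>J\<close>; the coefficient of a configuration is a Pfaffian with entries
  \<open>0\<close>, \<open>1\<close>, \<open>-1\<close>. If the two ends of some path between \<open>u\<close> and \<open>v\<close> disagree about it, this matrix has
  a zero row. If two paths cross, exchanging their tails transposes two rows and columns and so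
  reverses the sign; separation guarantees that no path from \<open>J\<close> to \<open>I\<close> is created. If no two paths
  cross, compatibility makes the configuration order preserving, and the coefficient is \<open>1\<close> or \<open>0\<close>
  according to the parities. The border in the odd cases acts as an extra vertex above all of \<open>I\<close>,
  respectively below all of \<open>J\<close>. The cancellation takes place in finite sets of paths closed under
  exchange of tails; since all families have nonnegative weight, the general case follows by
  exhaustion.\<close>

section \<open>Pfaffians indexed by lists\<close>

text \<open>The expansion rests on two facts: an entry is bilinear in a path chosen at its row label
  and a path chosen at its column label, and each label occurs exactly once in every term of a
  Pfaffian. The choices can therefore be taken outside, and only a kernel depending on the chosen
  paths remains inside. The sinks are listed in decreasing order so that the matched pairs of an
  order-preserving configuration are nested, which gives the sign 1. The delicate point of the
  exchange is to find the same crossing again afterwards. No first crossing along a path is needed: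
  acyclicity makes every exchange produce paths and preserve the number of paths through each
  vertex, so any fixed selection among the vertices lying on two paths is stable. The hypotheses
  give convergence of the matrix entries, not of the sum over families. Cancelling inside finite
  sets avoids rearranging a signed infinite sum, and the finite identities bound all partial sums by
  the limiting Pfaffian, so summability of the families comes out of the argument.\<close>

definition pf_sum :: "nat \<Rightarrow> (nat \<Rightarrow> nat \<Rightarrow> real) \<Rightarrow> real" where
  "pf_sum n A = (\<Sum>\<sigma> | \<sigma> permutes {..<2 * n}.
     of_int (sign \<sigma>) * (\<Prod>i<n. A (\<sigma> (2 * i)) (\<sigma> (2 * i + 1))))"

text \<open>Labels in place of row numbers allow blocks to be cut out by list operations and allow a
  transposition of labels to act on the entries. Only even lengths are meaningful: for an odd length
  the last element would be ignored.\<close>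

definition pf_list :: "('a \<Rightarrow> 'a \<Rightarrow> real) \<Rightarrow> 'a list \<Rightarrow> real" where
  "pf_list A xs = (let n = length xs div 2 in
     pf_sum n (\<lambda>i j. A (xs ! i) (xs ! j)) / (2 ^ n * fact n))"

lemma permutes_lessThan_less:
  "\<sigma> permutes {..<m::nat} \<Longrightarrow> i < m \<Longrightarrow> \<sigma> i < m"
  using permutes_in_image by fastforce

lemma pf_sum_cong:
  assumes "\<And>i j. i < 2 * n \<Longrightarrow> j < 2 * n \<Longrightarrow> A i j = B i j"
  shows "pf_sum n A = pf_sum n B"
proof -
  have "A (\<sigma> (2 * i)) (\<sigma> (2 * i + 1)) = B (\<sigma> (2 * i)) (\<sigma> (2 * i + 1))"
    if "\<sigma> permutes {..<2 * n}" "i < n" for \<sigma> i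
    using permutes_lessThan_less[OF that(1), of "2 * i"] permutes_lessThan_less[OF that(1), of "2 * i + 1"]
      that(2) assms by simp
  then show ?thesis
    unfolding pf_sum_def by (intro sum.cong refl arg_cong2[where f = "(*)"] prod.cong) auto
qed

lemma pfaffian_eq_pf_list:
  assumes "dim_row M = length xs" "even (length xs)"
    "\<And>i j. i < length xs \<Longrightarrow> j < length xs \<Longrightarrow> M $$ (i, j) = A (xs ! i) (xs ! j)"
  shows "pfaffian M = pf_list A xs"
proof -
  have "pf_sum (length xs div 2) (\<lambda>i j. M $$ (i, j))
      = pf_sum (length xs div 2) (\<lambda>i j. A (xs ! i) (xs ! j))"
    by (rule pf_sum_cong) (use assms in auto)
  then show ?thesis
    by (simp add: pfaffian_def pf_list_def pf_sum_def assms(1) Let_def)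
qed

lemma pf_list_cong:
  assumes "even (length xs)" "\<And>a b. a \<in> set xs \<Longrightarrow> b \<in> set xs \<Longrightarrow> A a b = B a b"
  shows "pf_list A xs = pf_list B xs"
  unfolding pf_list_def Let_def
  by (intro arg_cong2[where f = "(/)"] refl pf_sum_cong assms) (use assms(1) in auto)

lemma pf_list_map: "even (length xs) \<Longrightarrow> pf_list A (map g xs) = pf_list (\<lambda>a b. A (g a) (g b)) xs"
  unfolding pf_list_def Let_def
  by (simp, intro arg_cong2[where f = "(/)"] refl pf_sum_cong) auto

lemma pf_sum_permute:
  assumes "\<rho> permutes {..<2 * n}"
  shows "pf_sum n (\<lambda>i j. A (\<rho> i) (\<rho> j)) = of_int (sign \<rho>) * pf_sum n A"
proof -
  have "pf_sum n A = (\<Sum>\<sigma> | \<sigma> permutes {..<2 * n}.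
      of_int (sign (\<rho> \<circ> \<sigma>)) * (\<Prod>i<n. A ((\<rho> \<circ> \<sigma>) (2 * i)) ((\<rho> \<circ> \<sigma>) (2 * i + 1))))"
    unfolding pf_sum_def by (rule setum_permutations_compose_left[OF assms])
  also have "\<dots> = (\<Sum>\<sigma> | \<sigma> permutes {..<2 * n}.
      of_int (sign \<rho>) * (of_int (sign \<sigma>) * (\<Prod>i<n. A (\<rho> (\<sigma> (2 * i))) (\<rho> (\<sigma> (2 * i + 1))))))"
    using permutes_imp_permutation[OF finite_lessThan assms]
    by (intro sum.cong refl) (simp add: sign_compose permutes_imp_permutation[OF finite_lessThan] mult.assoc)
  also have "\<dots> = of_int (sign \<rho>) * pf_sum n (\<lambda>i j. A (\<rho> i) (\<rho> j))"
    by (simp add: pf_sum_def sum_distrib_left)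
  \<comment> \<open>The chain has the sign on the other side; being 1 or -1, it can be moved
    across.\<close>
  finally show ?thesis
    by (simp add: sign_def)
qed

lemma pf_list_swap:
  assumes "even (length xs)" "i < length xs" "j < length xs" "i \<noteq> j"
  shows "pf_list A (xs[i := xs ! j, j := xs ! i]) = - pf_list A xs"
proof -
  define n where "n = length xs div 2"
  have n: "length xs = 2 * n" using assms(1) by (simp add: n_def)
  let ?t = "Transposition.transpose i j"
  have "pf_sum n (\<lambda>k l. A (xs[i := xs ! j, j := xs ! i] ! k) (xs[i := xs ! j, j := xs ! i] ! l))
      = pf_sum n (\<lambda>k l. A (xs ! ?t k) (xs ! ?t l))"
    using assms n by (intro pf_sum_cong) (auto simp: nth_list_update transpose_def)
  also have "\<dots> = - pf_sum n (\<lambda>k l. A (xs ! k) (xs ! l))"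
    using assms n by (subst pf_sum_permute[where A = "\<lambda>k l. A (xs ! k) (xs ! l)"])
      (auto simp: sign_swap_id intro: permutes_swap_id)
  finally show ?thesis
    by (simp add: pf_list_def n)
qed

lemma pf_list_swap_adjacent:
  assumes "even (length (xs @ a # b # ys))"
  shows "pf_list A (xs @ b # a # ys) = - pf_list A (xs @ a # b # ys)"
  using pf_list_swap[OF assms, of "length xs" "Suc (length xs)" A]
  by (simp add: nth_append list_update_append)

text \<open>Relabelling the entries by a transposition amounts to exchanging two members of the
  list. This is the form in which an exchange of tails acts on the coefficient matrix.\<close>

lemma pf_list_transpose:
  assumes "even (length xs)" "distinct xs" "a \<in> set xs" "b \<in> set xs" "a \<noteq> b"
  shows "pf_list (\<lambda>c d. A (Transposition.transpose a b c) (Transposition.transpose a b d)) xs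
    = - pf_list A xs"
proof -
  obtain i j where ij: "i < length xs" "j < length xs" "xs ! i = a" "xs ! j = b"
    using assms by (metis in_set_conv_nth)
  with assms have "i \<noteq> j" by auto
  have "map (Transposition.transpose a b) xs = xs[i := xs ! j, j := xs ! i]"
    using ij assms(2) \<open>i \<noteq> j\<close>
    by (intro nth_equalityI) (auto simp: nth_list_update transpose_def nth_eq_iff_index_eq)
  then show ?thesis
    using pf_list_swap[OF assms(1) ij(1,2) \<open>i \<noteq> j\<close>, of A]
    by (simp flip: pf_list_map[OF assms(1)])
qed

text \<open>Every permutation puts the position of \<open>c\<close> into some pair, so each term
  contains a factor from the row or the column of \<open>c\<close>.\<close>

lemma pf_list_zero_row:
  assumes "even (length xs)" "c \<in> set xs"
    "\<And>d. d \<in> set xs \<Longrightarrow> A c d = 0" "\<And>d. d \<in> set xs \<Longrightarrow> A d c = 0"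
  shows "pf_list A xs = 0"
proof -
  define n where "n = length xs div 2"
  have n: "length xs = 2 * n" using assms(1) by (simp add: n_def)
  obtain k where k: "k < 2 * n" "xs ! k = c"
    using assms(2) n by (metis in_set_conv_nth)
  have "(\<Prod>i<n. A (xs ! \<sigma> (2 * i)) (xs ! \<sigma> (2 * i + 1))) = 0" if \<sigma>: "\<sigma> permutes {..<2 * n}" for \<sigma>
  proof -
    obtain m where m: "m < 2 * n" "\<sigma> m = k"
      using k(1) permutes_image[OF \<sigma>] by (metis imageE lessThan_iff)
    let ?i = "m div 2"
    have i: "?i < n" using m(1) by auto
    have in_set: "xs ! \<sigma> l \<in> set xs" if "l < 2 * n" for l
      using permutes_lessThan_less[OF \<sigma> that] n by simp
    have "A (xs ! \<sigma> (2 * ?i)) (xs ! \<sigma> (2 * ?i + 1)) = 0"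
    proof (cases "even m")
      case True
      then show ?thesis using m k in_set[of "2 * ?i + 1"] assms(3) i by auto
    next
      case False
      then show ?thesis using m k in_set[of "2 * ?i"] assms(4) i
        by (auto simp: odd_two_times_div_two_succ)
    qed
    with i show ?thesis by (intro prod_zero) auto
  qed
  then have "pf_sum n (\<lambda>i j. A (xs ! i) (xs ! j)) = 0"
    unfolding pf_sum_def by (intro sum.neutral ballI) (simp only: mem_Collect_eq mult_zero_right)
  then show ?thesis
    by (simp add: pf_list_def n)
qed

section \<open>Removing two rows that agree outside their common block\<close>

lemma sum_eq_zero_of_sign_reversing:
  fixes g :: "'a \<Rightarrow> real"
  assumes "\<And>x. x \<in> S \<Longrightarrow> h x \<in> S" "\<And>x. x \<in> S \<Longrightarrow> h (h x) = x" "\<And>x. x \<in> S \<Longrightarrow> g (h x) = - g x"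
  shows "sum g S = 0"
proof -
  have "sum g S = (\<Sum>x\<in>S. - g x)"
    by (rule sum.reindex_bij_witness[where i = h and j = h]) (use assms in auto)
  then show ?thesis by (simp add: sum_negf)
qed

text \<open>Composition with the transposition of the two twin indices cancels all terms in which
  they are not matched to each other. The remaining terms place the twins in one of
  \<open>Suc n\<close> pairs and in one of two orders, with equal contributions. The resulting
  factor \<open>2 * real (Suc n)\<close> is what the normalisation \<open>2 ^ n * fact n\<close>
  gains when \<open>n\<close> grows by one.\<close>

lemma pf_sum_Suc_twin:
  assumes row: "\<And>i. i < 2 * n \<Longrightarrow> B (2 * n) i = B (2 * n + 1) i"
    and col: "\<And>i. i < 2 * n \<Longrightarrow> B i (2 * n) = B i (2 * n + 1)"
    and skew: "B (2 * n + 1) (2 * n) = - B (2 * n) (2 * n + 1)"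
  shows "pf_sum (Suc n) B = 2 * real (Suc n) * B (2 * n) (2 * n + 1) * pf_sum n B"
proof -
  let ?N = "{..<2 * Suc n}" and ?x = "2 * n" and ?y = "2 * n + 1"
  define S where "S = {\<sigma>. \<sigma> permutes ?N}"
  define g where "g \<sigma> = of_int (sign \<sigma>) * (\<Prod>i<Suc n. B (\<sigma> (2 * i)) (\<sigma> (2 * i + 1)))" for \<sigma>
  define R where "R k = {\<sigma> \<in> S. {\<sigma> (2 * k), \<sigma> (2 * k + 1)} = {?x, ?y}}" for k
  have finS: "finite S" unfolding S_def by (rule finite_permutations) simp
  have perm: "permutation \<sigma>" if "\<sigma> \<in> S" for \<sigma>
    using that permutes_imp_permutation[OF finite_lessThan] by (auto simp: S_def)
  have inj: "\<sigma> i = \<sigma> j \<longleftrightarrow> i = j" if "\<sigma> \<in> S" for \<sigma> i j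
    using that permutes_inj[of \<sigma> ?N] by (auto simp: S_def inj_eq)

  define \<tau> where "\<tau> = Transposition.transpose ?x ?y"
  have \<tau>: "\<tau> \<in> S" by (auto simp: \<tau>_def S_def intro!: permutes_swap_id)
  have sign_\<tau>: "sign \<tau> = - 1" by (simp add: \<tau>_def sign_swap_id)
  have \<tau>\<tau>: "\<tau> \<circ> \<tau> = id" "\<tau> (\<tau> i) = i" for i by (auto simp: \<tau>_def)
  have comp: "\<sigma> \<circ> \<sigma>' \<in> S" if "\<sigma> \<in> S" "\<sigma>' \<in> S" for \<sigma> \<sigma>'
    using that by (auto simp: S_def intro: permutes_compose)
  have B\<tau>: "B (\<tau> i) (\<tau> j) = B i j"
    if "i < 2 * Suc n" "j < 2 * Suc n" "i \<noteq> j" "{i, j} \<noteq> {?x, ?y}" for i j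
    using that row[of i] row[of j] col[of i] col[of j]
    by (auto simp: \<tau>_def transpose_def less_Suc_eq)
  have "sum g (S - (\<Union>k\<in>{..n}. R k)) = 0"
  proof (rule sum_eq_zero_of_sign_reversing[where h = "\<lambda>\<sigma>. \<tau> \<circ> \<sigma>"])
    fix \<sigma> assume \<sigma>: "\<sigma> \<in> S - (\<Union>k\<in>{..n}. R k)"
    have iff: "{\<tau> i, \<tau> j} = {?x, ?y} \<longleftrightarrow> {i, j} = {?x, ?y}" for i j
      by (auto simp: \<tau>_def transpose_def doubleton_eq_iff)
    show "\<tau> \<circ> \<sigma> \<in> S - (\<Union>k\<in>{..n}. R k)"
      using \<sigma> comp[OF \<tau>] by (auto simp: R_def iff[simplified])
    show "\<tau> \<circ> (\<tau> \<circ> \<sigma>) = \<sigma>" by (auto simp: \<tau>\<tau>)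
    have "B ((\<tau> \<circ> \<sigma>) (2 * i)) ((\<tau> \<circ> \<sigma>) (2 * i + 1)) = B (\<sigma> (2 * i)) (\<sigma> (2 * i + 1))" if "i < Suc n" for i
    proof -
      have "\<sigma> permutes ?N" using \<sigma> by (simp add: S_def)
      then have "\<sigma> (2 * i) < 2 * Suc n" "\<sigma> (2 * i + 1) < 2 * Suc n"
        using that by (auto intro!: permutes_lessThan_less[of \<sigma>])
      moreover have "\<sigma> (2 * i) \<noteq> \<sigma> (2 * i + 1)" using \<sigma> inj by auto
      moreover have "{\<sigma> (2 * i), \<sigma> (2 * i + 1)} \<noteq> {?x, ?y}" using \<sigma> that by (auto simp: R_def)
      ultimately show ?thesis using B\<tau> by simp
    qed
    then show "g (\<tau> \<circ> \<sigma>) = - g \<sigma>"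
      using \<sigma> perm \<tau> by (simp add: g_def sign_compose sign_\<tau>)
  qed
  moreover have "sum g (\<Union>k\<in>{..n}. R k) = (\<Sum>k\<le>n. sum g (R k))"
  proof (rule sum.UNION_disjoint)
    show "\<forall>i\<in>{..n}. \<forall>j\<in>{..n}. i \<noteq> j \<longrightarrow> R i \<inter> R j = {}"
    proof (intro ballI impI equals0I)
      fix i j \<sigma> assume "i \<noteq> j" "\<sigma> \<in> R i \<inter> R j"
      then have "\<sigma> \<in> S" "\<sigma> (2 * i) \<in> {\<sigma> (2 * j), \<sigma> (2 * j + 1)}" by (auto simp: R_def)
      with \<open>i \<noteq> j\<close> show False using inj[of \<sigma>] by (auto; presburger)
    qed
  qed (use finS in \<open>auto simp: R_def\<close>)
  moreover have "sum g (R k) = sum g (R n)" if "k \<le> n" for k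
  proof -
    define \<pi> where "\<pi> = Transposition.transpose k n"
    \<comment> \<open>Exchanging the pairs \<open>k\<close> and \<open>n\<close> as wholes takes two
      transpositions, hence costs no sign.\<close>
    define \<rho> where "\<rho> = Transposition.transpose (2 * k) ?x \<circ> Transposition.transpose (2 * k + 1) ?y"
    have \<rho>: "\<rho> \<in> S"
      unfolding \<rho>_def using that by (intro comp) (auto simp: S_def intro!: permutes_swap_id)
    have \<rho>i: "\<rho> (2 * i) = 2 * \<pi> i" "\<rho> (2 * i + 1) = 2 * \<pi> i + 1" for i
      by (auto simp: \<rho>_def \<pi>_def transpose_def; presburger)+
    have sign_\<rho>: "sign \<rho> = 1"
      unfolding \<rho>_def by (subst sign_compose) (auto simp: sign_swap_id permutation_swap_id)
    have \<rho>\<rho>: "\<rho> \<circ> \<rho> = id"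
    proof
      fix i show "(\<rho> \<circ> \<rho>) i = id i"
        using \<rho>i[of "i div 2"] \<rho>i[of "\<pi> (i div 2)"] by (cases "even i") (auto simp: \<pi>_def elim!: evenE oddE)
    qed
    have g: "g (\<sigma> \<circ> \<rho>) = g \<sigma>" if "\<sigma> \<in> S" for \<sigma>
    proof -
      have "(\<Prod>i<Suc n. B ((\<sigma> \<circ> \<rho>) (2 * i)) ((\<sigma> \<circ> \<rho>) (2 * i + 1)))
          = (\<Prod>i<Suc n. B (\<sigma> (2 * \<pi> i)) (\<sigma> (2 * \<pi> i + 1)))"
        using \<rho>i by simp
      also have "\<dots> = (\<Prod>i<Suc n. B (\<sigma> (2 * i)) (\<sigma> (2 * i + 1)))"
        by (rule prod.reindex_bij_witness[where i = \<pi> and j = \<pi>])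
           (use \<open>k \<le> n\<close> in \<open>auto simp: \<pi>_def transpose_def\<close>)
      finally show ?thesis
        using that perm \<rho> by (simp add: g_def sign_compose sign_\<rho>)
    qed
    have \<pi>: "\<pi> k = n" "\<pi> n = k" by (auto simp: \<pi>_def)
    show ?thesis
    proof (rule sum.reindex_bij_witness[where i = "\<lambda>\<sigma>. \<sigma> \<circ> \<rho>" and j = "\<lambda>\<sigma>. \<sigma> \<circ> \<rho>"])
      fix \<sigma> :: "nat \<Rightarrow> nat"
      show "\<sigma> \<circ> \<rho> \<circ> \<rho> = \<sigma>" "\<sigma> \<circ> \<rho> \<circ> \<rho> = \<sigma>" by (simp_all only: comp_assoc \<rho>\<rho> comp_id)
      show "\<sigma> \<circ> \<rho> \<in> R n" if "\<sigma> \<in> R k"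
        using that comp[OF _ \<rho>] \<rho>i[of n] \<pi> by (auto simp: R_def)
      show "\<sigma> \<circ> \<rho> \<in> R k" if "\<sigma> \<in> R n"
        using that comp[OF _ \<rho>] \<rho>i[of k] \<pi> by (auto simp: R_def)
      show "g (\<sigma> \<circ> \<rho>) = g \<sigma>" if "\<sigma> \<in> R k" using g that by (simp add: R_def)
    qed
  qed
  moreover have "sum g (R n) = 2 * (B ?x ?y * pf_sum n B)"
  proof -
    define R1 where "R1 = {\<sigma> \<in> S. \<sigma> ?x = ?x \<and> \<sigma> ?y = ?y}"
    define R2 where "R2 = {\<sigma> \<in> S. \<sigma> ?x = ?y \<and> \<sigma> ?y = ?x}"
    have "R n = R1 \<union> R2" "R1 \<inter> R2 = {}"
      by (auto simp: R_def R1_def R2_def doubleton_eq_iff)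
    then have "sum g (R n) = sum g R1 + sum g R2"
      using finS by (simp add: sum.union_disjoint R1_def R2_def)
    \<comment> \<open>Reversing the order inside the twin pair changes the sign of the permutation
      and, by \<open>skew\<close>, the sign of one factor; the two changes cancel.\<close>
    moreover have "sum g R2 = sum g R1"
    proof (rule sum.reindex_bij_witness[where i = "\<lambda>\<sigma>. \<sigma> \<circ> \<tau>" and j = "\<lambda>\<sigma>. \<sigma> \<circ> \<tau>"])
      fix \<sigma> :: "nat \<Rightarrow> nat"
      show "\<sigma> \<circ> \<tau> \<circ> \<tau> = \<sigma>" "\<sigma> \<circ> \<tau> \<circ> \<tau> = \<sigma>" by (simp_all only: comp_assoc \<tau>\<tau> comp_id)
      show "\<sigma> \<circ> \<tau> \<in> R1" if "\<sigma> \<in> R2"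
        using that comp[OF _ \<tau>] by (auto simp: R1_def R2_def \<tau>_def)
      show "\<sigma> \<circ> \<tau> \<in> R2" if "\<sigma> \<in> R1"
        using that comp[OF _ \<tau>] by (auto simp: R1_def R2_def \<tau>_def)
      show "g (\<sigma> \<circ> \<tau>) = g \<sigma>" if "\<sigma> \<in> R2"
      proof -
        have "\<sigma> \<in> S" "\<sigma> ?x = ?y" "\<sigma> ?y = ?x" using that by (auto simp: R2_def)
        moreover have "\<tau> (2 * i) = 2 * i" "\<tau> (2 * i + 1) = 2 * i + 1" if "i < n" for i
          using that by (auto simp: \<tau>_def transpose_def)
        moreover have "\<tau> ?x = ?y" "\<tau> ?y = ?x" by (auto simp: \<tau>_def)
        ultimately show ?thesis
          using perm \<tau> skew by (simp add: g_def sign_compose sign_\<tau>)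
      qed
    qed
    moreover have "R1 = {\<sigma>. \<sigma> permutes {..<2 * n}}"
    proof (intro equalityI subsetI)
      fix \<sigma> assume "\<sigma> \<in> R1"
      then have "\<sigma> permutes ?N" "\<sigma> ?x = ?x" "\<sigma> ?y = ?y" by (auto simp: R1_def S_def)
      then have "\<sigma> permutes {..<2 * n}"
        by (elim permutes_superset) (auto simp: less_Suc_eq)
      then show "\<sigma> \<in> {\<sigma>. \<sigma> permutes {..<2 * n}}" by simp
    next
      fix \<sigma> assume "\<sigma> \<in> {\<sigma>. \<sigma> permutes {..<2 * n}}"
      then have \<sigma>: "\<sigma> permutes {..<2 * n}" by simp
      then have "\<sigma> permutes ?N" by (rule permutes_subset) auto
      then show "\<sigma> \<in> R1"
        using permutes_not_in[OF \<sigma>, of ?x] permutes_not_in[OF \<sigma>, of ?y] by (simp add: R1_def S_def)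
    qed
    then have "sum g R1 = B ?x ?y * pf_sum n B"
      unfolding pf_sum_def sum_distrib_left
    proof (intro sum.cong)
      fix \<sigma> assume "\<sigma> \<in> {\<sigma>. \<sigma> permutes {..<2 * n}}"
      then have "\<sigma> ?x = ?x" "\<sigma> ?y = ?y"
        using permutes_not_in[of \<sigma> "{..<2 * n}" ?x] permutes_not_in[of \<sigma> "{..<2 * n}" ?y] by auto
      then show "g \<sigma> = B ?x ?y * (real_of_int (sign \<sigma>) * (\<Prod>i<n. B (\<sigma> (2 * i)) (\<sigma> (2 * i + 1))))"
        by (simp add: g_def)
    qed
    ultimately show ?thesis by simp
  qed
  moreover have "sum g S = sum g (S - (\<Union>k\<in>{..n}. R k)) + sum g (\<Union>k\<in>{..n}. R k)"
    by (rule sum.subset_diff) (use finS in \<open>auto simp: R_def\<close>)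
  moreover have "pf_sum (Suc n) B = sum g S"
    unfolding pf_sum_def S_def by (intro sum.cong refl) (simp only: g_def)
  ultimately show ?thesis by simp
qed

lemma pf_list_Nil [simp]: "pf_list A [] = 1"
  by (simp add: pf_list_def pf_sum_def)

lemma pf_list_twin_last:
  assumes even: "even (length xs)"
    and twin: "\<And>c. c \<in> set xs \<Longrightarrow> A a c = A b c" "\<And>c. c \<in> set xs \<Longrightarrow> A c a = A c b"
    and skew: "A b a = - A a b"
  shows "pf_list A (xs @ [a, b]) = A a b * pf_list A xs"
proof -
  define n where "n = length xs div 2"
  have n: "length xs = 2 * n" using even by (simp add: n_def)
  let ?B = "\<lambda>i j. A ((xs @ [a, b]) ! i) ((xs @ [a, b]) ! j)"
  have "pf_sum (Suc n) ?B = 2 * real (Suc n) * ?B (2 * n) (2 * n + 1) * pf_sum n ?B"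
    by (rule pf_sum_Suc_twin) (use twin n skew in \<open>auto simp: nth_append\<close>)
  also have "?B (2 * n) (2 * n + 1) = A a b" by (simp add: nth_append n)
  also have "pf_sum n ?B = pf_sum n (\<lambda>i j. A (xs ! i) (xs ! j))"
    by (rule pf_sum_cong) (auto simp: nth_append n)
  finally show ?thesis
    by (simp add: pf_list_def n del: of_nat_Suc)
qed

text \<open>Moving an adjacent pair past one element takes two adjacent swaps, whose signs
  cancel.\<close>

lemma pf_list_move_pair:
  assumes "even (length (xs @ a # b # ys))"
  shows "pf_list A (xs @ a # b # ys) = pf_list A (xs @ ys @ [a, b])"
  using assms
proof (induction ys arbitrary: xs)
  case (Cons y ys)
  have "pf_list A (xs @ a # b # y # ys) = - pf_list A ((xs @ [a]) @ y # b # ys)"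
    using Cons.prems pf_list_swap_adjacent[of "xs @ [a]" y b ys A] by simp
  also have "\<dots> = pf_list A (xs @ y # a # b # ys)"
    using Cons.prems pf_list_swap_adjacent[of xs y a "b # ys" A] by simp
  also have "\<dots> = pf_list A ((xs @ [y]) @ ys @ [a, b])"
    using Cons.IH[of "xs @ [y]"] Cons.prems by simp
  finally show ?case by simp
qed simp

lemma pf_list_twin:
  assumes "even (length (xs @ ys))"
    and "\<And>c. c \<in> set (xs @ ys) \<Longrightarrow> A a c = A b c" "\<And>c. c \<in> set (xs @ ys) \<Longrightarrow> A c a = A c b"
    and "A b a = - A a b"
  shows "pf_list A (xs @ a # b # ys) = A a b * pf_list A (xs @ ys)"
  using pf_list_move_pair[of xs a b ys A] pf_list_twin_last[of "xs @ ys" A a b] assms by simp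

text \<open>The first two members of the block see the same entries elsewhere, namely 1 towards
  later members and 0 outside. They are twins with common entry 1 and can be removed without
  changing the value; a single leftover member produces a zero row.\<close>

lemma pf_list_ones_block:
  assumes "even (length (xs @ zs @ ys))"
    and skew: "\<And>a b. a \<in> set zs \<Longrightarrow> b \<in> set zs \<Longrightarrow> A b a = - A a b"
    and ones: "sorted_wrt (\<lambda>a b. A a b = 1) zs"
    and zero: "\<And>a c. a \<in> set zs \<Longrightarrow> c \<in> set (xs @ ys) \<Longrightarrow> A a c = 0 \<and> A c a = 0"
  shows "pf_list A (xs @ zs @ ys) = (if even (length zs) then pf_list A (xs @ ys) else 0)"
  using assms
proof (induction zs rule: induct_list012)
  case (2 a)
  have "A a a = 0" using "2.prems"(2)[of a a] by simp
  then have "pf_list A (xs @ [a] @ ys) = 0"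
    using "2.prems"(1,4) by (intro pf_list_zero_row[where c = a]) auto
  then show ?case by simp
next
  case (3 a b zs)
  have skew: "A c d = - A d c" if "c \<in> set (a # b # zs)" "d \<in> set (a # b # zs)" for c d
    using "3.prems"(2) that by blast
  have "pf_list A (xs @ a # b # (zs @ ys)) = A a b * pf_list A (xs @ zs @ ys)"
  proof (rule pf_list_twin)
    fix c assume "c \<in> set (xs @ zs @ ys)"
    then show "A a c = A b c" "A c a = A c b"
      using "3.prems"(3,4) skew[of c a] skew[of c b] by auto
  next
    show "A b a = - A a b" by (rule skew) auto
  qed (use "3.prems"(1) in auto)
  moreover have "pf_list A (xs @ zs @ ys) = (if even (length zs) then pf_list A (xs @ ys) else 0)"
  proof (rule "3.IH"(1))
    show "A d c = - A c d" if "c \<in> set zs" "d \<in> set zs" for c d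
      using that by (intro skew) auto
  qed (use "3.prems"(1,3,4) in auto)
  ultimately show ?case using "3.prems"(3) by simp
qed simp

text \<open>The last pair of \<open>ps\<close> is innermost in the list, so its two labels are
  adjacent. Both rows vanish outside the pair, which makes the labels twins with entry 1; the pairs
  are stripped from the inside outwards.\<close>

lemma pf_list_nested:
  assumes "\<And>c d. c \<in> set (map fst ps) \<Longrightarrow> d \<in> set (map fst ps) \<Longrightarrow> A c d = 0"
    and "\<And>c d. c \<in> set (map snd ps) \<Longrightarrow> d \<in> set (map snd ps) \<Longrightarrow> A c d = 0"
    and "\<And>i j. i < length ps \<Longrightarrow> j < length ps \<Longrightarrow> A (fst (ps ! i)) (snd (ps ! j)) = (if i = j then 1 else 0)"
    and "\<And>i j. i < length ps \<Longrightarrow> j < length ps \<Longrightarrow> A (snd (ps ! i)) (fst (ps ! j)) = (if i = j then - 1 else 0)"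
  shows "pf_list A (map fst ps @ rev (map snd ps)) = 1"
  using assms
proof (induction ps rule: rev_induct)
  case (snoc p ps)
  note zero = snoc.prems(1,2) and fs = snoc.prems(3) and sf = snoc.prems(4)
  have fs': "A (fst p) (snd p) = 1" "A (snd p) (fst p) = - 1"
    using fs[of "length ps" "length ps"] sf[of "length ps" "length ps"] by (auto simp: nth_append)
  have off: "A (fst p) (snd q) = 0 \<and> A (snd q) (fst p) = 0 \<and> A (snd p) (fst q) = 0 \<and> A (fst q) (snd p) = 0"
    if q: "q \<in> set ps" for q
  proof -
    obtain i where "i < length ps" "q = ps ! i" using q by (auto simp: in_set_conv_nth)
    then show ?thesis
      using fs[of i "length ps"] sf[of i "length ps"] fs[of "length ps" i] sf[of "length ps" i]
      by (simp add: nth_append)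
  qed
  have twin: "A (fst p) c = A (snd p) c \<and> A c (fst p) = A c (snd p)"
    if c: "c \<in> set (map fst ps @ rev (map snd ps))" for c
  proof -
    obtain q where "q \<in> set ps" "c = fst q \<or> c = snd q" using c by auto
    then show ?thesis
      using off[of q] zero(1)[of c "fst p"] zero(1)[of "fst p" c] zero(2)[of c "snd p"] zero(2)[of "snd p" c]
      by auto
  qed
  have "pf_list A (map fst ps @ fst p # snd p # rev (map snd ps))
      = A (fst p) (snd p) * pf_list A (map fst ps @ rev (map snd ps))"
    by (rule pf_list_twin) (use twin in \<open>simp_all add: fs'\<close>)
  also have "pf_list A (map fst ps @ rev (map snd ps)) = 1"
  proof (rule snoc.IH)
    fix i j assume "i < length ps" "j < length ps"
    then show "A (fst (ps ! i)) (snd (ps ! j)) = (if i = j then 1 else 0)"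
      "A (snd (ps ! i)) (fst (ps ! j)) = (if i = j then - 1 else 0)"
      using fs[of i j] sf[of i j] by (auto simp: nth_append)
  qed (use zero in auto)
  finally show ?case by (simp add: fs')
qed simp

section \<open>Expanding a Pfaffian over one choice per label\<close>

lemma sum_PiE_insert:
  assumes "a \<notin> S" "finite S" "\<And>x. x \<in> insert a S \<Longrightarrow> finite (X x)"
  shows "(\<Sum>f\<in>PiE (insert a S) X. g f) = (\<Sum>p\<in>X a. \<Sum>f\<in>PiE S X. g (f(a := p)))"
proof -
  have "(\<Sum>f\<in>PiE (insert a S) X. g f) = (\<Sum>(p, f)\<in>X a \<times> PiE S X. g (f(a := p)))"
    unfolding PiE_insert_eq
    by (subst sum.reindex[OF inj_combinator[OF assms(1)]]) (simp add: comp_def case_prod_unfold)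
  also have "\<dots> = (\<Sum>p\<in>X a. \<Sum>f\<in>PiE S X. g (f(a := p)))"
    by (simp add: sum.cartesian_product)
  finally show ?thesis .
qed

text \<open>Distributivity. Injectivity of \<open>c\<close> makes the choices at different positions
  independent, so that they can be collected into one function on labels.\<close>

lemma prod_sum_pairs_eq_sum_PiE:
  fixes c :: "nat \<Rightarrow> 'a" and K :: "'a \<Rightarrow> 'a \<Rightarrow> 'b \<Rightarrow> 'b \<Rightarrow> real"
  assumes "inj_on c {..<2 * n}" "\<And>i. i < 2 * n \<Longrightarrow> finite (X (c i))"
  shows "(\<Prod>k<n. \<Sum>P\<in>X (c (2 * k)). \<Sum>Q\<in>X (c (2 * k + 1)). K (c (2 * k)) (c (2 * k + 1)) P Q)
    = (\<Sum>f\<in>PiE (c ` {..<2 * n}) X. \<Prod>k<n. K (c (2 * k)) (c (2 * k + 1)) (f (c (2 * k))) (f (c (2 * k + 1))))"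
  using assms
proof (induction n)
  case (Suc n)
  let ?S = "c ` {..<2 * n}" and ?a = "c (2 * n)" and ?b = "c (2 * n + 1)"
  let ?G = "\<lambda>f. \<Prod>k<n. K (c (2 * k)) (c (2 * k + 1)) (f (c (2 * k))) (f (c (2 * k + 1)))"
  have S: "c ` {..<2 * Suc n} = insert ?b (insert ?a ?S)"
    by (auto simp: lessThan_Suc)
  have ne: "c i = c j \<longleftrightarrow> i = j" if "i < 2 * Suc n" "j < 2 * Suc n" for i j
    using Suc.prems(1) that by (auto simp: inj_on_def)
  have notin: "?a \<notin> ?S" "?b \<notin> insert ?a ?S"
    using ne by auto
  have fin: "finite (X x)" if "x \<in> insert ?b (insert ?a ?S)" for x
    using that Suc.prems(2) by (auto simp flip: S)
  have G: "?G (f(?a := P, ?b := Q)) = ?G f" for f P Q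
    by (intro prod.cong refl) (auto simp: ne)
  have "(\<Sum>f\<in>PiE (c ` {..<2 * Suc n}) X. ?G f * K ?a ?b (f ?a) (f ?b))
      = (\<Sum>Q\<in>X ?b. \<Sum>P\<in>X ?a. \<Sum>f\<in>PiE ?S X. ?G f * K ?a ?b P Q)"
    unfolding S
    by (subst sum_PiE_insert[OF notin(2)], use fin in simp, use fin in blast,
        subst sum_PiE_insert[OF notin(1)], use fin in simp, use fin in blast,
        intro sum.cong refl arg_cong2[where f = "(*)"], simp_all only: G)
       (use ne[of "2 * n" "2 * n + 1"] in auto)
  also have "\<dots> = (\<Sum>P\<in>X ?a. \<Sum>Q\<in>X ?b. \<Sum>f\<in>PiE ?S X. ?G f * K ?a ?b P Q)"
    by (rule sum.swap)
  also have "\<dots> = (\<Sum>f\<in>PiE ?S X. ?G f) * (\<Sum>P\<in>X ?a. \<Sum>Q\<in>X ?b. K ?a ?b P Q)"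
    by (simp only: sum_distrib_left[symmetric] sum_distrib_right[symmetric])
  also have "(\<Sum>f\<in>PiE ?S X. ?G f)
      = (\<Prod>k<n. \<Sum>P\<in>X (c (2 * k)). \<Sum>Q\<in>X (c (2 * k + 1)). K (c (2 * k)) (c (2 * k + 1)) P Q)"
    using Suc.prems by (intro Suc.IH[symmetric]) (auto simp: inj_on_def)
  finally show ?case by simp
qed simp

lemma prod_lessThan_pairs:
  fixes n :: nat
  shows "(\<Prod>i<2 * n. g i) = (\<Prod>k<n. g (2 * k) * g (2 * k + 1) :: real)"
  by (induction n) (auto simp: mult.assoc)

text \<open>Each term of the Pfaffian uses every label once and so expands over one choice per
  label. Neither the set of choices nor the total weight depends on the permutation, hence the two
  summations can be exchanged.\<close>

lemma pf_list_sum_kernel: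
  assumes dist: "distinct xs" and even: "even (length xs)" and fin: "\<And>a. a \<in> set xs \<Longrightarrow> finite (X a)"
  shows "pf_list (\<lambda>a b. \<Sum>P\<in>X a. \<Sum>Q\<in>X b. W a P * W b Q * K a b P Q) xs
    = (\<Sum>f\<in>PiE (set xs) X. (\<Prod>a\<in>set xs. W a (f a)) * pf_list (\<lambda>a b. K a b (f a) (f b)) xs)"
proof -
  define n where "n = length xs div 2"
  have n: "length xs = 2 * n" using even by (simp add: n_def)
  let ?M = "\<lambda>a b. \<Sum>P\<in>X a. \<Sum>Q\<in>X b. W a P * W b Q * K a b P Q"
  let ?w = "\<lambda>f. \<Prod>a\<in>set xs. W a (f a)"
  let ?p = "\<lambda>f \<sigma>. \<Prod>i<n. K (xs ! \<sigma> (2 * i)) (xs ! \<sigma> (2 * i + 1)) (f (xs ! \<sigma> (2 * i))) (f (xs ! \<sigma> (2 * i + 1)))"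
  have expand: "(\<Prod>i<n. ?M (xs ! \<sigma> (2 * i)) (xs ! \<sigma> (2 * i + 1))) = (\<Sum>f\<in>PiE (set xs) X. ?w f * ?p f \<sigma>)"
    if \<sigma>: "\<sigma> permutes {..<2 * n}" for \<sigma>
  proof -
    define c where "c = (\<lambda>i. xs ! \<sigma> i)"
    have "inj_on ((!) xs) {..<2 * n}"
      by (rule inj_on_nth) (use dist n in auto)
    then have inj: "inj_on c {..<2 * n}"
      using comp_inj_on[of \<sigma> "{..<2 * n}" "(!) xs"] permutes_inj_on[OF \<sigma>] permutes_image[OF \<sigma>]
      by (simp add: c_def comp_def)
    have "c ` {..<2 * n} = (!) xs ` {..<2 * n}"
      unfolding c_def by (simp only: permutes_image[OF \<sigma>] flip: image_image)
    then have img: "c ` {..<2 * n} = set xs"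
      by (simp add: set_conv_nth n image_def Bex_def conj_commute)
    have w: "?w f = (\<Prod>k<n. W (c (2 * k)) (f (c (2 * k))) * W (c (2 * k + 1)) (f (c (2 * k + 1))))" for f
      unfolding img[symmetric] by (subst prod.reindex[OF inj]) (simp only: prod_lessThan_pairs comp_def)
    have "(\<Prod>i<n. ?M (c (2 * i)) (c (2 * i + 1)))
      = (\<Sum>f\<in>PiE (c ` {..<2 * n}) X. \<Prod>k<n. W (c (2 * k)) (f (c (2 * k))) * W (c (2 * k + 1)) (f (c (2 * k + 1)))
           * K (c (2 * k)) (c (2 * k + 1)) (f (c (2 * k))) (f (c (2 * k + 1))))"
    proof (rule prod_sum_pairs_eq_sum_PiE[OF inj])
      show "finite (X (c i))" if "i < 2 * n" for i
        using that img fin by auto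
    qed
    also have "\<dots> = (\<Sum>f\<in>PiE (set xs) X. ?w f * ?p f \<sigma>)"
      unfolding img w by (simp only: prod.distrib c_def)
    finally show ?thesis by (simp only: c_def)
  qed
  have "pf_sum n (\<lambda>i j. ?M (xs ! i) (xs ! j))
      = (\<Sum>\<sigma> | \<sigma> permutes {..<2 * n}. \<Sum>f\<in>PiE (set xs) X. ?w f * (of_int (sign \<sigma>) * ?p f \<sigma>))"
    unfolding pf_sum_def
    by (intro sum.cong refl) (simp only: expand mem_Collect_eq sum_distrib_left mult.left_commute)
  also have "\<dots> = (\<Sum>f\<in>PiE (set xs) X. ?w f * pf_sum n (\<lambda>i j. K (xs ! i) (xs ! j) (f (xs ! i)) (f (xs ! j))))"
    by (subst sum.swap) (simp only: pf_sum_def sum_distrib_left)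
  finally show ?thesis
    by (simp add: pf_list_def n sum_divide_distrib)
qed

section \<open>Exchanging the tails of two paths\<close>

abbreviation src :: "'v \<times> 'e list \<times> 'v \<Rightarrow> 'v" where "src P \<equiv> fst P"
abbreviation trg :: "'v \<times> 'e list \<times> 'v \<Rightarrow> 'v" where "trg P \<equiv> snd (snd P)"
abbreviation arc_list :: "'v \<times> 'e list \<times> 'v \<Rightarrow> 'e list" where "arc_list P \<equiv> fst (snd P)"

definition is_path :: "('v, 'e) pre_digraph \<Rightarrow> 'v \<times> 'e list \<times> 'v \<Rightarrow> bool" where
  "is_path D P \<longleftrightarrow> pre_digraph.apath D (src P) (arc_list P) (trg P)"

text \<open>The head of \<open>P\<close> up to \<open>z\<close> is continued by the tail of
  \<open>Q\<close> from \<open>z\<close>. Cutting at the first arc that leaves \<open>z\<close> also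
  covers a path ending in \<open>z\<close>: no arc of it leaves \<open>z\<close>, so the head is the
  whole path and the tail is empty.\<close>

definition graft ::
  "('v, 'e) pre_digraph \<Rightarrow> 'v \<Rightarrow> 'v \<times> 'e list \<times> 'v \<Rightarrow> 'v \<times> 'e list \<times> 'v \<Rightarrow> 'v \<times> 'e list \<times> 'v" where
  "graft D z P Q = (src P,
     takeWhile (\<lambda>e. tail D e \<noteq> z) (arc_list P) @ dropWhile (\<lambda>e. tail D e \<noteq> z) (arc_list Q), trg Q)"

lemma src_graft [simp]: "src (graft D z P Q) = src P"
  and trg_graft [simp]: "trg (graft D z P Q) = trg Q"
  by (simp_all add: graft_def)

lemma takeWhile_dropWhile_eq_Nil: "takeWhile R (dropWhile R q) = []"
  by (induction q) auto

lemma takeWhile_takeWhile_append_dropWhile: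
  "takeWhile R (takeWhile R p @ dropWhile R q) = takeWhile R p"
  by (induction p) (auto simp: takeWhile_dropWhile_eq_Nil)

lemma dropWhile_takeWhile_append_dropWhile:
  "dropWhile R (takeWhile R p @ dropWhile R q) = dropWhile R q"
  by (induction p) (auto simp: takeWhile_dropWhile_eq_Nil)

text \<open>The place of the cut survives: no arc of a head leaves \<open>z\<close>, and a tail is
  empty or begins with an arc leaving \<open>z\<close>. Hence this is an identity for arbitrary arc
  lists.\<close>

lemma graft_graft [simp]: "graft D z (graft D z P Q) (graft D z Q P) = P"
  by (simp add: graft_def takeWhile_takeWhile_append_dropWhile dropWhile_takeWhile_append_dropWhile)

lemma graft_weight:
  "path_weight w (arc_list (graft D z P Q)) * path_weight w (arc_list (graft D z Q P))
    = path_weight w (arc_list P) * path_weight w (arc_list Q)"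
proof -
  have "path_weight w p = path_weight w (takeWhile R p) * path_weight w (dropWhile R p)" for p and R :: "_ \<Rightarrow> bool"
    unfolding path_weight_def
    by (simp only: prod_list.append[symmetric] map_append[symmetric] takeWhile_dropWhile_id)
  from this[of "arc_list P" "\<lambda>e. tail D e \<noteq> z"] this[of "arc_list Q" "\<lambda>e. tail D e \<noteq> z"] show ?thesis
    by (simp add: graft_def path_weight_def)
qed

section \<open>Walks and paths in an acyclic digraph\<close>

context wf_digraph
begin

lemma awalk_verts_reachable:
  "awalk x p y \<Longrightarrow> z \<in> set (awalk_verts x p) \<Longrightarrow> (x, z) \<in> (arcs_ends G)\<^sup>*"
proof (induction p arbitrary: x)
  case (Cons e p)
  then have e: "e \<in> arcs G" "x = tail G e" "awalk (head G e) p y"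
    by (auto simp: awalk_Cons_iff)
  show ?case
  proof (cases "z = x")
    case False
    with Cons.prems e have "(head G e, z) \<in> (arcs_ends G)\<^sup>*" by (intro Cons.IH) auto
    with e show ?thesis
      by (metis converse_rtrancl_into_rtrancl in_arcs_imp_in_arcs_ends)
  qed simp
qed simp

text \<open>A repeated vertex would close a directed cycle. Joining a head to a foreign tail yields
  at first only a walk, and this turns it back into a path.\<close>

lemma acyclic_awalk_imp_apath:
  assumes "acyclic (arcs_ends G)"
  shows "awalk x p y \<Longrightarrow> apath x p y"
proof (induction p arbitrary: x)
  case (Cons e p)
  then have e: "e \<in> arcs G" "x = tail G e" "awalk (head G e) p y"
    by (auto simp: awalk_Cons_iff)
  have "tail G e \<notin> set (awalk_verts (head G e) p)"
  proof
    assume "tail G e \<in> set (awalk_verts (head G e) p)"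
    then have "(head G e, tail G e) \<in> (arcs_ends G)\<^sup>*"
      using awalk_verts_reachable e by blast
    then have "(tail G e, tail G e) \<in> (arcs_ends G)\<^sup>+"
      using in_arcs_imp_in_arcs_ends[OF e(1)] by (rule rtrancl_into_trancl2[rotated])
    with assms show False by (auto simp: acyclic_def)
  qed
  with e Cons.IH show ?case by (auto simp: apath_Cons_iff)
qed (simp add: awalk_Nil_iff apath_Nil_iff)

lemma awalk_split_at_vertex:
  "awalk x p y \<Longrightarrow> z \<in> set (awalk_verts x p) \<Longrightarrow>
    awalk x (takeWhile (\<lambda>e. tail G e \<noteq> z) p) z \<and> awalk z (dropWhile (\<lambda>e. tail G e \<noteq> z) p) y"
  by (induction p arbitrary: x) (auto simp: awalk_simps)

lemma apath_append_inter:
  assumes "apath x (p @ q) y" "awalk x p z" "awalk z q y"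
  shows "set (awalk_verts x p) \<inter> set (awalk_verts z q) = {z}"
proof -
  have last: "awlast x p = z" using assms(2) by auto
  have "hd (awalk_verts z q) = z" using assms(3) by auto
  then have "awalk_verts z q = z # tl (awalk_verts z q)"
    by (metis awalk_verts_non_Nil list.collapse)
  then have "set (awalk_verts z q) = insert z (set (tl (awalk_verts z q)))"
    by (metis list.simps(15))
  moreover have "z \<in> set (awalk_verts x p)" using last by (metis awalk_verts_non_Nil last_in_set)
  ultimately show ?thesis
    using assms(1) unfolding apath_append_iff last by auto
qed

end

text \<open>The last claim counts how many of the two paths contain a given vertex. All four
  combinations of a head with a tail are paths, so in each of them the two pieces meet in
  \<open>z\<close> alone. A vertex other than \<open>z\<close> is therefore counted once for every
  one of the four pieces containing it, both before and after the exchange.\<close>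

lemma graft_path:
  fixes D :: "('v, 'e) pre_digraph"
  assumes "wf_digraph D" "acyclic (arcs_ends D)" "is_path D P" "is_path D Q"
    "z \<in> path_vertices D P" "z \<in> path_vertices D Q"
  shows "is_path D (graft D z P Q)" "z \<in> path_vertices D (graft D z P Q)"
    "of_bool (y \<in> path_vertices D (graft D z P Q)) + of_bool (y \<in> path_vertices D (graft D z Q P))
      = (of_bool (y \<in> path_vertices D P) + of_bool (y \<in> path_vertices D Q) :: nat)"
proof -
  interpret wf_digraph D by fact
  define A1 where "A1 P = set (awalk_verts (src P) (takeWhile (\<lambda>e. tail D e \<noteq> z) (arc_list P)))" for P :: "'v \<times> 'e list \<times> 'v"
  define A2 where "A2 P = set (awalk_verts z (dropWhile (\<lambda>e. tail D e \<noteq> z) (arc_list P)))" for P :: "'v \<times> 'e list \<times> 'v"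
  have main: "is_path D (graft D z P Q) \<and> path_vertices D (graft D z P Q) = A1 P \<union> A2 Q \<and> A1 P \<inter> A2 Q = {z}"
    if "is_path D P" "is_path D Q" "z \<in> path_vertices D P" "z \<in> path_vertices D Q" for P Q
  proof -
    have 1: "awalk (src P) (takeWhile (\<lambda>e. tail D e \<noteq> z) (arc_list P)) z"
      using that awalk_split_at_vertex[of "src P" "arc_list P" "trg P" z]
      by (auto simp: is_path_def path_vertices_def apath_def case_prod_unfold)
    have 2: "awalk z (dropWhile (\<lambda>e. tail D e \<noteq> z) (arc_list Q)) (trg Q)"
      using that awalk_split_at_vertex[of "src Q" "arc_list Q" "trg Q" z]
      by (auto simp: is_path_def path_vertices_def apath_def case_prod_unfold)
    have 3: "is_path D (graft D z P Q)"
      using acyclic_awalk_imp_apath[OF assms(2) awalk_appendI[OF 1 2]] by (simp add: is_path_def graft_def)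
    then have "A1 P \<inter> A2 Q = {z}"
      unfolding A1_def A2_def using 1 2
      by (intro apath_append_inter) (auto simp: is_path_def graft_def)
    moreover have "path_vertices D (graft D z P Q) = A1 P \<union> A2 Q"
      using set_awalk_verts_append[OF 1 2] by (simp add: path_vertices_def graft_def A1_def A2_def)
    ultimately show ?thesis using 3 by blast
  qed
  \<comment> \<open>A path is its own graft, so \<open>main\<close> also splits \<open>P\<close> and
    \<open>Q\<close> themselves into head and tail.\<close>
  have self: "graft D z P P = P" for P :: "'v \<times> 'e list \<times> 'v" by (simp add: graft_def)
  note PQ = main[OF assms(3-6)] and QP = main[OF assms(4,3,6,5)]
    and PP = main[OF assms(3,3,5,5), unfolded self] and QQ = main[OF assms(4,4,6,6), unfolded self]
  show "is_path D (graft D z P Q)" "z \<in> path_vertices D (graft D z P Q)"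
    using PQ by auto
  show "of_bool (y \<in> path_vertices D (graft D z P Q)) + of_bool (y \<in> path_vertices D (graft D z Q P))
      = (of_bool (y \<in> path_vertices D P) + of_bool (y \<in> path_vertices D Q) :: nat)"
    using PQ QP PP QQ by (cases "y = z") (auto simp: set_eq_iff of_bool_def)
qed

section \<open>Path systems and their configurations\<close>

text \<open>The labels of the rows and columns; \<open>SrcEnd\<close> and \<open>SnkEnd\<close> label the borders.\<close>

datatype terminal = Src nat | SrcEnd | Snk nat | SnkEnd

locale path_system =
  fixes D :: "('v, 'e) pre_digraph" and w :: "'e \<Rightarrow> real"
    and r s :: nat and u v :: "nat \<Rightarrow> 'v"
    and I J :: "'v set" and leI leJ :: "'v rel"
  assumes wf_D: "wf_digraph D" and acyclic_D: "acyclic (arcs_ends D)"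
    and w_pos: "\<And>e. e \<in> arcs D \<Longrightarrow> w e > 0"
    and inj_u: "inj_on u {1..r}" and inj_v: "inj_on v {1..s}"
    and linear_I: "linear_order_on I leI" and linear_J: "linear_order_on J leJ"
    and J_u: "J \<inter> u ` {1..r} = {}" and v_I: "v ` {1..s} \<inter> I = {}"
    and compat: "D_compatible D (order_concat leJ (seq_order r u)) (order_concat (seq_order s v) leI)"
    and separated: "D_separated D J (u ` {1..r}) (v ` {1..s}) I"
begin

abbreviation "V \<equiv> path_vertices D"

abbreviation weight :: "'v \<times> 'e list \<times> 'v \<Rightarrow> real" where "weight P \<equiv> path_weight w (arc_list P)"

lemma u_eq_iff: "i \<in> {1..r} \<Longrightarrow> j \<in> {1..r} \<Longrightarrow> u i = u j \<longleftrightarrow> i = j"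
  by (rule inj_on_eq_iff[OF inj_u])

lemma v_eq_iff: "i \<in> {1..s} \<Longrightarrow> j \<in> {1..s} \<Longrightarrow> v i = v j \<longleftrightarrow> i = j"
  by (rule inj_on_eq_iff[OF inj_v])

lemma u_notin_J: "i \<in> {1..r} \<Longrightarrow> u i \<notin> J"
  using J_u by blast

lemma v_notin_I: "i \<in> {1..s} \<Longrightarrow> v i \<notin> I"
  using v_I by blast

text \<open>The matrix entry stripped of weights, for one path chosen at each of two labels. Two
  sinks are compared in the reverse order because \<open>terminals\<close> lists them decreasingly.
  A border label behaves like a further path whose end lies above all of \<open>I\<close>, or whose
  start lies below all of \<open>J\<close>.\<close>

fun pairing :: "terminal \<Rightarrow> terminal \<Rightarrow> 'v \<times> 'e list \<times> 'v \<Rightarrow> 'v \<times> 'e list \<times> 'v \<Rightarrow> real" where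
  "pairing (Src _) (Src _) P Q = (if trg P \<in> I \<and> trg Q \<in> I then order_sgn leI (trg P) (trg Q) else 0)"
| "pairing (Snk _) (Snk _) P Q = (if src P \<in> J \<and> src Q \<in> J then order_sgn leJ (src Q) (src P) else 0)"
| "pairing (Src _) (Snk _) P Q = of_bool (P = Q)"
| "pairing (Snk _) (Src _) P Q = - of_bool (P = Q)"
| "pairing (Src _) SrcEnd P Q = of_bool (trg P \<in> I)"
| "pairing SrcEnd (Src _) P Q = - of_bool (trg Q \<in> I)"
| "pairing (Snk _) SnkEnd P Q = of_bool (src P \<in> J)"
| "pairing SnkEnd (Snk _) P Q = - of_bool (src Q \<in> J)"
| "pairing _ _ _ _ = 0"

text \<open>A path from \<open>u\<close> to \<open>v\<close> occurs at both of its ends but must be counted once.\<close>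

fun terminal_weight :: "terminal \<Rightarrow> 'v \<times> 'e list \<times> 'v \<Rightarrow> real" where
  "terminal_weight (Src _) P = weight P"
| "terminal_weight (Snk _) P = (if src P \<in> J then weight P else 1)"
| "terminal_weight _ _ = 1"

text \<open>With the sinks reversed, pairs matched in increasing order are nested in this list, and
  each border label directly follows the paths to \<open>I\<close> or from \<open>J\<close> that it
  completes.\<close>

definition terminals :: "bool \<Rightarrow> bool \<Rightarrow> terminal list" where
  "terminals \<alpha> \<beta> = map Src [1..<Suc r] @ (if \<alpha> then [SrcEnd] else []) @
     rev (map Snk [1..<Suc s]) @ (if \<beta> then [SnkEnd] else [])"

lemma set_terminals:
  "set (terminals \<alpha> \<beta>) = Src ` {1..r} \<union> Snk ` {1..s} \<union> (if \<alpha> then {SrcEnd} else {}) \<union> (if \<beta> then {SnkEnd} else {})"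
  by (auto simp: terminals_def)

lemma distinct_terminals: "distinct (terminals \<alpha> \<beta>)"
  by (auto simp: terminals_def distinct_map inj_on_def)

text \<open>A border label has no path to choose; its one dummy value contributes a factor 1. Taking
  \<open>undefined\<close> makes it agree with the default value of extensional functions, so that a
  choice is determined by its values on the proper labels.\<close>

fun slot :: "('v \<times> 'e list \<times> 'v) set \<Rightarrow> terminal \<Rightarrow> ('v \<times> 'e list \<times> 'v) set" where
  "slot Z (Src i) = {P \<in> Z. src P = u i \<and> trg P \<in> v ` {1..s} \<union> I}"
| "slot Z (Snk j) = {P \<in> Z. trg P = v j \<and> src P \<in> u ` {1..r} \<union> J}"
| "slot Z _ = {undefined}"

definition entry :: "('v \<times> 'e list \<times> 'v) set \<Rightarrow> terminal \<Rightarrow> terminal \<Rightarrow> real" where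
  "entry Z a b = (\<Sum>P\<in>slot Z a. \<Sum>Q\<in>slot Z b. terminal_weight a P * terminal_weight b Q * pairing a b P Q)"

text \<open>As an image this is a set, so a path held by both of its ends occurs once, as in
  \<open>P_zero\<close>.\<close>

definition fam :: "(terminal \<Rightarrow> 'v \<times> 'e list \<times> 'v) \<Rightarrow> ('v \<times> 'e list \<times> 'v) set" where
  "fam f = f ` (Src ` {1..r} \<union> Snk ` {1..s})"

text \<open>The third condition is agreement: a path with a labelled end on either side must also be
  the one chosen there. Consequently, equality of the paths at a source and a sink can be read off
  from an endpoint.\<close>

definition routing :: "(terminal \<Rightarrow> 'v \<times> 'e list \<times> 'v) \<Rightarrow> bool" where
  "routing f \<longleftrightarrow>
     (\<forall>i\<in>{1..r}. is_path D (f (Src i)) \<and> src (f (Src i)) = u i \<and> trg (f (Src i)) \<in> v ` {1..s} \<union> I) \<and>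
     (\<forall>j\<in>{1..s}. is_path D (f (Snk j)) \<and> trg (f (Snk j)) = v j \<and> src (f (Snk j)) \<in> u ` {1..r} \<union> J) \<and>
     (\<forall>i\<in>{1..r}. \<forall>j\<in>{1..s}. trg (f (Src i)) = v j \<or> src (f (Snk j)) = u i \<longrightarrow> f (Src i) = f (Snk j))"

lemma routing_Src:
  assumes "routing f" "i \<in> {1..r}"
  shows "is_path D (f (Src i))" "src (f (Src i)) = u i" "trg (f (Src i)) \<in> v ` {1..s} \<union> I"
  using assms by (auto simp: routing_def)

lemma routing_Snk:
  assumes "routing f" "j \<in> {1..s}"
  shows "is_path D (f (Snk j))" "trg (f (Snk j)) = v j" "src (f (Snk j)) \<in> u ` {1..r} \<union> J"
  using assms by (auto simp: routing_def)

lemma routing_trg_iff: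
  assumes "routing f" "i \<in> {1..r}" "j \<in> {1..s}"
  shows "f (Src i) = f (Snk j) \<longleftrightarrow> trg (f (Src i)) = v j"
  using assms unfolding routing_def by metis

lemma routing_src_iff:
  assumes "routing f" "i \<in> {1..r}" "j \<in> {1..s}"
  shows "f (Src i) = f (Snk j) \<longleftrightarrow> src (f (Snk j)) = u i"
  using assms unfolding routing_def by metis

lemma finite_fam: "finite (fam f)"
  by (simp add: fam_def)

lemma fam_cases:
  assumes "x \<in> fam f"
  obtains i where "i \<in> {1..r}" "x = f (Src i)" | j where "j \<in> {1..s}" "x = f (Snk j)"
  using assms by (auto simp: fam_def)

lemma Src_in_fam: "i \<in> {1..r} \<Longrightarrow> f (Src i) \<in> fam f"
  and Snk_in_fam: "j \<in> {1..s} \<Longrightarrow> f (Snk j) \<in> fam f"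
  by (auto simp: fam_def)

lemma fam_src:
  assumes "routing f" "x \<in> fam f" "i \<in> {1..r}" "src x = u i"
  shows "x = f (Src i)"
  using assms(2)
proof (cases rule: fam_cases)
  case (1 k)
  then show ?thesis using assms routing_Src(2)[OF assms(1), of k] u_eq_iff[of k i] by auto
next
  case (2 j)
  then show ?thesis using assms routing_src_iff[of f i j] by auto
qed

lemma fam_trg:
  assumes "routing f" "x \<in> fam f" "j \<in> {1..s}" "trg x = v j"
  shows "x = f (Snk j)"
  using assms(2)
proof (cases rule: fam_cases)
  case (1 i)
  then show ?thesis using assms routing_trg_iff[of f i j] by auto
next
  case (2 k)
  then show ?thesis using assms routing_Snk(2)[OF assms(1), of k] v_eq_iff[of k j] by auto
qed

lemma fam_ends:
  assumes "routing f" "x \<in> fam f"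
  shows "is_path D x" "src x \<in> u ` {1..r} \<union> J" "trg x \<in> v ` {1..s} \<union> I"
    "src x \<in> u ` {1..r} \<or> trg x \<in> v ` {1..s}"
proof -
  have "is_path D x \<and> src x \<in> u ` {1..r} \<union> J \<and> trg x \<in> v ` {1..s} \<union> I \<and>
      (src x \<in> u ` {1..r} \<or> trg x \<in> v ` {1..s})"
    using assms(2)
  proof (cases rule: fam_cases)
    case (1 i)
    then show ?thesis using routing_Src[OF assms(1) 1(1)] by simp
  next
    case (2 j)
    then show ?thesis using routing_Snk[OF assms(1) 2(1)] by simp
  qed
  then show "is_path D x" "src x \<in> u ` {1..r} \<union> J" "trg x \<in> v ` {1..s} \<union> I"
    "src x \<in> u ` {1..r} \<or> trg x \<in> v ` {1..s}"
    by blast+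
qed

text \<open>Suppose the path at \<open>Src i\<close> ends in \<open>v j\<close> while
  \<open>Snk j\<close> holds another one. It does not end in \<open>I\<close>, so it pairs with no
  source and no border; by its end it could coincide only with the path at \<open>Snk j\<close>,
  which is excluded. The other kind of disagreement is symmetric.\<close>

lemma pairing_not_routing_zero_row:
  assumes "f \<in> PiE (set (terminals \<alpha> \<beta>)) (slot Z)" "\<And>P. P \<in> Z \<Longrightarrow> is_path D P" "\<not> routing f"
  shows "\<exists>a\<in>set (terminals \<alpha> \<beta>). \<forall>b\<in>set (terminals \<alpha> \<beta>). pairing a b (f a) (f b) = 0 \<and> pairing b a (f b) (f a) = 0"
proof -
  have Src: "f (Src i) \<in> slot Z (Src i)" if "i \<in> {1..r}" for i
    using that by (intro PiE_mem[OF assms(1)]) (auto simp: set_terminals)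
  have Snk: "f (Snk j) \<in> slot Z (Snk j)" if "j \<in> {1..s}" for j
    using that by (intro PiE_mem[OF assms(1)]) (auto simp: set_terminals)
  obtain i j where ij: "i \<in> {1..r}" "j \<in> {1..s}" "f (Src i) \<noteq> f (Snk j)"
      "trg (f (Src i)) = v j \<or> src (f (Snk j)) = u i"
  proof -
    have "is_path D (f (Src i)) \<and> src (f (Src i)) = u i \<and> trg (f (Src i)) \<in> v ` {1..s} \<union> I"
      if "i \<in> {1..r}" for i
      using Src[OF that] assms(2)[of "f (Src i)"] by simp
    moreover have "is_path D (f (Snk j)) \<and> trg (f (Snk j)) = v j \<and> src (f (Snk j)) \<in> u ` {1..r} \<union> J"
      if "j \<in> {1..s}" for j
      using Snk[OF that] assms(2)[of "f (Snk j)"] by simp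
    ultimately show thesis
      using assms(3) that unfolding routing_def by blast
  qed
  from ij(4) show ?thesis
  proof
    assume trg: "trg (f (Src i)) = v j"
    then have "trg (f (Src i)) \<notin> I" using v_notin_I ij by auto
    moreover have "f (Src i) \<noteq> f (Snk k) \<and> f (Snk k) \<noteq> f (Src i)" if "k \<in> {1..s}" for k
      using Snk[OF that] trg ij v_eq_iff[of j k] that by auto
    ultimately show ?thesis
      using ij(1) by (intro bexI[of _ "Src i"]) (auto simp: set_terminals split: if_splits)
  next
    assume src: "src (f (Snk j)) = u i"
    then have "src (f (Snk j)) \<notin> J" using u_notin_J ij by auto
    moreover have "f (Src k) \<noteq> f (Snk j) \<and> f (Snk j) \<noteq> f (Src k)" if "k \<in> {1..r}" for k
      using Src[OF that] src ij u_eq_iff[of i k] that by auto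
    ultimately show ?thesis
      using ij(2) by (intro bexI[of _ "Snk j"]) (auto simp: set_terminals split: if_splits)
  qed
qed

lemma pf_list_not_routing:
  assumes "even (length (terminals \<alpha> \<beta>))"
    "f \<in> PiE (set (terminals \<alpha> \<beta>)) (slot Z)" "\<And>P. P \<in> Z \<Longrightarrow> is_path D P" "\<not> routing f"
  shows "pf_list (\<lambda>a b. pairing a b (f a) (f b)) (terminals \<alpha> \<beta>) = 0"
proof -
  obtain a where "a \<in> set (terminals \<alpha> \<beta>)"
    "\<And>b. b \<in> set (terminals \<alpha> \<beta>) \<Longrightarrow> pairing a b (f a) (f b) = 0 \<and> pairing b a (f b) (f a) = 0"
    using pairing_not_routing_zero_row[OF assms(2) _ assms(4)] assms(3) by blast
  then show ?thesis by (intro pf_list_zero_row[OF assms(1), of a]) auto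
qed

text \<open>Each path is charged to its source label if it starts in \<open>u\<close>, and otherwise
  to its sink label. On these labels \<open>f\<close> is injective with image \<open>fam f\<close>,
  and all remaining labels have weight 1.\<close>

lemma prod_terminal_weight:
  assumes "routing f"
  shows "(\<Prod>a\<in>set (terminals \<alpha> \<beta>). terminal_weight a (f a)) = (\<Prod>P\<in>fam f. weight P)"
proof -
  let ?A = "Src ` {1..r}" and ?B = "Snk ` {j \<in> {1..s}. src (f (Snk j)) \<in> J}"
  have "(\<Prod>a\<in>set (terminals \<alpha> \<beta>). terminal_weight a (f a)) = (\<Prod>a\<in>?A \<union> ?B. terminal_weight a (f a))"
    by (rule prod.mono_neutral_right) (auto simp: set_terminals split: if_splits)
  also have "\<dots> = (\<Prod>a\<in>?A \<union> ?B. weight (f a))"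
    by (rule prod.cong) auto
  also have "\<dots> = (\<Prod>P\<in>f ` (?A \<union> ?B). weight P)"
  proof (rule prod.reindex_cong[symmetric, OF _ refl refl])
    show "inj_on f (?A \<union> ?B)"
    proof (rule inj_onI)
      fix a b assume ab: "a \<in> ?A \<union> ?B" "b \<in> ?A \<union> ?B" "f a = f b"
      show "a = b"
        using ab routing_Src(2)[OF assms] routing_Snk(2)[OF assms] u_eq_iff v_eq_iff u_notin_J
        by auto metis+
    qed
  qed
  also have "f ` (?A \<union> ?B) = fam f"
  proof
    show "f ` (?A \<union> ?B) \<subseteq> fam f" by (auto simp: fam_def)
    show "fam f \<subseteq> f ` (?A \<union> ?B)"
    proof
      fix x assume "x \<in> fam f"
      then show "x \<in> f ` (?A \<union> ?B)"
        using fam_ends(2)[OF assms \<open>x \<in> fam f\<close>] fam_src[OF assms \<open>x \<in> fam f\<close>]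
        by (auto elim!: fam_cases)
    qed
  qed
  finally show ?thesis .
qed

end

section \<open>The sign-reversing involution\<close>

context path_system
begin

text \<open>A source label keeps the start of its path and a sink label keeps the end, so the sink
  of \<open>P\<close> receives the graft of \<open>Q\<close> with \<open>P\<close>. Labels out of
  range are guarded because their value \<open>undefined\<close> could happen to equal
  \<open>P\<close> or \<open>Q\<close>.\<close>

definition swap_tails :: "'v \<Rightarrow> 'v \<times> 'e list \<times> 'v \<Rightarrow> 'v \<times> 'e list \<times> 'v \<Rightarrow>
    (terminal \<Rightarrow> 'v \<times> 'e list \<times> 'v) \<Rightarrow> terminal \<Rightarrow> 'v \<times> 'e list \<times> 'v" where
  "swap_tails z P Q f a = (case a of
     Src i \<Rightarrow> if i \<notin> {1..r} then f a
       else if f a = P then graft D z P Q else if f a = Q then graft D z Q P else f a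
   | Snk j \<Rightarrow> if j \<notin> {1..s} then f a
       else if f a = P then graft D z Q P else if f a = Q then graft D z P Q else f a
   | _ \<Rightarrow> f a)"

lemma swap_tails_Src:
  "i \<in> {1..r} \<Longrightarrow> swap_tails z P Q f (Src i) =
     (if f (Src i) = P then graft D z P Q else if f (Src i) = Q then graft D z Q P else f (Src i))"
  and swap_tails_Snk:
  "j \<in> {1..s} \<Longrightarrow> swap_tails z P Q f (Snk j) =
     (if f (Snk j) = P then graft D z Q P else if f (Snk j) = Q then graft D z P Q else f (Snk j))"
  by (simp_all only: swap_tails_def terminal.case if_False not_not simp_thms if_True)

lemma swap_tails_commute: "P \<noteq> Q \<Longrightarrow> swap_tails z P Q f = swap_tails z Q P f"
  by (rule ext) (auto simp: swap_tails_def split: terminal.split)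

end

text \<open>The condition \<open>side\<close> ensures that each of the two grafts has an end with a
  label to hold it, so that both stay in the family. A graft from \<open>J\<close> to
  \<open>I\<close> would be held by no label.\<close>

locale crossing = path_system +
  fixes f z P Q
  assumes f: "routing f" and P: "P \<in> fam f" "z \<in> V P" and Q: "Q \<in> fam f" "z \<in> V Q"
    and PQ: "P \<noteq> Q"
    and side: "src P \<in> u ` {1..r} \<and> src Q \<in> u ` {1..r} \<or> trg P \<in> v ` {1..s} \<and> trg Q \<in> v ` {1..s}"
begin

abbreviation (input) "P' \<equiv> graft D z P Q"
abbreviation (input) "Q' \<equiv> graft D z Q P"
abbreviation (input) "f' \<equiv> swap_tails z P Q f"

lemma paths: "is_path D P" "is_path D Q"
  using fam_ends(1)[OF f] P Q by auto

lemma grafts: "is_path D P'" "is_path D Q'" "z \<in> V P'" "z \<in> V Q'"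
  using graft_path[OF wf_D acyclic_D] paths P Q by blast+

lemma swap_Src: "i \<in> {1..r} \<Longrightarrow> f' (Src i) = (if f (Src i) = P then P' else if f (Src i) = Q then Q' else f (Src i))"
  by (rule swap_tails_Src)

lemma swap_Snk: "j \<in> {1..s} \<Longrightarrow> f' (Snk j) = (if f (Snk j) = P then Q' else if f (Snk j) = Q then P' else f (Snk j))"
  by (rule swap_tails_Snk)

text \<open>If a graft has labelled ends on both sides, its start was the start of one exchanged
  path and its end the end of the other. Agreement of \<open>f\<close> identifies the labels of
  these ends, and both receive this same graft.\<close>

lemma routing_swap: "routing f'"
  unfolding routing_def
proof (intro conjI ballI impI)
  fix i assume i: "i \<in> {1..r}"
  note R = routing_Src[OF f i]
  show "is_path D (f' (Src i))" "src (f' (Src i)) = u i" "trg (f' (Src i)) \<in> v ` {1..s} \<union> I"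
    unfolding swap_Src[OF i] using R grafts fam_ends(3)[OF f P(1)] fam_ends(3)[OF f Q(1)]
    by auto
next
  fix j assume j: "j \<in> {1..s}"
  note R = routing_Snk[OF f j]
  show "is_path D (f' (Snk j))" "trg (f' (Snk j)) = v j" "src (f' (Snk j)) \<in> u ` {1..r} \<union> J"
    unfolding swap_Snk[OF j] using R grafts fam_ends(2)[OF f P(1)] fam_ends(2)[OF f Q(1)]
    by auto
next
  fix i j assume ij: "i \<in> {1..r}" "j \<in> {1..s}" and or: "trg (f' (Src i)) = v j \<or> src (f' (Snk j)) = u i"
  have t: "P = f (Snk j)" if "trg P = v j" using fam_trg[OF f P(1) ij(2) that] .
  have t': "Q = f (Snk j)" if "trg Q = v j" using fam_trg[OF f Q(1) ij(2) that] .
  have s: "P = f (Src i)" if "src P = u i" using fam_src[OF f P(1) ij(1) that] .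
  have s': "Q = f (Src i)" if "src Q = u i" using fam_src[OF f Q(1) ij(1) that] .
  from or show "f' (Src i) = f' (Snk j)"
  proof
    assume a: "trg (f' (Src i)) = v j"
    consider "f (Src i) = P" | "f (Src i) = Q" | "f (Src i) \<noteq> P" "f (Src i) \<noteq> Q" by blast
    then show ?thesis
    proof cases
      case 1
      then show ?thesis using a t' PQ by (simp add: swap_tails_Src[OF ij(1)] swap_tails_Snk[OF ij(2)])
    next
      case 2
      then show ?thesis using a t PQ by (simp add: swap_tails_Src[OF ij(1)] swap_tails_Snk[OF ij(2)])
    next
      case 3
      then have "f (Snk j) = f (Src i)"
        using a routing_trg_iff[OF f ij] by (simp add: swap_tails_Src[OF ij(1)])
      with 3 show ?thesis by (simp add: swap_tails_Src[OF ij(1)] swap_tails_Snk[OF ij(2)])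
    qed
  next
    assume a: "src (f' (Snk j)) = u i"
    consider "f (Snk j) = P" | "f (Snk j) = Q" | "f (Snk j) \<noteq> P" "f (Snk j) \<noteq> Q" by blast
    then show ?thesis
    proof cases
      case 1
      then show ?thesis using a s' PQ by (simp add: swap_tails_Src[OF ij(1)] swap_tails_Snk[OF ij(2)])
    next
      case 2
      then show ?thesis using a s PQ by (simp add: swap_tails_Src[OF ij(1)] swap_tails_Snk[OF ij(2)])
    next
      case 3
      then have "f (Src i) = f (Snk j)"
        using a routing_src_iff[OF f ij] by (simp add: swap_tails_Snk[OF ij(2)])
      with 3 show ?thesis by (simp add: swap_tails_Src[OF ij(1)] swap_tails_Snk[OF ij(2)])
    qed
  qed
qed

text \<open>A member of the family is determined by a start in \<open>u\<close> or an end in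
  \<open>v\<close>, and a graft inherits such an end from \<open>P\<close> or \<open>Q\<close>. It
  may coincide with one of these two but with no third member, so replacing two paths neither merges
  members nor affects other labels.\<close>

lemma graft_in_fam: "P' \<in> fam f \<Longrightarrow> P' \<in> {P, Q}" "Q' \<in> fam f \<Longrightarrow> Q' \<in> {P, Q}"
proof -
  have src: "x = y" if "x \<in> fam f" "y \<in> fam f" "src x = src y" "src x \<in> u ` {1..r}" for x y
    using that fam_src[OF f] by (metis imageE)
  have trg: "x = y" if "x \<in> fam f" "y \<in> fam f" "trg x = trg y" "trg x \<in> v ` {1..s}" for x y
    using that fam_trg[OF f] by (metis imageE)
  show "P' \<in> {P, Q}" if "P' \<in> fam f"
    using side src[OF that P(1)] trg[OF that Q(1)] by auto
  show "Q' \<in> {P, Q}" if "Q' \<in> fam f"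
    using side src[OF that Q(1)] trg[OF that P(1)] by auto
qed

lemma grafts_distinct: "P' \<noteq> Q'"
proof
  assume "P' = Q'"
  then have "src P = src Q" "trg P = trg Q"
    by (metis src_graft, metis trg_graft)
  with side have "P = Q"
    using fam_src[OF f P(1)] fam_src[OF f Q(1)] fam_trg[OF f P(1)] fam_trg[OF f Q(1)] by (metis imageE)
  with PQ show False by simp
qed

lemma fam_swap: "fam f' = (fam f - {P, Q}) \<union> {P', Q'}"
proof
  show "fam f' \<subseteq> (fam f - {P, Q}) \<union> {P', Q'}"
  proof
    fix x assume "x \<in> fam f'"
    then show "x \<in> (fam f - {P, Q}) \<union> {P', Q'}"
    proof (cases rule: fam_cases)
      case (1 i)
      then show ?thesis using Src_in_fam[OF 1(1), of f] by (simp add: swap_tails_Src split: if_splits)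
    next
      case (2 j)
      then show ?thesis using Snk_in_fam[OF 2(1), of f] by (simp add: swap_tails_Snk split: if_splits)
    qed
  qed
  have "x \<in> fam f'" if "x \<in> fam f" "x \<noteq> P" "x \<noteq> Q" for x
    using that(1)
  proof (cases rule: fam_cases)
    case (1 i)
    then show ?thesis using Src_in_fam[OF 1(1), of f'] that by (simp add: swap_tails_Src)
  next
    case (2 j)
    then show ?thesis using Snk_in_fam[OF 2(1), of f'] that by (simp add: swap_tails_Snk)
  qed
  moreover have "P' \<in> fam f' \<and> Q' \<in> fam f'"
    using side
  proof
    assume "src P \<in> u ` {1..r} \<and> src Q \<in> u ` {1..r}"
    then obtain i k where ik: "i \<in> {1..r}" "k \<in> {1..r}" "src P = u i" "src Q = u k" by blast
    then have "f (Src i) = P" "f (Src k) = Q" using fam_src[OF f] P Q by metis+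
    then show ?thesis
      using Src_in_fam[OF ik(1), of f'] Src_in_fam[OF ik(2), of f'] ik PQ by (simp add: swap_tails_Src)
  next
    assume "trg P \<in> v ` {1..s} \<and> trg Q \<in> v ` {1..s}"
    then obtain i k where ik: "i \<in> {1..s}" "k \<in> {1..s}" "trg P = v i" "trg Q = v k" by blast
    then have "f (Snk i) = P" "f (Snk k) = Q" using fam_trg[OF f] P Q by metis+
    then show ?thesis
      using Snk_in_fam[OF ik(1), of f'] Snk_in_fam[OF ik(2), of f'] ik PQ by (simp add: swap_tails_Snk)
  qed
  ultimately show "(fam f - {P, Q}) \<union> {P', Q'} \<subseteq> fam f'" by blast
qed

lemma sum_fam_swap:
  fixes g :: "_ \<Rightarrow> nat"
  assumes "g P' + g Q' = g P + g Q"
  shows "sum g (fam f') = sum g (fam f)"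
proof -
  have "sum g (fam f) = sum g (fam f - {P, Q}) + (g P + g Q)"
    using PQ P Q finite_fam[of f] by (subst sum.subset_diff[of "{P, Q}"]) auto
  moreover have "sum g (fam f') = sum g (fam f - {P, Q}) + (g P' + g Q')"
    unfolding fam_swap using grafts_distinct graft_in_fam finite_fam[of f]
    by (subst sum.union_disjoint) auto
  ultimately show ?thesis using assms by simp
qed

lemma prod_fam_swap: "(\<Prod>P\<in>fam f'. weight P) = (\<Prod>P\<in>fam f. weight P)"
proof -
  have "(\<Prod>P\<in>fam f. weight P) = (\<Prod>P\<in>fam f - {P, Q}. weight P) * (weight P * weight Q)"
    using PQ P Q finite_fam[of f] by (subst prod.subset_diff[of "{P, Q}"]) auto
  moreover have "(\<Prod>P\<in>fam f'. weight P) = (\<Prod>P\<in>fam f - {P, Q}. weight P) * (weight P' * weight Q')"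
    unfolding fam_swap using grafts_distinct graft_in_fam finite_fam[of f]
    by (subst prod.union_disjoint) auto
  ultimately show ?thesis by (simp add: graft_weight)
qed

text \<open>This leaves the predicate \<open>crossing_at\<close> unchanged, so the vertex picked by
  \<open>resolve\<close> is the same after the exchange, however it is picked.\<close>

lemma card_through_swap: "card {x \<in> fam f'. y \<in> V x} = card {x \<in> fam f. y \<in> V x}"
proof -
  have card: "card {x \<in> A. y \<in> V x} = (\<Sum>x\<in>A. of_bool (y \<in> V x))" if "finite A" for A
    using that by (simp add: of_bool_def sum.If_cases Int_def)
  show ?thesis
    unfolding card[OF finite_fam]
    by (rule sum_fam_swap) (rule graft_path(3)[OF wf_D acyclic_D paths P(2) Q(2)])
qed

lemma swap_swap: "swap_tails z P' Q' f' = f"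
proof
  fix a
  show "swap_tails z P' Q' f' a = f a"
  proof (cases a)
    case (Src i)
    show ?thesis
    proof (cases "i \<in> {1..r}")
      case True
      then show ?thesis
        using graft_in_fam Src_in_fam[OF True, of f] PQ grafts_distinct
        unfolding Src by (auto simp: swap_tails_Src[OF True] simp del: atLeastAtMost_iff)
    qed (simp add: swap_tails_def Src)
  next
    case (Snk j)
    show ?thesis
    proof (cases "j \<in> {1..s}")
      case True
      then show ?thesis
        using graft_in_fam Snk_in_fam[OF True, of f] PQ grafts_distinct
        unfolding Snk by (auto simp: swap_tails_Snk[OF True] simp del: atLeastAtMost_iff)
    qed (simp add: swap_tails_def Snk)
  qed (simp_all add: swap_tails_def)
qed

text \<open>The kernel sees only ends in \<open>I\<close>, starts in \<open>J\<close>, and whether a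
  source and a sink hold the same path; the last is decided by endpoints. When two sources exchange
  tails, their ends are exchanged and no start in \<open>J\<close> changes, so the effect is a
  transposition of these two labels.\<close>

lemma pairing_swap_Src:
  assumes t: "t \<in> {1..r}" "t' \<in> {1..r}" "P = f (Src t)" "Q = f (Src t')"
    and ab: "a \<in> set (terminals \<alpha> \<beta>)" "b \<in> set (terminals \<alpha> \<beta>)"
  defines "\<tau> \<equiv> Transposition.transpose (Src t) (Src t')"
  shows "pairing a b (f' a) (f' b) = pairing (\<tau> a) (\<tau> b) (f (\<tau> a)) (f (\<tau> b))"
proof -
  define \<pi> where "\<pi> = Transposition.transpose t t'"
  have \<tau>: "\<tau> (Src i) = Src (\<pi> i)" "\<tau> (Snk j) = Snk j" "\<tau> SrcEnd = SrcEnd" "\<tau> SnkEnd = SnkEnd" for i j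
    by (auto simp: \<tau>_def \<pi>_def transpose_def)
  have \<pi>: "\<pi> i \<in> {1..r}" if "i \<in> {1..r}" for i
    using that t by (auto simp: \<pi>_def transpose_def)
  have f_eq: "f (Src i) = f (Src k) \<longleftrightarrow> i = k" if "i \<in> {1..r}" "k \<in> {1..r}" for i k
    using routing_Src(2)[OF f] u_eq_iff that by metis
  have Src: "trg (f' (Src i)) = trg (f (Src (\<pi> i)))" if i: "i \<in> {1..r}" for i
    using f_eq[OF i t(1)] f_eq[OF i t(2)] by (auto simp: swap_tails_Src[OF i] t(3,4) \<pi>_def transpose_def)
  \<comment> \<open>Both exchanged paths and both grafts start in \<open>u\<close>, which is
    disjoint from \<open>J\<close>; sinks fed from \<open>J\<close> keep their paths.\<close>
  have Snk: "(src (f' (Snk j)) \<in> J \<longleftrightarrow> src (f (Snk j)) \<in> J) \<and>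
      (src (f (Snk j)) \<in> J \<longrightarrow> src (f' (Snk j)) = src (f (Snk j)))" if j: "j \<in> {1..s}" for j
    using routing_Src(2)[OF f t(1)] routing_Src(2)[OF f t(2)] u_notin_J t by (auto simp: swap_tails_Snk[OF j])
  have eq: "f' (Src i) = f' (Snk j) \<longleftrightarrow> f (Src (\<pi> i)) = f (Snk j)" if "i \<in> {1..r}" "j \<in> {1..s}" for i j
    using routing_trg_iff[OF routing_swap that] routing_trg_iff[OF f \<pi> that(2), OF that(1)] Src[OF that(1)] by simp
  have eq': "f' (Snk j) = f' (Src i) \<longleftrightarrow> f (Snk j) = f (Src (\<pi> i))" if "i \<in> {1..r}" "j \<in> {1..s}" for i j
    using eq[OF that] by metis
  have idx: "a = Src i \<Longrightarrow> i \<in> {1..r}" "a = Snk i \<Longrightarrow> i \<in> {1..s}"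
    "b = Src i \<Longrightarrow> i \<in> {1..r}" "b = Snk i \<Longrightarrow> i \<in> {1..s}" for i
    using ab by (auto simp: set_terminals split: if_splits)
  show ?thesis
    by (cases a; cases b) (use idx in \<open>simp_all add: \<tau> Src Snk[THEN conjunct1] Snk[THEN conjunct2, rule_format] eq eq' del: atLeastAtMost_iff\<close>)
qed

lemma pairing_swap_Snk:
  assumes t: "t \<in> {1..s}" "t' \<in> {1..s}" "P = f (Snk t)" "Q = f (Snk t')"
    and ab: "a \<in> set (terminals \<alpha> \<beta>)" "b \<in> set (terminals \<alpha> \<beta>)"
  defines "\<tau> \<equiv> Transposition.transpose (Snk t) (Snk t')"
  shows "pairing a b (f' a) (f' b) = pairing (\<tau> a) (\<tau> b) (f (\<tau> a)) (f (\<tau> b))"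
proof -
  define \<pi> where "\<pi> = Transposition.transpose t t'"
  have \<tau>: "\<tau> (Snk i) = Snk (\<pi> i)" "\<tau> (Src j) = Src j" "\<tau> SrcEnd = SrcEnd" "\<tau> SnkEnd = SnkEnd" for i j
    by (auto simp: \<tau>_def \<pi>_def transpose_def)
  have \<pi>: "\<pi> i \<in> {1..s}" if "i \<in> {1..s}" for i
    using that t by (auto simp: \<pi>_def transpose_def)
  have f_eq: "f (Snk i) = f (Snk k) \<longleftrightarrow> i = k" if "i \<in> {1..s}" "k \<in> {1..s}" for i k
    using routing_Snk(2)[OF f] v_eq_iff that by metis
  have Snk: "src (f' (Snk i)) = src (f (Snk (\<pi> i)))" if i: "i \<in> {1..s}" for i
    using f_eq[OF i t(1)] f_eq[OF i t(2)] by (auto simp: swap_tails_Snk[OF i] t(3,4) \<pi>_def transpose_def)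
  have Src: "(trg (f' (Src j)) \<in> I \<longleftrightarrow> trg (f (Src j)) \<in> I) \<and>
      (trg (f (Src j)) \<in> I \<longrightarrow> trg (f' (Src j)) = trg (f (Src j)))" if j: "j \<in> {1..r}" for j
    using routing_Snk(2)[OF f t(1)] routing_Snk(2)[OF f t(2)] v_notin_I t by (auto simp: swap_tails_Src[OF j])
  have eq: "f' (Src i) = f' (Snk j) \<longleftrightarrow> f (Src i) = f (Snk (\<pi> j))" if "i \<in> {1..r}" "j \<in> {1..s}" for i j
    using routing_src_iff[OF routing_swap that] routing_src_iff[OF f that(1) \<pi>, OF that(2)] Snk[OF that(2)] by simp
  have eq': "f' (Snk j) = f' (Src i) \<longleftrightarrow> f (Snk (\<pi> j)) = f (Src i)" if "i \<in> {1..r}" "j \<in> {1..s}" for i j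
    using eq[OF that] by metis
  have idx: "a = Src i \<Longrightarrow> i \<in> {1..r}" "a = Snk i \<Longrightarrow> i \<in> {1..s}"
    "b = Src i \<Longrightarrow> i \<in> {1..r}" "b = Snk i \<Longrightarrow> i \<in> {1..s}" for i
    using ab by (auto simp: set_terminals split: if_splits)
  show ?thesis
    by (cases a; cases b) (use idx in \<open>simp_all add: \<tau> Snk Src[THEN conjunct1] Src[THEN conjunct2, rule_format] eq eq' del: atLeastAtMost_iff\<close>)
qed

lemma pf_list_swap_tails:
  assumes "even (length (terminals \<alpha> \<beta>))"
  shows "pf_list (\<lambda>a b. pairing a b (f' a) (f' b)) (terminals \<alpha> \<beta>)
    = - pf_list (\<lambda>a b. pairing a b (f a) (f b)) (terminals \<alpha> \<beta>)"
  using side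
proof
  assume "src P \<in> u ` {1..r} \<and> src Q \<in> u ` {1..r}"
  then obtain i k where ik: "i \<in> {1..r}" "k \<in> {1..r}" "src P = u i" "src Q = u k" by blast
  then have PQ': "P = f (Src i)" "Q = f (Src k)" using fam_src[OF f] P Q by metis+
  let ?\<tau> = "Transposition.transpose (Src i) (Src k)"
  have "pf_list (\<lambda>a b. pairing a b (f' a) (f' b)) (terminals \<alpha> \<beta>)
      = pf_list (\<lambda>a b. pairing (?\<tau> a) (?\<tau> b) (f (?\<tau> a)) (f (?\<tau> b))) (terminals \<alpha> \<beta>)"
    by (rule pf_list_cong[OF assms]) (rule pairing_swap_Src[OF ik(1,2) PQ'])
  also have "\<dots> = - pf_list (\<lambda>a b. pairing a b (f a) (f b)) (terminals \<alpha> \<beta>)"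
    using ik PQ PQ' by (intro pf_list_transpose[OF assms distinct_terminals]) (auto simp: set_terminals)
  finally show ?thesis .
next
  assume "trg P \<in> v ` {1..s} \<and> trg Q \<in> v ` {1..s}"
  then obtain i k where ik: "i \<in> {1..s}" "k \<in> {1..s}" "trg P = v i" "trg Q = v k" by blast
  then have PQ': "P = f (Snk i)" "Q = f (Snk k)" using fam_trg[OF f] P Q by metis+
  let ?\<tau> = "Transposition.transpose (Snk i) (Snk k)"
  have "pf_list (\<lambda>a b. pairing a b (f' a) (f' b)) (terminals \<alpha> \<beta>)
      = pf_list (\<lambda>a b. pairing (?\<tau> a) (?\<tau> b) (f (?\<tau> a)) (f (?\<tau> b))) (terminals \<alpha> \<beta>)"
    by (rule pf_list_cong[OF assms]) (rule pairing_swap_Snk[OF ik(1,2) PQ'])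
  also have "\<dots> = - pf_list (\<lambda>a b. pairing a b (f a) (f b)) (terminals \<alpha> \<beta>)"
    using ik PQ PQ' by (intro pf_list_transpose[OF assms distinct_terminals]) (auto simp: set_terminals)
  finally show ?thesis .
qed

end

lemma two_le_card_iff:
  "finite A \<Longrightarrow> 2 \<le> card A \<longleftrightarrow> (\<exists>x\<in>A. \<exists>y\<in>A. x \<noteq> y)"
  using card_le_Suc0_iff_eq[of A] by (auto simp: numeral_2_eq_2 not_less_eq_eq[symmetric])

lemma two_smallest:
  fixes A :: "nat set"
  assumes "finite A" "2 \<le> card A"
  shows "Min A \<in> A" "Min (A - {Min A}) \<in> A" "Min A \<noteq> Min (A - {Min A})"
proof -
  have "A \<noteq> {}" using assms by auto
  then show "Min A \<in> A" using assms by auto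
  have "A - {Min A} \<noteq> {}"
    using assms(2) card_mono[of "{Min A}" A] by auto
  then have "Min (A - {Min A}) \<in> A - {Min A}" using assms by (intro Min_in) auto
  then show "Min (A - {Min A}) \<in> A" "Min A \<noteq> Min (A - {Min A})" by auto
qed

section \<open>A canonical crossing and the involution that resolves it\<close>

context path_system
begin

definition crossing_at :: "(terminal \<Rightarrow> 'v \<times> 'e list \<times> 'v) \<Rightarrow> 'v \<Rightarrow> bool" where
  "crossing_at f z \<longleftrightarrow> 2 \<le> card {P \<in> fam f. z \<in> V P}"

definition srcs_through :: "(terminal \<Rightarrow> 'v \<times> 'e list \<times> 'v) \<Rightarrow> 'v \<Rightarrow> nat set" where
  "srcs_through f z = {i \<in> {1..r}. z \<in> V (f (Src i))}"

definition snks_through :: "(terminal \<Rightarrow> 'v \<times> 'e list \<times> 'v) \<Rightarrow> 'v \<Rightarrow> nat set" where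
  "snks_through f z = {j \<in> {1..s}. z \<in> V (f (Snk j))}"

definition resolve :: "(terminal \<Rightarrow> 'v \<times> 'e list \<times> 'v) \<Rightarrow> terminal \<Rightarrow> 'v \<times> 'e list \<times> 'v" where
  "resolve f = (let z = SOME z. crossing_at f z; A = srcs_through f z; B = snks_through f z in
     if 2 \<le> card A then swap_tails z (f (Src (Min A))) (f (Src (Min (A - {Min A})))) f
     else swap_tails z (f (Snk (Min B))) (f (Snk (Min (B - {Min B})))) f)"

text \<open>Every member starts in \<open>u\<close> or ends in \<open>v\<close>. If two members
  neither both start in \<open>u\<close> nor both end in \<open>v\<close>, one runs from
  \<open>J\<close> to \<open>v\<close> and the other from \<open>u\<close> to \<open>I\<close>, and
  separation forbids them to meet.\<close>

lemma crossing_two_on_one_side: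
  assumes "routing f" "crossing_at f z"
  shows "2 \<le> card (srcs_through f z) \<or> 2 \<le> card (snks_through f z)"
proof -
  obtain P Q where PQ: "P \<in> fam f" "Q \<in> fam f" "P \<noteq> Q" "z \<in> V P" "z \<in> V Q"
    using assms(2) finite_fam[of f] unfolding crossing_at_def by (subst (asm) two_le_card_iff) auto
  have fin: "finite (srcs_through f z)" "finite (snks_through f z)"
    by (auto simp: srcs_through_def snks_through_def)
  consider "src P \<in> u ` {1..r}" "src Q \<in> u ` {1..r}" | "trg P \<in> v ` {1..s}" "trg Q \<in> v ` {1..s}"
    | "src P \<in> J" "trg P \<in> v ` {1..s}" "src Q \<in> u ` {1..r}" "trg Q \<in> I"
    | "src Q \<in> J" "trg Q \<in> v ` {1..s}" "src P \<in> u ` {1..r}" "trg P \<in> I"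
    using fam_ends[OF assms(1) PQ(1)] fam_ends[OF assms(1) PQ(2)] by blast
  then show ?thesis
  proof cases
    case 1
    then obtain i k where ik: "i \<in> {1..r}" "k \<in> {1..r}" "src P = u i" "src Q = u k" by blast
    then have "P = f (Src i)" "Q = f (Src k)" using fam_src[OF assms(1)] PQ by metis+
    with PQ ik show ?thesis
      unfolding two_le_card_iff[OF fin(1)] by (auto simp: srcs_through_def)
  next
    case 2
    then obtain i k where ik: "i \<in> {1..s}" "k \<in> {1..s}" "trg P = v i" "trg Q = v k" by blast
    then have "P = f (Snk i)" "Q = f (Snk k)" using fam_trg[OF assms(1)] PQ by metis+
    with PQ ik show ?thesis
      unfolding two_le_card_iff[OF fin(2)] by (auto simp: snks_through_def)
  next
    case 3
    then have "V P \<inter> V Q = {}"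
      using separated fam_ends(1)[OF assms(1) PQ(1)] fam_ends(1)[OF assms(1) PQ(2)]
      unfolding D_separated_def is_path_def by (metis prod.collapse)
    with PQ show ?thesis by auto
  next
    case 4
    then have "V Q \<inter> V P = {}"
      using separated fam_ends(1)[OF assms(1) PQ(1)] fam_ends(1)[OF assms(1) PQ(2)]
      unfolding D_separated_def is_path_def by (metis prod.collapse)
    with PQ show ?thesis by auto
  qed
qed

text \<open>The vertex \<open>z\<close> and the two terminals whose paths are exchanged depend only on data that the
  exchange leaves unchanged, so that \<open>resolve\<close> is an involution.\<close>

lemma resolve_props:
  assumes f: "routing f" and cr: "\<exists>z. crossing_at f z"
  shows "routing (resolve f)" "\<exists>z. crossing_at (resolve f) z" "resolve (resolve f) = f"
    "(\<Prod>P\<in>fam (resolve f). weight P) = (\<Prod>P\<in>fam f. weight P)"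
    "even (length (terminals \<alpha> \<beta>)) \<Longrightarrow>
       pf_list (\<lambda>a b. pairing a b (resolve f a) (resolve f b)) (terminals \<alpha> \<beta>)
       = - pf_list (\<lambda>a b. pairing a b (f a) (f b)) (terminals \<alpha> \<beta>)"
    "\<exists>z P Q. P \<in> fam f \<and> Q \<in> fam f \<and> z \<in> V P \<and> z \<in> V Q \<and> resolve f = swap_tails z P Q f"
proof -
  define z where "z = (SOME z. crossing_at f z)"
  have z: "crossing_at f z" unfolding z_def using cr by (rule someI_ex)
  define A where "A = srcs_through f z"
  define B where "B = snks_through f z"
  have fin: "finite A" "finite B"
    by (auto simp: A_def B_def srcs_through_def snks_through_def)
  define c where "c = (if 2 \<le> card A then Src (Min A) else Snk (Min B))"
  define d where "d = (if 2 \<le> card A then Src (Min (A - {Min A})) else Snk (Min (B - {Min B})))"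
  have two: "2 \<le> card A \<or> 2 \<le> card B"
    using crossing_two_on_one_side[OF f z] by (simp add: A_def B_def)
  have res: "resolve f = swap_tails z (f c) (f d) f"
    by (simp add: resolve_def c_def d_def A_def B_def z_def Let_def)
  have A: "i \<in> A \<longleftrightarrow> i \<in> {1..r} \<and> z \<in> V (f (Src i))" for i by (auto simp: A_def srcs_through_def)
  have B: "i \<in> B \<longleftrightarrow> i \<in> {1..s} \<and> z \<in> V (f (Snk i))" for i by (auto simp: B_def snks_through_def)
  interpret crossing D w r s u v I J leI leJ f z "f c" "f d"
  proof
    show "routing f" by fact
    have "f c \<in> fam f \<and> z \<in> V (f c) \<and> f d \<in> fam f \<and> z \<in> V (f d) \<and> f c \<noteq> f d \<and>
      (src (f c) \<in> u ` {1..r} \<and> src (f d) \<in> u ` {1..r} \<or> trg (f c) \<in> v ` {1..s} \<and> trg (f d) \<in> v ` {1..s})"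
    proof (cases "2 \<le> card A")
      case True
      note m = two_smallest[OF fin(1) True]
      then have "Min A \<in> {1..r}" "z \<in> V (f (Src (Min A)))" "Min (A - {Min A}) \<in> {1..r}"
        "z \<in> V (f (Src (Min (A - {Min A}))))" using A by blast+
      then show ?thesis
        using True m(3) routing_Src(2)[OF f, of "Min A"] routing_Src(2)[OF f, of "Min (A - {Min A})"]
          u_eq_iff[of "Min A" "Min (A - {Min A})"] Src_in_fam[of _ f]
        by (auto simp: c_def d_def simp del: atLeastAtMost_iff)
    next
      case False
      with two have "2 \<le> card B" by simp
      note m = two_smallest[OF fin(2) this]
      then have "Min B \<in> {1..s}" "z \<in> V (f (Snk (Min B)))" "Min (B - {Min B}) \<in> {1..s}"
        "z \<in> V (f (Snk (Min (B - {Min B}))))" using B by blast+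
      then show ?thesis
        using False m(3) routing_Snk(2)[OF f, of "Min B"] routing_Snk(2)[OF f, of "Min (B - {Min B})"]
          v_eq_iff[of "Min B" "Min (B - {Min B})"] Snk_in_fam[of _ f]
        by (auto simp: c_def d_def simp del: atLeastAtMost_iff)
    qed
    then show "f c \<in> fam f" "z \<in> V (f c)" "f d \<in> fam f" "z \<in> V (f d)" "f c \<noteq> f d"
      "src (f c) \<in> u ` {1..r} \<and> src (f d) \<in> u ` {1..r} \<or> trg (f c) \<in> v ` {1..s} \<and> trg (f d) \<in> v ` {1..s}"
      by blast+
  qed
  show "routing (resolve f)" unfolding res by (rule routing_swap)
  have cr_eq: "crossing_at (resolve f) = crossing_at f"
    by (rule ext) (simp add: crossing_at_def res card_through_swap)
  then show "\<exists>z. crossing_at (resolve f) z" using cr by simp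
  show "(\<Prod>P\<in>fam (resolve f). weight P) = (\<Prod>P\<in>fam f. weight P)"
    unfolding res by (rule prod_fam_swap)
  show "pf_list (\<lambda>a b. pairing a b (resolve f a) (resolve f b)) (terminals \<alpha> \<beta>)
       = - pf_list (\<lambda>a b. pairing a b (f a) (f b)) (terminals \<alpha> \<beta>)" if "even (length (terminals \<alpha> \<beta>))"
    unfolding res by (rule pf_list_swap_tails[OF that])
  show "\<exists>z P Q. P \<in> fam f \<and> Q \<in> fam f \<and> z \<in> V P \<and> z \<in> V Q \<and> resolve f = swap_tails z P Q f"
    using P Q res by blast
  \<comment> \<open>Both grafts pass through \<open>z\<close> again, so the labels whose paths
    contain \<open>z\<close> are the same as before.\<close>
  have A': "srcs_through (resolve f) z = A"
    unfolding A_def srcs_through_def res using grafts P Q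
    by (auto simp: swap_tails_Src simp del: atLeastAtMost_iff split: if_splits)
  have B': "snks_through (resolve f) z = B"
    unfolding B_def snks_through_def res using grafts P Q
    by (auto simp: swap_tails_Snk simp del: atLeastAtMost_iff split: if_splits)
  have "resolve (resolve f) = swap_tails z (resolve f c) (resolve f d) (resolve f)"
    by (simp add: resolve_def[of "resolve f"] cr_eq A' B' c_def d_def Let_def flip: z_def)
  also have "\<dots> = f"
  proof (cases "2 \<le> card A")
    case True
    note m = two_smallest[OF fin(1) True]
    have "resolve f c = graft D z (f c) (f d)" "resolve f d = graft D z (f d) (f c)"
      using True m PQ unfolding A res by (auto simp: c_def d_def swap_tails_Src simp del: atLeastAtMost_iff)
    then show ?thesis using swap_swap by (simp add: res)
  next
    case False
    with two have "2 \<le> card B" by simp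
    note m = two_smallest[OF fin(2) this]
    \<comment> \<open>Sink labels keep ends rather than starts, so the two grafts appear in the
      opposite order; \<open>swap_tails_commute\<close> compensates.\<close>
    have "resolve f c = graft D z (f d) (f c)" "resolve f d = graft D z (f c) (f d)"
      using False m PQ unfolding B res by (auto simp: c_def d_def swap_tails_Snk simp del: atLeastAtMost_iff)
    then show ?thesis
      using swap_swap swap_tails_commute[OF grafts_distinct] by (simp add: res)
  qed
  finally show "resolve (resolve f) = f" .
qed

end

section \<open>Non-crossing configurations\<close>

lemma down_closed_eq_interval:
  fixes K :: "nat set"
  assumes "K \<subseteq> {1..n}" "\<And>i j. i \<in> K \<Longrightarrow> 1 \<le> j \<Longrightarrow> j < i \<Longrightarrow> j \<in> K"
  obtains k where "k \<le> n" "K = {1..k}"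
proof (cases "K = {}")
  case True
  then show thesis using that[of 0] by simp
next
  case False
  have fin: "finite K" using assms(1) finite_subset by blast
  have "Max K \<in> K" using False fin by simp
  have "K = {1..Max K}"
  proof (intro equalityI subsetI)
    fix x assume "x \<in> K"
    then show "x \<in> {1..Max K}" using assms(1) Max_ge[OF fin] by auto
  next
    fix x assume "x \<in> {1..Max K}"
    then show "x \<in> K" using \<open>Max K \<in> K\<close> assms(2)[of "Max K" x] by (cases "x = Max K") auto
  qed
  moreover have "Max K \<le> n" using \<open>Max K \<in> K\<close> assms(1) by auto
  ultimately show thesis using that by blast
qed

text \<open>An increasing map onto an interval sends \<open>{1..i}\<close> onto
  \<open>{m + 1..g i}\<close>, and comparing cardinalities forces the value.\<close>

lemma increasing_onto_interval:
  fixes g :: "nat \<Rightarrow> nat"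
  assumes mono: "\<And>i j. i \<in> {1..k} \<Longrightarrow> j \<in> {1..k} \<Longrightarrow> i < j \<Longrightarrow> g i < g j"
    and img: "g ` {1..k} = {m + 1..n}"
  shows "i \<in> {1..k} \<Longrightarrow> g i = m + i" "k = n - m"
proof -
  have less_iff: "g i < g j \<longleftrightarrow> i < j" if "i \<in> {1..k}" "j \<in> {1..k}" for i j
    using mono[OF that] mono[OF that(2,1)] by (metis less_asym linorder_less_linear)
  have inj: "inj_on g {1..k}"
    using less_iff by (intro inj_onI) (metis less_irrefl linorder_less_linear)
  show "k = n - m" using card_image[OF inj] unfolding img by simp
  show "g i = m + i" if i: "i \<in> {1..k}"
  proof -
    have "g ` {1..i} = {m + 1..g i}"
    proof
      show "g ` {1..i} \<subseteq> {m + 1..g i}"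
      proof
        fix y assume "y \<in> g ` {1..i}"
        then obtain j where j: "j \<in> {1..i}" "y = g j" by blast
        then have jk: "j \<in> {1..k}" using i by auto
        then have "y \<in> {m + 1..n}" using j img by blast
        moreover have "\<not> g i < g j" using less_iff[OF i jk] j by auto
        ultimately show "y \<in> {m + 1..g i}" using j by auto
      qed
      show "{m + 1..g i} \<subseteq> g ` {1..i}"
      proof
        fix y assume y: "y \<in> {m + 1..g i}"
        have "g i \<in> {m + 1..n}" using i img by blast
        with y have "y \<in> g ` {1..k}" unfolding img by auto
        then obtain j where j: "j \<in> {1..k}" "y = g j" by blast
        then have "\<not> i < j" using y less_iff[OF i j(1)] by auto
        with j show "y \<in> g ` {1..i}" by auto
      qed
    qed
    moreover have "inj_on g {1..i}" using inj by (rule inj_on_subset) (use i in auto)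
    ultimately have "i = g i - m" using card_image[of g "{1..i}"] by simp
    moreover have "g i \<in> {m + 1..n}" using i img by blast
    ultimately show ?thesis by auto
  qed
qed

lemma order_sgn_skew:
  assumes "linear_order_on A R" "x \<in> A" "y \<in> A"
  shows "order_sgn R y x = - order_sgn R x y"
  using assms by (auto simp: order_sgn_def linear_order_on_def partial_order_on_def total_on_def dest: antisymD)

context path_system
begin

lemma pairing_skew: "pairing b a Q P = - pairing a b P Q"
  by (cases a; cases b) (auto simp: order_sgn_skew[OF linear_I, of "trg P" "trg Q"] order_sgn_skew[OF linear_J, of "src P" "src Q"])

definition noncrossing :: "(terminal \<Rightarrow> 'v \<times> 'e list \<times> 'v) \<Rightarrow> bool" where
  "noncrossing f \<longleftrightarrow> (\<forall>z. \<not> crossing_at f z)"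

lemma noncrossing_iff:
  "noncrossing f \<longleftrightarrow> pairwise (\<lambda>p q. disjnt (V p) (V q)) (fam f)"
proof -
  have "finite {P \<in> fam f. z \<in> V P}" for z using finite_fam by simp
  from two_le_card_iff[OF this] show ?thesis
    unfolding noncrossing_def crossing_at_def pairwise_def disjnt_def by blast
qed

lemma noncrossingD:
  "noncrossing f \<Longrightarrow> P \<in> fam f \<Longrightarrow> Q \<in> fam f \<Longrightarrow> P \<noteq> Q \<Longrightarrow> V P \<inter> V Q = {}"
  unfolding noncrossing_iff pairwise_def disjnt_def by blast

lemma ends_in_V:
  assumes "is_path D P"
  shows "src P \<in> V P" "trg P \<in> V P"
proof -
  interpret wf_digraph D by (rule wf_D)
  have "awalk (src P) (arc_list P) (trg P)" using assms by (simp add: is_path_def apath_def)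
  then have "awhd (src P) (arc_list P) = src P" "awlast (src P) (arc_list P) = trg P" by auto
  then have "src P \<in> set (awalk_verts (src P) (arc_list P))" "trg P \<in> set (awalk_verts (src P) (arc_list P))"
    by (metis awalk_verts_non_Nil hd_in_set, metis awalk_verts_non_Nil last_in_set)
  then show "src P \<in> V P" "trg P \<in> V P" by (auto simp: path_vertices_def case_prod_unfold)
qed

lemma Field_leI: "y \<in> I \<Longrightarrow> y \<in> Field leI"
  and Field_leJ: "y \<in> J \<Longrightarrow> y \<in> Field leJ"
  using linear_I linear_J
  by (auto simp: linear_order_on_def partial_order_on_def preorder_on_def refl_on_def Field_def)

lemma seq_orderI: "1 \<le> i \<Longrightarrow> i \<le> j \<Longrightarrow> j \<le> n \<Longrightarrow> (x i, x j) \<in> seq_order n x"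
  by (auto simp: seq_order_def)

lemma seq_order_Field: "i \<in> {1..n} \<Longrightarrow> x i \<in> Field (seq_order n x)"
  by (auto simp: seq_order_def Field_def)

text \<open>Compatibility in contrapositive form: disjoint paths cannot have starts in one order and
  ends in the opposite order. All order statements about noncrossing configurations reduce to
  this.\<close>

lemma no_inversion:
  assumes f: "routing f" "noncrossing f" and PQ: "P \<in> fam f" "Q \<in> fam f"
    and src: "(src P, src Q) \<in> order_concat leJ (seq_order r u)" "src P \<noteq> src Q"
    and trg: "(trg Q, trg P) \<in> order_concat (seq_order s v) leI" "trg Q \<noteq> trg P"
  shows False
proof -
  have "V P \<inter> V Q \<noteq> {}"
    using compat fam_ends(1)[OF f(1) PQ(1)] fam_ends(1)[OF f(1) PQ(2)] src trg
    unfolding D_compatible_def is_path_def by (metis prod.collapse)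
  moreover have "P \<noteq> Q" using src by auto
  ultimately show False
    using noncrossingD[OF f(2) PQ] by blast
qed

text \<open>The shape of a member of \<open>P_zero\<close> with \<open>l = m + 1\<close>: here
  \<open>k\<close> paths run from \<open>u\<close> to \<open>v\<close> and \<open>m\<close> from
  \<open>J\<close> to \<open>v\<close>. The two sign conditions add strictly increasing ends in
  \<open>I\<close> and starts in \<open>J\<close>, which make the blocks of ones in the coefficient
  matrix.\<close>

definition staircase :: "nat \<Rightarrow> nat \<Rightarrow> (terminal \<Rightarrow> 'v \<times> 'e list \<times> 'v) \<Rightarrow> bool" where
  "staircase k m f \<longleftrightarrow> k \<le> r \<and> m \<le> s \<and> k + m = s \<and>
     (\<forall>i\<in>{1..k}. f (Src i) = f (Snk (m + i))) \<and>
     (\<forall>i\<in>{k + 1..r}. trg (f (Src i)) \<in> I) \<and>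
     (\<forall>j\<in>{1..m}. src (f (Snk j)) \<in> J) \<and>
     (\<forall>i\<in>{k + 1..r}. \<forall>j\<in>{k + 1..r}. i < j \<longrightarrow> order_sgn leI (trg (f (Src i))) (trg (f (Src j))) = 1) \<and>
     (\<forall>i\<in>{1..m}. \<forall>j\<in>{1..m}. i < j \<longrightarrow> order_sgn leJ (src (f (Snk i))) (src (f (Snk j))) = 1)"

lemma noncrossing_staircase:
  assumes f: "routing f" "noncrossing f"
  obtains k m where "staircase k m f"
proof -
  define K where "K = {i \<in> {1..r}. trg (f (Src i)) \<in> v ` {1..s}}"
  define M where "M = {j \<in> {1..s}. src (f (Snk j)) \<in> J}"
  have u_less: "(u i, u j) \<in> order_concat leJ (seq_order r u)" if "1 \<le> i" "i < j" "j \<le> r" for i j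
    using seq_orderI[of i j r u] that by (auto simp: order_concat_def)
  have v_less: "(v i, v j) \<in> order_concat (seq_order s v) leI" if "1 \<le> i" "i < j" "j \<le> s" for i j
    using seq_orderI[of i j s v] that by (auto simp: order_concat_def)
  \<comment> \<open>The sources routed to \<open>v\<close> form an initial segment: an earlier
    source ending in \<open>I\<close> would be inverted against a later one ending in
    \<open>v\<close>, since \<open>I\<close> comes after \<open>v\<close>.\<close>
  obtain k where k: "k \<le> r" "K = {1..k}"
  proof (rule down_closed_eq_interval)
    show "K \<subseteq> {1..r}" by (auto simp: K_def)
    fix i j assume ij: "i \<in> K" "1 \<le> j" "j < i"
    then have i: "i \<in> {1..r}" "trg (f (Src i)) \<in> v ` {1..s}" and j: "j \<in> {1..r}" by (auto simp: K_def)
    show "j \<in> K"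
    proof (rule ccontr)
      assume "j \<notin> K"
      then have tj: "trg (f (Src j)) \<in> I" using routing_Src(3)[OF f(1) j] j by (auto simp: K_def)
      show False
      proof (rule no_inversion[OF f Src_in_fam[OF j] Src_in_fam[OF i(1)]])
        show "(src (f (Src j)), src (f (Src i))) \<in> order_concat leJ (seq_order r u)"
          using routing_Src(2)[OF f(1)] i j ij u_less by auto
        show "src (f (Src j)) \<noteq> src (f (Src i))"
          using routing_Src(2)[OF f(1)] i j ij u_eq_iff[of j i] by auto
        show "(trg (f (Src i)), trg (f (Src j))) \<in> order_concat (seq_order s v) leI"
          using i(2) Field_leI[OF tj] seq_order_Field[of _ s v] by (auto simp: order_concat_def)
        show "trg (f (Src i)) \<noteq> trg (f (Src j))"
          using i(2) tj v_notin_I by auto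
      qed
    qed
  qed
  \<comment> \<open>Dually, the sinks fed from \<open>J\<close> form an initial segment, because
    \<open>J\<close> comes before \<open>u\<close>.\<close>
  obtain m where m: "m \<le> s" "M = {1..m}"
  proof (rule down_closed_eq_interval)
    show "M \<subseteq> {1..s}" by (auto simp: M_def)
    fix i j assume ij: "i \<in> M" "1 \<le> j" "j < i"
    then have i: "i \<in> {1..s}" "src (f (Snk i)) \<in> J" and j: "j \<in> {1..s}" by (auto simp: M_def)
    show "j \<in> M"
    proof (rule ccontr)
      assume "j \<notin> M"
      then have sj: "src (f (Snk j)) \<in> u ` {1..r}" using routing_Snk(3)[OF f(1) j] j by (auto simp: M_def)
      show False
      proof (rule no_inversion[OF f Snk_in_fam[OF i(1)] Snk_in_fam[OF j]])
        show "(src (f (Snk i)), src (f (Snk j))) \<in> order_concat leJ (seq_order r u)"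
          using sj Field_leJ[OF i(2)] seq_order_Field[of _ r u] by (auto simp: order_concat_def)
        show "src (f (Snk i)) \<noteq> src (f (Snk j))"
          using sj i(2) u_notin_J by auto
        show "(trg (f (Snk j)), trg (f (Snk i))) \<in> order_concat (seq_order s v) leI"
          using routing_Snk(2)[OF f(1)] i j ij v_less by auto
        show "trg (f (Snk j)) \<noteq> trg (f (Snk i))"
          using routing_Snk(2)[OF f(1)] i j ij v_eq_iff[of j i] by auto
      qed
    qed
  qed
  have "\<exists>j. j \<in> {1..s} \<and> trg (f (Src i)) = v j" if "i \<in> {1..k}" for i
    using that unfolding k(2)[symmetric] K_def by blast
  then obtain g where g: "\<And>i. i \<in> {1..k} \<Longrightarrow> g i \<in> {1..s} \<and> trg (f (Src i)) = v (g i)" by metis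
  have kr: "i \<in> {1..r}" if "i \<in> {1..k}" for i using that k by auto
  have fg: "f (Src i) = f (Snk (g i))" if "i \<in> {1..k}" for i
    using routing_trg_iff[OF f(1) kr[OF that]] g[OF that] by blast
  have mono: "g i < g j" if ij: "i \<in> {1..k}" "j \<in> {1..k}" "i < j" for i j
  proof (rule ccontr)
    assume "\<not> g i < g j"
    moreover have "g i \<noteq> g j"
    proof
      assume "g i = g j"
      then have "f (Src i) = f (Src j)" using fg ij by metis
      then have "u i = u j" using routing_Src(2)[OF f(1) kr] ij by metis
      then show False using u_eq_iff[OF kr kr] ij by simp
    qed
    ultimately have less: "g j < g i" by simp
    show False
    proof (rule no_inversion[OF f Src_in_fam[OF kr[OF ij(1)]] Src_in_fam[OF kr[OF ij(2)]]])
      show "(src (f (Src i)), src (f (Src j))) \<in> order_concat leJ (seq_order r u)"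
        using routing_Src(2)[OF f(1) kr] ij u_less kr[of i] kr[of j] by auto
      show "src (f (Src i)) \<noteq> src (f (Src j))"
        using routing_Src(2)[OF f(1) kr] ij u_eq_iff[OF kr kr, of i j] by auto
      show "(trg (f (Src j)), trg (f (Src i))) \<in> order_concat (seq_order s v) leI"
        using g[OF ij(1)] g[OF ij(2)] less v_less[of "g j" "g i"] by auto
      show "trg (f (Src j)) \<noteq> trg (f (Src i))"
        using g[OF ij(1)] g[OF ij(2)] less v_eq_iff[of "g j" "g i"] by auto
    qed
  qed
  have img: "g ` {1..k} = {m + 1..s}"
  proof
    show "g ` {1..k} \<subseteq> {m + 1..s}"
    proof
      fix y assume "y \<in> g ` {1..k}"
      then obtain i where i: "i \<in> {1..k}" "y = g i" by blast
      have "src (f (Snk (g i))) = u i" using routing_Src(2)[OF f(1) kr] fg i by metis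
      then have "g i \<notin> M" using u_notin_J[OF kr[OF i(1)]] by (auto simp: M_def)
      then show "y \<in> {m + 1..s}" using g[OF i(1)] i m by auto
    qed
    show "{m + 1..s} \<subseteq> g ` {1..k}"
    proof
      fix j assume j: "j \<in> {m + 1..s}"
      then have js: "j \<in> {1..s}" and "j \<notin> M" using m by auto
      then have "src (f (Snk j)) \<in> u ` {1..r}" using routing_Snk(3)[OF f(1) js] by (auto simp: M_def)
      then obtain i where i: "i \<in> {1..r}" "src (f (Snk j)) = u i" by blast
      then have tv: "trg (f (Src i)) = v j"
        using routing_src_iff[OF f(1) i(1) js] routing_trg_iff[OF f(1) i(1) js] by blast
      then have "i \<in> {1..k}" using i js k by (auto simp: K_def)
      then have "g i = j" using g[of i] tv v_eq_iff[OF _ js] by metis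
      with \<open>i \<in> {1..k}\<close> show "j \<in> g ` {1..k}" by blast
    qed
  qed
  have gi: "\<And>i. i \<in> {1..k} \<Longrightarrow> g i = m + i" "k = s - m"
    using increasing_onto_interval[of k g m s] mono img by blast+
  have I: "trg (f (Src i)) \<in> I" if "i \<in> {k + 1..r}" for i
  proof -
    have "i \<in> {1..r}" "i \<notin> K" using that k by auto
    then show ?thesis using routing_Src(3)[OF f(1), of i] by (auto simp: K_def)
  qed
  have J: "src (f (Snk j)) \<in> J" if "j \<in> {1..m}" for j
    using that unfolding m(2)[symmetric] M_def by blast
  have sgnI: "order_sgn leI (trg (f (Src i))) (trg (f (Src j))) = 1"
    if ij: "i \<in> {k + 1..r}" "j \<in> {k + 1..r}" "i < j" for i j
  proof -
    have r: "i \<in> {1..r}" "j \<in> {1..r}" using ij by auto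
    have ne: "src (f (Src i)) \<noteq> src (f (Src j))"
      using routing_Src(2)[OF f(1)] r ij u_eq_iff[OF r] by auto
    \<comment> \<open>Disjointness makes the two ends distinct, which excludes the value 0 of the
      sign; compatibility then excludes -1.\<close>
    have "V (f (Src i)) \<inter> V (f (Src j)) = {}"
      using ne by (intro noncrossingD[OF f(2)] Src_in_fam r) auto
    then have tne: "trg (f (Src i)) \<noteq> trg (f (Src j))"
      using ends_in_V(2)[OF routing_Src(1)[OF f(1) r(1)]] ends_in_V(2)[OF routing_Src(1)[OF f(1) r(2)]]
      by (metis disjoint_iff)
    have "(trg (f (Src j)), trg (f (Src i))) \<notin> leI"
    proof
      assume "(trg (f (Src j)), trg (f (Src i))) \<in> leI"
      then show False
        using no_inversion[OF f Src_in_fam[OF r(1)] Src_in_fam[OF r(2)] _ ne _ tne[symmetric]]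
          routing_Src(2)[OF f(1)] r ij u_less by (auto simp: order_concat_def)
    qed
    then have "(trg (f (Src i)), trg (f (Src j))) \<in> leI"
      using linear_I I[OF ij(1)] I[OF ij(2)] tne by (auto simp: linear_order_on_def total_on_def)
    with tne show ?thesis by (simp add: order_sgn_def)
  qed
  have sgnJ: "order_sgn leJ (src (f (Snk i))) (src (f (Snk j))) = 1"
    if ij: "i \<in> {1..m}" "j \<in> {1..m}" "i < j" for i j
  proof -
    have r: "i \<in> {1..s}" "j \<in> {1..s}" using ij m by auto
    have ne: "trg (f (Snk i)) \<noteq> trg (f (Snk j))"
      using routing_Snk(2)[OF f(1)] r ij v_eq_iff[OF r] by auto
    have "V (f (Snk i)) \<inter> V (f (Snk j)) = {}"
      using ne by (intro noncrossingD[OF f(2)] Snk_in_fam r) auto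
    then have tne: "src (f (Snk i)) \<noteq> src (f (Snk j))"
      using ends_in_V(1)[OF routing_Snk(1)[OF f(1) r(1)]] ends_in_V(1)[OF routing_Snk(1)[OF f(1) r(2)]]
      by (metis disjoint_iff)
    have "(src (f (Snk j)), src (f (Snk i))) \<notin> leJ"
    proof
      assume "(src (f (Snk j)), src (f (Snk i))) \<in> leJ"
      then show False
        using no_inversion[OF f Snk_in_fam[OF r(2)] Snk_in_fam[OF r(1)] _ tne[symmetric] _ ne]
          routing_Snk(2)[OF f(1)] r ij v_less by (auto simp: order_concat_def)
    qed
    then have "(src (f (Snk i)), src (f (Snk j))) \<in> leJ"
      using linear_J J[OF ij(1)] J[OF ij(2)] tne by (auto simp: linear_order_on_def total_on_def)
    with tne show ?thesis by (simp add: order_sgn_def)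
  qed
  have "f (Src i) = f (Snk (m + i))" if "i \<in> {1..k}" for i
    using fg[OF that] gi(1)[OF that] by simp
  then have "staircase k m f"
    unfolding staircase_def using k(1) m(1) gi(2) I J sgnI sgnJ by auto
  then show thesis by (rule that)
qed

section \<open>The coefficient of a noncrossing configuration\<close>

lemma staircase_Src_low:
  assumes "routing f" "staircase k m f" "i \<in> {1..k}"
  shows "trg (f (Src i)) \<notin> I" "i \<in> {1..r}" "m + i \<in> {1..s}"
proof -
  show i: "i \<in> {1..r}" and mi: "m + i \<in> {1..s}" using assms by (auto simp: staircase_def)
  have "f (Src i) = f (Snk (m + i))" using assms by (auto simp: staircase_def)
  then show "trg (f (Src i)) \<notin> I" using routing_Snk(2)[OF assms(1) mi] v_notin_I[OF mi] by simp
qed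

lemma staircase_Src_high:
  assumes "routing f" "staircase k m f" "i \<in> {k + 1..r}"
  shows "trg (f (Src i)) \<in> I" "i \<in> {1..r}" "j \<in> {1..s} \<Longrightarrow> f (Src i) \<noteq> f (Snk j)"
proof -
  show i: "i \<in> {1..r}" using assms by auto
  show "trg (f (Src i)) \<in> I" using assms by (auto simp: staircase_def)
  then show "f (Src i) \<noteq> f (Snk j)" if "j \<in> {1..s}"
    using routing_Snk(2)[OF assms(1) that] v_notin_I[OF that] by auto
qed

lemma staircase_Snk_high:
  assumes "routing f" "staircase k m f" "j \<in> {m + 1..s}"
  shows "src (f (Snk j)) \<notin> J" "j \<in> {1..s}" "j - m \<in> {1..k}" "f (Snk j) = f (Src (j - m))"
proof -
  show j: "j \<in> {1..s}" and jm: "j - m \<in> {1..k}" using assms by (auto simp: staircase_def)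
  then have "f (Src (j - m)) = f (Snk (m + (j - m)))"
    using assms(2) unfolding staircase_def by blast
  then show eq: "f (Snk j) = f (Src (j - m))" using assms(3) by simp
  have "j - m \<in> {1..r}" using assms jm by (auto simp: staircase_def)
  then show "src (f (Snk j)) \<notin> J"
    using routing_Src(2)[OF assms(1), of "j - m"] u_notin_J[of "j - m"] eq by simp
qed

lemma staircase_Snk_low:
  assumes "routing f" "staircase k m f" "j \<in> {1..m}"
  shows "src (f (Snk j)) \<in> J" "j \<in> {1..s}" "i \<in> {1..r} \<Longrightarrow> f (Src i) \<noteq> f (Snk j)"
proof -
  show j: "j \<in> {1..s}" using assms by (auto simp: staircase_def)
  show "src (f (Snk j)) \<in> J" using assms by (auto simp: staircase_def)
  then show "f (Src i) \<noteq> f (Snk j)" if "i \<in> {1..r}"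
    using routing_Src(2)[OF assms(1) that] u_notin_J[OF that] by auto
qed

lemma staircase_num_paths:
  assumes "routing f" "staircase k m f"
  shows "num_paths (fam f) (u ` {1..r}) I = r - k" "num_paths (fam f) J (v ` {1..s}) = m"
proof -
  have "{(x, p, y). (x, p, y) \<in> fam f \<and> x \<in> u ` {1..r} \<and> y \<in> I} = (\<lambda>i. f (Src i)) ` {k + 1..r}"
  proof (intro equalityI subsetI)
    fix P assume "P \<in> {(x, p, y). (x, p, y) \<in> fam f \<and> x \<in> u ` {1..r} \<and> y \<in> I}"
    then have P: "P \<in> fam f" "src P \<in> u ` {1..r}" "trg P \<in> I" by auto
    then obtain i where i: "i \<in> {1..r}" "P = f (Src i)" using fam_src[OF assms(1)] by blast
    then have "i \<notin> {1..k}" using staircase_Src_low(1)[OF assms] P by auto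
    then show "P \<in> (\<lambda>i. f (Src i)) ` {k + 1..r}" using i by auto
  next
    fix P assume "P \<in> (\<lambda>i. f (Src i)) ` {k + 1..r}"
    then obtain i where i: "i \<in> {k + 1..r}" "P = f (Src i)" by blast
    note h = staircase_Src_high[OF assms i(1)]
    have "P \<in> fam f" "src P \<in> u ` {1..r}" "trg P \<in> I"
      using i h Src_in_fam[OF h(2)] routing_Src(2)[OF assms(1) h(2)] by auto
    then show "P \<in> {(x, p, y). (x, p, y) \<in> fam f \<and> x \<in> u ` {1..r} \<and> y \<in> I}" by (auto simp: case_prod_unfold)
  qed
  moreover have "inj_on (\<lambda>i. f (Src i)) {k + 1..r}"
  proof (rule inj_onI)
    fix i j assume "i \<in> {k + 1..r}" "j \<in> {k + 1..r}" "f (Src i) = f (Src j)"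
    then show "i = j" using routing_Src(2)[OF assms(1)] u_eq_iff[of i j] by (metis staircase_Src_high(2)[OF assms])
  qed
  ultimately show "num_paths (fam f) (u ` {1..r}) I = r - k"
    unfolding num_paths_def by (simp add: card_image)
  have "{(x, p, y). (x, p, y) \<in> fam f \<and> x \<in> J \<and> y \<in> v ` {1..s}} = (\<lambda>i. f (Snk i)) ` {1..m}"
  proof (intro equalityI subsetI)
    fix P assume "P \<in> {(x, p, y). (x, p, y) \<in> fam f \<and> x \<in> J \<and> y \<in> v ` {1..s}}"
    then have P: "P \<in> fam f" "src P \<in> J" "trg P \<in> v ` {1..s}" by auto
    then obtain i where i: "i \<in> {1..s}" "P = f (Snk i)" using fam_trg[OF assms(1)] by blast
    then have "i \<notin> {m + 1..s}" using staircase_Snk_high(1)[OF assms] P by auto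
    then show "P \<in> (\<lambda>i. f (Snk i)) ` {1..m}" using i by auto
  next
    fix P assume "P \<in> (\<lambda>i. f (Snk i)) ` {1..m}"
    then obtain i where i: "i \<in> {1..m}" "P = f (Snk i)" by blast
    note h = staircase_Snk_low[OF assms i(1)]
    have "P \<in> fam f" "src P \<in> J" "trg P \<in> v ` {1..s}"
      using i h Snk_in_fam[OF h(2)] routing_Snk(2)[OF assms(1) h(2)] by auto
    then show "P \<in> {(x, p, y). (x, p, y) \<in> fam f \<and> x \<in> J \<and> y \<in> v ` {1..s}}" by (auto simp: case_prod_unfold)
  qed
  moreover have "inj_on (\<lambda>i. f (Snk i)) {1..m}"
  proof (rule inj_onI)
    fix i j assume "i \<in> {1..m}" "j \<in> {1..m}" "f (Snk i) = f (Snk j)"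
    then show "i = j" using routing_Snk(2)[OF assms(1)] v_eq_iff[of i j] by (metis staircase_Snk_low(2)[OF assms])
  qed
  ultimately show "num_paths (fam f) J (v ` {1..s}) = m"
    unfolding num_paths_def by (simp add: card_image)
qed

text \<open>The paths to \<open>I\<close> and from \<open>J\<close> contribute consecutive blocks of ones above the diagonal;
  the matched pairs that remain are nested.\<close>

lemma pf_list_staircase:
  assumes f: "routing f" "staircase k m f" and ev: "even (length (terminals \<alpha> \<beta>))"
  shows "pf_list (\<lambda>a b. pairing a b (f a) (f b)) (terminals \<alpha> \<beta>) = of_bool ((odd (r - k) \<longleftrightarrow> \<alpha>) \<and> (odd m \<longleftrightarrow> \<beta>))"
proof -
  let ?A = "\<lambda>a b. pairing a b (f a) (f b)"
  define xs where "xs = map Src [1..<Suc k]"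
  define B1 where "B1 = map Src [Suc k..<Suc r] @ (if \<alpha> then [SrcEnd] else [])"
  define ys where "ys = rev (map Snk [Suc m..<Suc s])"
  define B2 where "B2 = rev (map Snk [1..<Suc m]) @ (if \<beta> then [SnkEnd] else [])"
  have km: "k \<le> r" "m \<le> s" "k + m = s" using f(2) by (auto simp: staircase_def)
  have "[1..<Suc r] = [1..<Suc k] @ [Suc k..<Suc r]" "[1..<Suc s] = [1..<Suc m] @ [Suc m..<Suc s]"
    using km upt_add_eq_append[of 1 "Suc k" "r - k"] upt_add_eq_append[of 1 "Suc m" "s - m"] by auto
  then have T: "terminals \<alpha> \<beta> = xs @ B1 @ ys @ B2"
    unfolding terminals_def xs_def B1_def ys_def B2_def by (simp only: map_append rev_append append_assoc)
  have set_xs: "set xs = Src ` {1..k}" and set_ys: "set ys = Snk ` {m + 1..s}"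
    and set_B1: "set B1 = Src ` {k + 1..r} \<union> (if \<alpha> then {SrcEnd} else {})"
    and set_B2: "set B2 = Snk ` {1..m} \<union> (if \<beta> then {SnkEnd} else {})"
    by (auto simp: xs_def ys_def B1_def B2_def)
  note lowS = staircase_Src_low[OF f] and highS = staircase_Src_high[OF f]
    and lowK = staircase_Snk_low[OF f] and highK = staircase_Snk_high[OF f]
  have sgnI: "\<And>i j. i \<in> {k + 1..r} \<Longrightarrow> j \<in> {k + 1..r} \<Longrightarrow> i < j \<Longrightarrow> order_sgn leI (trg (f (Src i))) (trg (f (Src j))) = 1"
    and sgnJ: "\<And>i j. i \<in> {1..m} \<Longrightarrow> j \<in> {1..m} \<Longrightarrow> i < j \<Longrightarrow> order_sgn leJ (src (f (Snk i))) (src (f (Snk j))) = 1"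
    using f(2) unfolding staircase_def by blast+
  have 1: "pf_list ?A (xs @ B1 @ (ys @ B2)) = (if even (length B1) then pf_list ?A (xs @ ys @ B2) else 0)"
  proof (rule pf_list_ones_block)
    show "even (length (xs @ B1 @ ys @ B2))" using ev T by simp
    show "?A b a = - ?A a b" if "a \<in> set B1" "b \<in> set B1" for a b by (rule pairing_skew)
    show "sorted_wrt (\<lambda>a b. ?A a b = 1) B1"
      using sgnI highS(1) unfolding B1_def
      by (auto simp: sorted_wrt_append sorted_wrt_map intro!: sorted_wrt_mono_rel[OF _ sorted_wrt_upt])
    fix a c assume a: "a \<in> set B1" and c: "c \<in> set (xs @ ys @ B2)"
    \<comment> \<open>Sources \<open>1\<close> to \<open>k\<close> do not end in \<open>I\<close>,
      and a path into \<open>I\<close> is not held by any sink; so the block \<open>B1\<close> is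
      orthogonal to everything else.\<close>
    have "c \<in> Src ` {1..k} \<or> c \<in> Snk ` {1..s} \<or> c = SnkEnd"
      using c km unfolding set_append set_xs set_ys set_B2 by (auto split: if_splits)
    then have "?A a c = 0"
      using a lowS(1) highS(3) unfolding set_B1 by (auto split: if_splits)
    then show "?A a c = 0 \<and> ?A c a = 0" using pairing_skew[of c a] by simp
  qed
  have 2: "pf_list ?A ((xs @ ys) @ B2 @ []) = (if even (length B2) then pf_list ?A ((xs @ ys) @ []) else 0)"
    if "even (length B1)"
  proof (rule pf_list_ones_block)
    show "even (length ((xs @ ys) @ B2 @ []))" using ev that by (simp add: T)
    show "?A b a = - ?A a b" if "a \<in> set B2" "b \<in> set B2" for a b by (rule pairing_skew)
    show "sorted_wrt (\<lambda>a b. ?A a b = 1) B2"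
      using sgnJ lowK(1) unfolding B2_def
      by (auto simp: sorted_wrt_append sorted_wrt_map sorted_wrt_rev simp del: upt_Suc
          intro!: sorted_wrt_mono_rel[OF _ sorted_wrt_upt])
    fix a c assume a: "a \<in> set B2" and c: "c \<in> set ((xs @ ys) @ [])"
    have "c \<in> Src ` {1..k} \<or> c \<in> Snk ` {m + 1..s}"
      using c unfolding set_append set_xs set_ys by simp
    moreover have "f (Snk j) \<noteq> f (Src i)" if "j \<in> {1..m}" "i \<in> {1..k}" for i j
      using lowK(3)[OF that(1) lowS(2)[OF that(2)]] by simp
    ultimately have "?A a c = 0"
      using a highK(1) unfolding set_B2 by (auto split: if_splits)
    then show "?A a c = 0 \<and> ?A c a = 0" using pairing_skew[of c a] by simp
  qed
  have 3: "pf_list ?A (xs @ ys) = 1"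
  proof -
    let ?ps = "map (\<lambda>i. (Src i, Snk (m + i))) [1..<Suc k]"
    have fst: "map fst ?ps = xs" by (simp add: xs_def comp_def del: upt_Suc)
    have "map (\<lambda>i. Snk (m + i)) [1..<Suc k] = map Snk [Suc m..<Suc s]"
      using km by (intro nth_equalityI) (auto simp del: upt_Suc simp: nth_upt)
    then have snd: "rev (map snd ?ps) = ys"
      by (simp add: ys_def comp_def del: upt_Suc)
    have ij: "?A (Src i) (Snk (m + j)) = (if i = j then 1 else 0)" "?A (Snk (m + j)) (Src i) = (if i = j then - 1 else 0)"
      if "i \<in> {1..k}" "j \<in> {1..k}" for i j
    proof -
      have "f (Src i) = f (Snk (m + j)) \<longleftrightarrow> trg (f (Src i)) = v (m + j)"
        using that lowS by (intro routing_trg_iff[OF f(1)]) auto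
      also have "trg (f (Src i)) = v (m + i)"
        using that f(2) lowS(3)[of i] routing_Snk(2)[OF f(1), of "m + i"] by (auto simp: staircase_def)
      also have "v (m + i) = v (m + j) \<longleftrightarrow> i = j"
        using v_eq_iff[OF lowS(3) lowS(3), of i j] that by simp
      finally have "f (Src i) = f (Snk (m + j)) \<longleftrightarrow> i = j" .
      then show "?A (Src i) (Snk (m + j)) = (if i = j then 1 else 0)" "?A (Snk (m + j)) (Src i) = (if i = j then - 1 else 0)"
        by (auto simp: eq_commute[of "f (Snk _)"])
    qed
    have "pf_list ?A (map fst ?ps @ rev (map snd ?ps)) = 1"
    proof (rule pf_list_nested)
      show "?A c d = 0" if "c \<in> set (map fst ?ps)" "d \<in> set (map fst ?ps)" for c d
        using that lowS(1) by auto
      show "?A c d = 0" if "c \<in> set (map snd ?ps)" "d \<in> set (map snd ?ps)" for c d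
      proof -
        have "c \<in> set ys" "d \<in> set ys" using that snd by (metis set_rev)+
        then show ?thesis using highK(1) by (auto simp: set_ys)
      qed
      fix i j assume "i < length ?ps" "j < length ?ps"
      then show "?A (fst (?ps ! i)) (snd (?ps ! j)) = (if i = j then 1 else 0)"
        "?A (snd (?ps ! i)) (fst (?ps ! j)) = (if i = j then - 1 else 0)"
        using ij[of "Suc i" "Suc j"] ij[of "Suc j" "Suc i"] by (auto simp del: upt_Suc)
    qed
    then show ?thesis unfolding fst snd .
  qed
  \<comment> \<open>This is where the parities enter: a border label lengthens its block by one, so
    with it an odd number of paths survives and without it an even number.\<close>
  have len: "even (length B1) \<longleftrightarrow> (odd (r - k) \<longleftrightarrow> \<alpha>)" "even (length B2) \<longleftrightarrow> (odd m \<longleftrightarrow> \<beta>)"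
    by (auto simp: B1_def B2_def simp del: upt_Suc)
  have "pf_list ?A (terminals \<alpha> \<beta>) = (if even (length B1) then pf_list ?A ((xs @ ys) @ B2 @ []) else 0)"
    using 1 by (simp only: T append_assoc append_Nil2)
  also have "\<dots> = of_bool (even (length B1) \<and> even (length B2))"
    using 2 3 by (simp del: append_assoc)
  finally show ?thesis unfolding len .
qed

lemma pf_list_noncrossing:
  assumes "routing f" "noncrossing f" "even (length (terminals \<alpha> \<beta>))"
  shows "pf_list (\<lambda>a b. pairing a b (f a) (f b)) (terminals \<alpha> \<beta>) =
    of_bool ((odd (num_paths (fam f) (u ` {1..r}) I) \<longleftrightarrow> \<alpha>) \<and> (odd (num_paths (fam f) J (v ` {1..s})) \<longleftrightarrow> \<beta>))"
proof -
  obtain k m where "staircase k m f" using noncrossing_staircase[OF assms(1,2)] .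
  then show ?thesis
    using pf_list_staircase[OF assms(1) _ assms(3)] staircase_num_paths[OF assms(1)] by simp
qed

section \<open>Noncrossing configurations and the families in \<open>P_zero\<close>\<close>

lemma fam_in_P_zero:
  assumes f: "routing f" "noncrossing f"
  shows "fam f \<in> P_zero D J r u s v I"
proof -
  obtain k m where st: "staircase k m f" using noncrossing_staircase[OF f] .
  have km: "k \<le> r" "m \<le> s" "k + m = s" using st by (auto simp: staircase_def)
  \<comment> \<open>There are \<open>l - 1 = m\<close> paths from \<open>J\<close>, and
    \<open>s + 1 - l = k\<close>, so \<open>s + 2 - l = k + 1\<close> is the first source whose path
    ends in \<open>I\<close>.\<close>
  define l where "l = m + 1"
  note highS = staircase_Src_high[OF f(1) st] and lowK = staircase_Snk_low[OF f(1) st]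
    and highK = staircase_Snk_high[OF f(1) st]
  have mid: "(u (j + 1 - l), arc_list (f (Snk j)), v j) = f (Snk j)" if j: "j \<in> {l..s}" for j
  proof -
    have j': "j \<in> {m + 1..s}" using j by (simp add: l_def)
    have "j - m \<in> {1..r}" using highK(3)[OF j'] km by auto
    then have "src (f (Snk j)) = u (j + 1 - l)"
      using highK(4)[OF j'] routing_Src(2)[OF f(1), of "j - m"] by (simp add: l_def)
    moreover have "trg (f (Snk j)) = v j" using routing_Snk(2)[OF f(1) highK(2)[OF j']] .
    ultimately show ?thesis by (simp add: prod_eq_iff)
  qed
  have high: "(u i, arc_list (f (Src i)), trg (f (Src i))) = f (Src i)" if "i \<in> {s + 2 - l..r}" for i
  proof -
    have "i \<in> {k + 1..r}" using that km by (auto simp: l_def)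
    then show ?thesis using routing_Src(2)[OF f(1) highS(2)] by (simp add: prod_eq_iff)
  qed
  have low: "(src (f (Snk j)), arc_list (f (Snk j)), v j) = f (Snk j)" if "j \<in> {1..l - 1}" for j
  proof -
    have "j \<in> {1..m}" using that by (auto simp: l_def)
    then show ?thesis using routing_Snk(2)[OF f(1) lowK(2)] by (simp add: prod_eq_iff)
  qed
  have fam: "fam f = (\<lambda>j. f (Snk j)) ` {l..s} \<union> (\<lambda>i. f (Src i)) ` {s + 2 - l..r} \<union> (\<lambda>j. f (Snk j)) ` {1..l - 1}"
  proof -
    have s: "{1..s} = {l..s} \<union> {1..l - 1}" and r: "{1..r} = {1..k} \<union> {s + 2 - l..r}"
      using km by (auto simp: l_def)
    have "f (Src i) = f (Snk (m + i)) \<and> m + i \<in> {l..s}" if "i \<in> {1..k}" for i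
      using that st by (auto simp: staircase_def l_def)
    then have "(\<lambda>i. f (Src i)) ` {1..k} \<subseteq> (\<lambda>j. f (Snk j)) ` {l..s}" by blast
    then show ?thesis
      unfolding fam_def image_Un image_image s r by blast
  qed
  have "1 \<le> l \<and> l \<le> s + 1 \<and> s + 1 - l \<le> r"
    using km by (auto simp: l_def)
  moreover have "\<forall>j\<in>{l..s}. pre_digraph.apath D (u (j + 1 - l)) (arc_list (f (Snk j))) (v j)"
  proof
    fix j assume j: "j \<in> {l..s}"
    then have "is_path D (f (Snk j))" by (intro routing_Snk(1)[OF f(1)]) (auto simp: l_def)
    moreover have "src (f (Snk j)) = u (j + 1 - l)" "trg (f (Snk j)) = v j"
      using mid[OF j] by (metis fst_conv, metis snd_conv)
    ultimately show "pre_digraph.apath D (u (j + 1 - l)) (arc_list (f (Snk j))) (v j)"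
      by (simp only: is_path_def)
  qed
  moreover have "\<forall>i\<in>{s + 2 - l..r}. trg (f (Src i)) \<in> I \<and> pre_digraph.apath D (u i) (arc_list (f (Src i))) (trg (f (Src i)))"
  proof
    fix i assume i: "i \<in> {s + 2 - l..r}"
    then have i': "i \<in> {k + 1..r}" using km by (auto simp: l_def)
    then show "trg (f (Src i)) \<in> I \<and> pre_digraph.apath D (u i) (arc_list (f (Src i))) (trg (f (Src i)))"
      using highS(1)[OF i'] routing_Src(1,2)[OF f(1) highS(2)[OF i']] by (simp add: is_path_def)
  qed
  moreover have "\<forall>j\<in>{1..l - 1}. src (f (Snk j)) \<in> J \<and> pre_digraph.apath D (src (f (Snk j))) (arc_list (f (Snk j))) (v j)"
  proof
    fix j assume j: "j \<in> {1..l - 1}"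
    then have j': "j \<in> {1..m}" by (auto simp: l_def)
    then show "src (f (Snk j)) \<in> J \<and> pre_digraph.apath D (src (f (Snk j))) (arc_list (f (Snk j))) (v j)"
      using lowK(1)[OF j'] routing_Snk(1,2)[OF f(1) lowK(2)[OF j']] by (simp add: is_path_def)
  qed
  moreover have "fam f = (\<lambda>j. (u (j + 1 - l), arc_list (f (Snk j)), v j)) ` {l..s}
      \<union> (\<lambda>i. (u i, arc_list (f (Src i)), trg (f (Src i)))) ` {s + 2 - l..r}
      \<union> (\<lambda>j. (src (f (Snk j)), arc_list (f (Snk j)), v j)) ` {1..l - 1}"
    unfolding fam by (intro arg_cong2[where f = "(\<union>)"] image_cong refl mid[symmetric] high[symmetric] low[symmetric])
  moreover have "pairwise (\<lambda>p q. disjnt (V p) (V q)) (fam f)"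
    using f(2) by (simp add: noncrossing_iff)
  ultimately show ?thesis
    unfolding P_zero_def
    by (intro CollectI exI[of _ l] exI[of _ "\<lambda>j. arc_list (f (Snk j))"] exI[of _ "\<lambda>i. arc_list (f (Src i))"]
        exI[of _ "\<lambda>i. trg (f (Src i))"] exI[of _ "\<lambda>j. src (f (Snk j))"]) blast
qed

text \<open>Together with \<open>fam_in_P_zero\<close> this identifies families with noncrossing
  routings. Fixing the value \<open>undefined\<close> outside the proper labels makes the routing
  unique.\<close>

lemma P_zero_is_fam:
  assumes "F \<in> P_zero D J r u s v I"
  obtains f where "routing f" "noncrossing f" "fam f = F"
    "\<And>a. a \<notin> Src ` {1..r} \<union> Snk ` {1..s} \<Longrightarrow> f a = undefined"
proof -
  from assms obtain l p A a B b where l: "1 \<le> l" "l \<le> s + 1" "s + 1 - l \<le> r"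
    and p: "\<And>i. i \<in> {l..s} \<Longrightarrow> pre_digraph.apath D (u (i + 1 - l)) (p i) (v i)"
    and A: "\<And>i. i \<in> {s + 2 - l..r} \<Longrightarrow> a i \<in> I \<and> pre_digraph.apath D (u i) (A i) (a i)"
    and B: "\<And>j. j \<in> {1..l - 1} \<Longrightarrow> b j \<in> J \<and> pre_digraph.apath D (b j) (B j) (v j)"
    and F: "F = (\<lambda>i. (u (i + 1 - l), p i, v i)) ` {l..s}
            \<union> (\<lambda>i. (u i, A i, a i)) ` {s + 2 - l..r}
            \<union> (\<lambda>j. (b j, B j, v j)) ` {1..l - 1}"
    and disj: "pairwise (\<lambda>p q. disjnt (V p) (V q)) F"
    unfolding P_zero_def by blast
  define g where "g i = (u (i + 1 - l), p i, v i)" for i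
  \<comment> \<open>A path from \<open>u\<close> to \<open>v\<close> is stored at both of its ends;
    the shift \<open>i + l - 1\<close> from source to sink index inverts
    \<open>j + 1 - l\<close>.\<close>
  define f where "f = (\<lambda>t. case t of
      Src i \<Rightarrow> if i \<notin> {1..r} then undefined else if i < s + 2 - l then g (i + l - 1) else (u i, A i, a i)
    | Snk j \<Rightarrow> if j \<notin> {1..s} then undefined else if l \<le> j then g j else (b j, B j, v j)
    | _ \<Rightarrow> undefined)"
  have Src_low: "f (Src i) = g (i + l - 1)" "i + l - 1 \<in> {l..s}" "i + l - 1 + 1 - l = i"
    if "i \<in> {1..r}" "i < s + 2 - l" for i
    using that l by (auto simp: f_def)
  have Src_high: "f (Src i) = (u i, A i, a i)" "i \<in> {s + 2 - l..r}"
    if "i \<in> {1..r}" "\<not> i < s + 2 - l" for i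
    using that l by (auto simp: f_def)
  have Snk_high: "f (Snk j) = g j" "j \<in> {l..s}" "j + 1 - l \<in> {1..r}" "j + 1 - l < s + 2 - l"
    if "j \<in> {1..s}" "l \<le> j" for j
    using that l by (auto simp: f_def)
  have Snk_low: "f (Snk j) = (b j, B j, v j)" "j \<in> {1..l - 1}"
    if "j \<in> {1..s}" "\<not> l \<le> j" for j
    using that l by (auto simp: f_def)
  have g_path: "is_path D (g j)" "src (g j) = u (j + 1 - l)" "trg (g j) = v j" if "j \<in> {l..s}" for j
    using p[OF that] by (auto simp: g_def is_path_def)
  have "routing f"
    unfolding routing_def
  proof (intro conjI ballI impI)
    fix i assume i: "i \<in> {1..r}"
    have "is_path D (f (Src i)) \<and> src (f (Src i)) = u i \<and> trg (f (Src i)) \<in> v ` {1..s} \<union> I"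
    proof (cases "i < s + 2 - l")
      case True
      note h = Src_low[OF i True]
      have "i + l - 1 \<in> {1..s}" using h(2) l(1) by auto
      then show ?thesis using h g_path[OF h(2)] by auto
    next
      case False
      then show ?thesis using Src_high[OF i False] A by (auto simp: is_path_def)
    qed
    then show "is_path D (f (Src i))" "src (f (Src i)) = u i" "trg (f (Src i)) \<in> v ` {1..s} \<union> I" by blast+
  next
    fix j assume j: "j \<in> {1..s}"
    have "is_path D (f (Snk j)) \<and> trg (f (Snk j)) = v j \<and> src (f (Snk j)) \<in> u ` {1..r} \<union> J"
    proof (cases "l \<le> j")
      case True
      note h = Snk_high[OF j True]
      then show ?thesis using g_path[OF h(2)] by auto
    next
      case False
      then show ?thesis using Snk_low[OF j False] B by (auto simp: is_path_def)
    qed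
    then show "is_path D (f (Snk j))" "trg (f (Snk j)) = v j" "src (f (Snk j)) \<in> u ` {1..r} \<union> J" by blast+
  next
    fix i j assume i: "i \<in> {1..r}" and j: "j \<in> {1..s}"
      and or: "trg (f (Src i)) = v j \<or> src (f (Snk j)) = u i"
    from or show "f (Src i) = f (Snk j)"
    proof
      assume tr: "trg (f (Src i)) = v j"
      have low: "i < s + 2 - l"
      proof (rule ccontr)
        assume "\<not> i < s + 2 - l"
        then have "trg (f (Src i)) \<in> I" using Src_high[OF i] A by auto
        then show False using tr v_notin_I[OF j] by simp
      qed
      note h = Src_low[OF i low]
      have "i + l - 1 \<in> {1..s}" using h(2) l(1) by auto
      then have "i + l - 1 = j" using tr h(1) g_path(3)[OF h(2)] v_eq_iff[of "i + l - 1" j] j by metis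
      then show ?thesis using h Snk_high[OF j] by auto
    next
      assume sr: "src (f (Snk j)) = u i"
      have high: "l \<le> j"
      proof (rule ccontr)
        assume "\<not> l \<le> j"
        then have "src (f (Snk j)) \<in> J" using Snk_low[OF j] B by auto
        then show False using sr u_notin_J[OF i] by simp
      qed
      note h = Snk_high[OF j high]
      have "j + 1 - l = i" using sr h(1,3) g_path(2)[OF h(2)] u_eq_iff[of "j + 1 - l" i] i by metis
      then show ?thesis using h Src_low(1)[OF i] high by auto
    qed
  qed
  moreover have "fam f = F"
  proof (intro equalityI subsetI)
    fix x assume "x \<in> fam f"
    then show "x \<in> F"
    proof (cases rule: fam_cases)
      case (1 i)
      then show ?thesis
        using Src_low[OF 1(1)] Src_high[OF 1(1)] unfolding F g_def[symmetric] by (cases "i < s + 2 - l") auto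
    next
      case (2 j)
      then show ?thesis
        using Snk_low[OF 2(1)] Snk_high[OF 2(1)] unfolding F g_def[symmetric] by (cases "l \<le> j") auto
    qed
  next
    fix x assume "x \<in> F"
    then consider i where "i \<in> {l..s}" "x = g i" | i where "i \<in> {s + 2 - l..r}" "x = (u i, A i, a i)"
      | j where "j \<in> {1..l - 1}" "x = (b j, B j, v j)"
      unfolding F g_def[symmetric] by blast
    then show "x \<in> fam f"
    proof cases
      case (1 i)
      then have i: "i \<in> {1..s}" "l \<le> i" using l by auto
      then show ?thesis using Snk_high[OF i] Snk_in_fam[OF i(1), of f] 1 by simp
    next
      case (2 i)
      then have i: "i \<in> {1..r}" "\<not> i < s + 2 - l" using l by auto
      then show ?thesis using Src_high[OF i] Src_in_fam[OF i(1), of f] 2 by simp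
    next
      case (3 j)
      then have j: "j \<in> {1..s}" "\<not> l \<le> j" using l by auto
      then show ?thesis using Snk_low[OF j] Snk_in_fam[OF j(1), of f] 3 by simp
    qed
  qed
  moreover have "noncrossing f" using disj unfolding noncrossing_iff \<open>fam f = F\<close> .
  moreover have "f t = undefined" if "t \<notin> Src ` {1..r} \<union> Snk ` {1..s}" for t
    using that by (cases t) (auto simp: f_def)
  ultimately show thesis using that by blast
qed

text \<open>The identity inside a finite set of paths. Closure of \<open>Z\<close> under grafts is
  what keeps \<open>resolve\<close> within the choices summed over, so that the crossing routings
  cancel among themselves.\<close>

lemma pf_list_entry_eq_sum:
  assumes Z: "finite Z" "\<And>P. P \<in> Z \<Longrightarrow> is_path D P"
    and closed: "\<And>P Q z. P \<in> Z \<Longrightarrow> Q \<in> Z \<Longrightarrow> z \<in> V P \<Longrightarrow> z \<in> V Q \<Longrightarrow> graft D z P Q \<in> Z"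
    and ev: "even (length (terminals \<alpha> \<beta>))"
  shows "pf_list (entry Z) (terminals \<alpha> \<beta>) =
    (\<Sum>F | F \<in> P_zero D J r u s v I \<and> F \<subseteq> Z \<and>
        (odd (num_paths F (u ` {1..r}) I) \<longleftrightarrow> \<alpha>) \<and> (odd (num_paths F J (v ` {1..s})) \<longleftrightarrow> \<beta>).
       \<Prod>P\<in>F. weight P)"
proof -
  let ?T = "terminals \<alpha> \<beta>"
  define C where "C = PiE (set ?T) (slot Z)"
  define g where "g f = (\<Prod>a\<in>set ?T. terminal_weight a (f a)) * pf_list (\<lambda>a b. pairing a b (f a) (f b)) ?T" for f
  let ?par = "\<lambda>F. (odd (num_paths F (u ` {1..r}) I) \<longleftrightarrow> \<alpha>) \<and> (odd (num_paths F J (v ` {1..s})) \<longleftrightarrow> \<beta>)"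
  define C1 where "C1 = {f \<in> C. routing f \<and> (\<exists>z. crossing_at f z)}"
  define C2 where "C2 = {f \<in> C. routing f \<and> noncrossing f}"
  have fin_slot: "finite (slot Z a)" for a using Z(1) by (cases a) auto
  have finC: "finite C" unfolding C_def by (intro finite_PiE fin_slot) simp
  have famZ: "fam f \<subseteq> Z" if "f \<in> C" for f
  proof
    fix x assume "x \<in> fam f"
    then obtain a where "a \<in> Src ` {1..r} \<union> Snk ` {1..s}" "x = f a" by (auto simp: fam_def)
    moreover from this have "f a \<in> slot Z a"
      using that unfolding C_def by (intro PiE_mem[of f "set ?T"]) (auto simp: set_terminals)
    ultimately show "x \<in> Z" by auto
  qed
  have inC: "f \<in> C" if "routing f" "fam f \<subseteq> Z" "\<And>a. a \<notin> Src ` {1..r} \<union> Snk ` {1..s} \<Longrightarrow> f a = undefined" for f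
    unfolding C_def
  proof (rule PiE_I)
    fix a assume a: "a \<in> set ?T"
    show "f a \<in> slot Z a"
    proof (cases a)
      case (Src i)
      then have i: "i \<in> {1..r}" using a by (auto simp: set_terminals split: if_splits)
      then show ?thesis using routing_Src[OF that(1) i] Src_in_fam[OF i, of f] that(2) Src by auto
    next
      case (Snk i)
      then have i: "i \<in> {1..s}" using a by (auto simp: set_terminals split: if_splits)
      then show ?thesis using routing_Snk[OF that(1) i] Snk_in_fam[OF i, of f] that(2) Snk by auto
    qed (use that(3) in auto)
  qed (use that(3) in \<open>auto simp: set_terminals\<close>)
  have undef: "f a = undefined" if "f \<in> C" "a \<notin> Src ` {1..r} \<union> Snk ` {1..s}" for f a
  proof (cases "a \<in> set ?T")
    case True
    then have "f a \<in> slot Z a" using that(1) unfolding C_def by (rule PiE_mem[rotated])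
    then show ?thesis using that(2) True by (auto simp: set_terminals split: if_splits)
  next
    case False
    then show ?thesis using that(1) unfolding C_def by (rule PiE_arb[rotated])
  qed

  have "pf_list (entry Z) ?T = pf_list (\<lambda>a b. \<Sum>P\<in>slot Z a. \<Sum>Q\<in>slot Z b.
      terminal_weight a P * terminal_weight b Q * pairing a b P Q) ?T"
    by (rule pf_list_cong[OF ev]) (simp add: entry_def)
  also have "\<dots> = sum g C"
    unfolding C_def g_def by (rule pf_list_sum_kernel[OF distinct_terminals ev fin_slot])
  \<comment> \<open>Choices on which the two ends of a path disagree have coefficient zero; the rest
    are routings, crossing in \<open>C1\<close> and noncrossing in \<open>C2\<close>.\<close>
  also have "sum g C = sum g (C1 \<union> C2)"
  proof (rule sum.mono_neutral_right[OF finC])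
    show "\<forall>f\<in>C - (C1 \<union> C2). g f = 0"
    proof
      fix f assume "f \<in> C - (C1 \<union> C2)"
      then have "f \<in> C" "\<not> routing f" by (auto simp: C1_def C2_def noncrossing_def)
      then have "pf_list (\<lambda>a b. pairing a b (f a) (f b)) ?T = 0"
        using Z(2) unfolding C_def by (intro pf_list_not_routing[OF ev])
      then show "g f = 0" by (simp add: g_def)
    qed
  qed (auto simp: C1_def C2_def)
  also have "\<dots> = sum g C1 + sum g C2"
    by (rule sum.union_disjoint) (use finC in \<open>auto simp: C1_def C2_def noncrossing_def\<close>)
  also have "sum g C1 = 0"
  proof (rule sum_eq_zero_of_sign_reversing[where h = resolve])
    fix f assume "f \<in> C1"
    then have f: "f \<in> C" "routing f" "\<exists>z. crossing_at f z" by (auto simp: C1_def)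
    note res = resolve_props[OF f(2,3)]
    obtain z P Q where PQ: "P \<in> fam f" "Q \<in> fam f" "z \<in> V P" "z \<in> V Q" "resolve f = swap_tails z P Q f"
      using res(6) by blast
    then have PZ: "P \<in> Z" "Q \<in> Z" using famZ[OF f(1)] by auto
    have "fam (resolve f) \<subseteq> Z"
    proof
      fix x assume "x \<in> fam (resolve f)"
      then show "x \<in> Z"
      proof (cases rule: fam_cases)
        case (1 i)
        then show ?thesis
          using Src_in_fam[OF 1(1), of f] famZ[OF f(1)] closed[OF PZ PQ(3,4)] closed[OF PZ(2,1) PQ(4,3)]
          by (auto simp: PQ(5) swap_tails_Src simp del: atLeastAtMost_iff)
      next
        case (2 i)
        then show ?thesis
          using Snk_in_fam[OF 2(1), of f] famZ[OF f(1)] closed[OF PZ PQ(3,4)] closed[OF PZ(2,1) PQ(4,3)]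
          by (auto simp: PQ(5) swap_tails_Snk simp del: atLeastAtMost_iff)
      qed
    qed
    moreover have "resolve f a = undefined" if "a \<notin> Src ` {1..r} \<union> Snk ` {1..s}" for a
      using that undef[OF f(1) that] by (auto simp: PQ(5) swap_tails_def split: terminal.split)
    ultimately have "resolve f \<in> C" by (intro inC res(1))
    then show "resolve f \<in> C1" using res(1,2) by (simp add: C1_def)
    show "resolve (resolve f) = f" by (rule res(3))
    show "g (resolve f) = - g f"
      using res(4) res(5)[OF ev] prod_terminal_weight[OF f(2)] prod_terminal_weight[OF res(1)]
      by (simp add: g_def)
  qed
  also have "sum g C2 = (\<Sum>f\<in>C2. if ?par (fam f) then \<Prod>P\<in>fam f. weight P else 0)"
  proof (rule sum.cong[OF refl])
    fix f assume "f \<in> C2"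
    then have "routing f" "noncrossing f" by (auto simp: C2_def)
    then show "g f = (if ?par (fam f) then \<Prod>P\<in>fam f. weight P else 0)"
      using pf_list_noncrossing[OF _ _ ev, of f] by (simp add: g_def prod_terminal_weight)
  qed
  also have "\<dots> = (\<Sum>F\<in>fam ` C2. if ?par F then \<Prod>P\<in>F. weight P else 0)"
  proof (rule sum.reindex_cong[symmetric, OF _ refl refl])
    \<comment> \<open>The path at a proper label is recovered from the family as its member with the
      prescribed start or end; everywhere else the value is \<open>undefined\<close>.\<close>
    show "inj_on fam C2"
    proof (rule inj_onI)
      fix f f' assume ff: "f \<in> C2" "f' \<in> C2" "fam f = fam f'"
      then have C: "f \<in> C" "f' \<in> C" and R: "routing f" "routing f'" by (auto simp: C2_def)
      show "f = f'"
      proof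
        fix a show "f a = f' a"
        proof (cases "a \<in> Src ` {1..r} \<union> Snk ` {1..s}")
          case True
          then show ?thesis
          proof
            assume "a \<in> Src ` {1..r}"
            then obtain i where i: "i \<in> {1..r}" "a = Src i" by blast
            then show ?thesis
              using fam_src[OF R(2), of "f a" i] Src_in_fam[OF i(1), of f] routing_Src(2)[OF R(1) i(1)] ff(3) by simp
          next
            assume "a \<in> Snk ` {1..s}"
            then obtain i where i: "i \<in> {1..s}" "a = Snk i" by blast
            then show ?thesis
              using fam_trg[OF R(2), of "f a" i] Snk_in_fam[OF i(1), of f] routing_Snk(2)[OF R(1) i(1)] ff(3) by simp
          qed
        next
          case False
          then show ?thesis using undef[OF C(1)] undef[OF C(2)] by simp
        qed
      qed
    qed
  qed
  also have "fam ` C2 = {F \<in> P_zero D J r u s v I. F \<subseteq> Z}"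
  proof (intro equalityI subsetI)
    fix F assume "F \<in> fam ` C2"
    then show "F \<in> {F \<in> P_zero D J r u s v I. F \<subseteq> Z}"
      using fam_in_P_zero famZ by (auto simp: C2_def)
  next
    fix F assume F: "F \<in> {F \<in> P_zero D J r u s v I. F \<subseteq> Z}"
    then obtain f where f: "routing f" "noncrossing f" "fam f = F"
      "\<And>a. a \<notin> Src ` {1..r} \<union> Snk ` {1..s} \<Longrightarrow> f a = undefined"
      using P_zero_is_fam by blast
    then have "f \<in> C" using F by (intro inC) auto
    then show "F \<in> fam ` C2" using f by (auto simp: C2_def)
  qed
  also have "(\<Sum>F\<in>{F \<in> P_zero D J r u s v I. F \<subseteq> Z}. if ?par F then \<Prod>P\<in>F. weight P else 0)
      = (\<Sum>F | F \<in> P_zero D J r u s v I \<and> F \<subseteq> Z \<and> ?par F. \<Prod>P\<in>F. weight P)"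
  proof -
    have "finite {F \<in> P_zero D J r u s v I. F \<subseteq> Z}"
      by (rule finite_subset[of _ "Pow Z"]) (use Z(1) in auto)
    then show ?thesis
      by (simp add: sum.inter_filter[symmetric] conj_assoc)
  qed
  finally show ?thesis by simp
qed

end

section \<open>Passing to infinite sums\<close>

lemma bij_betw_Sigma_fibres:
  "e ` X \<subseteq> A \<Longrightarrow> bij_betw (\<lambda>P. (e P, P)) X (Sigma A (\<lambda>x. {P \<in> X. e P = x}))"
  by (rule bij_betwI[where g = snd]) auto

lemma has_sum_fibres:
  fixes f :: "'a \<Rightarrow> real"
  assumes "(f has_sum S) X" "e ` X \<subseteq> A" "\<And>x. x \<in> A \<Longrightarrow> (f has_sum g x) {P \<in> X. e P = x}"
  shows "(g has_sum S) A"
proof (rule has_sum_Sigma'[where f = "\<lambda>(x, P). f P" and B = "\<lambda>x. {P \<in> X. e P = x}"])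
  show "((\<lambda>(x, P). f P) has_sum S) (Sigma A (\<lambda>x. {P \<in> X. e P = x}))"
    using has_sum_reindex_bij_betw[OF bij_betw_Sigma_fibres[OF assms(2)], of "\<lambda>(x, P). f P" S] assms(1)
    by simp
qed (use assms(3) in simp)

text \<open>For nonnegative terms, convergence of the iterated sum gives convergence of the total
  sum. This derives summability over all paths into \<open>I\<close>, or out of \<open>J\<close>,
  from the assumptions on \<open>path_sum\<close>.\<close>

lemma summable_on_fibres:
  fixes f :: "'a \<Rightarrow> real"
  assumes "\<And>x. x \<in> X \<Longrightarrow> 0 \<le> f x" "e ` X \<subseteq> A" "\<And>x. x \<in> A \<Longrightarrow> (f has_sum g x) {P \<in> X. e P = x}"
    "g summable_on A"
  shows "f summable_on X"
proof -
  have "(\<lambda>(x, P). f P) summable_on (Sigma A (\<lambda>x. {P \<in> X. e P = x}))"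
    by (rule summable_on_SigmaI[where g = g]) (use assms in auto)
  then show ?thesis
    using has_sum_reindex_bij_betw[OF bij_betw_Sigma_fibres[OF assms(2)], of "\<lambda>(x, P). f P"]
    by (simp add: summable_on_def)
qed

lemma has_sum_product_nonneg:
  fixes a :: "'a \<Rightarrow> real" and b :: "'b \<Rightarrow> real"
  assumes "(a has_sum s) A" "(b has_sum t) B" "\<And>x. x \<in> A \<Longrightarrow> 0 \<le> a x" "\<And>y. y \<in> B \<Longrightarrow> 0 \<le> b y"
  shows "((\<lambda>(x, y). a x * b y) has_sum (s * t)) (A \<times> B)"
proof -
  have inner: "((\<lambda>y. a x * b y) has_sum (a x * t)) B" for x
    by (rule has_sum_cmult_right[OF assms(2)])
  have outer: "((\<lambda>x. a x * t) has_sum (s * t)) A"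
    by (rule has_sum_cmult_left[OF assms(1)])
  have "(\<lambda>(x, y). a x * b y) summable_on A \<times> B"
    by (rule summable_on_SigmaI[where g = "\<lambda>x. a x * t"])
       (use inner outer assms(3,4) in \<open>auto simp: summable_on_def\<close>)
  then obtain c where c: "((\<lambda>(x, y). a x * b y) has_sum c) (A \<times> B)"
    by (auto simp: summable_on_def)
  then have "((\<lambda>x. a x * t) has_sum c) A"
    by (rule has_sum_Sigma') (simp add: inner)
  with outer have "c = s * t" by (rule has_sum_unique[symmetric])
  with c show ?thesis by simp
qed

text \<open>The sign destroys nonnegativity, but being bounded by 1 it leaves the double series
  dominated by a product of two convergent nonnegative sums. Absolute convergence then permits
  grouping the pairs of paths by their endpoints.\<close>

lemma has_sum_double_fibres:
  fixes a :: "'a \<Rightarrow> real" and b :: "'b \<Rightarrow> real" and \<sigma> :: "'c \<Rightarrow> 'd \<Rightarrow> real"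
  assumes a: "\<And>P. P \<in> X \<Longrightarrow> 0 \<le> a P" "e ` X \<subseteq> A" "\<And>x. x \<in> A \<Longrightarrow> (a has_sum g x) {P \<in> X. e P = x}" "a summable_on X"
    and b: "\<And>Q. Q \<in> Y \<Longrightarrow> 0 \<le> b Q" "d ` Y \<subseteq> B" "\<And>y. y \<in> B \<Longrightarrow> (b has_sum h y) {Q \<in> Y. d Q = y}" "b summable_on Y"
    and \<sigma>: "\<And>x y. \<bar>\<sigma> x y\<bar> \<le> 1"
  shows "((\<lambda>(P, Q). a P * b Q * \<sigma> (e P) (d Q)) has_sum (\<Sum>\<^sub>\<infinity>(x, y)\<in>A \<times> B. g x * h y * \<sigma> x y)) (X \<times> Y)"
proof -
  let ?f = "\<lambda>(P, Q). a P * b Q * \<sigma> (e P) (d Q)"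
  have "(\<lambda>(P, Q). a P * b Q) summable_on X \<times> Y"
    using has_sum_product_nonneg[OF has_sum_infsum[OF a(4)] has_sum_infsum[OF b(4)]] a(1) b(1)
    by (auto simp: summable_on_def)
  then have "(\<lambda>PQ. norm (?f PQ)) summable_on X \<times> Y"
  proof (rule abs_summable_on_comparison_test')
    fix PQ assume "PQ \<in> X \<times> Y"
    then show "norm (?f PQ) \<le> (\<lambda>(P, Q). a P * b Q) PQ"
      using a(1) b(1) \<sigma> by (auto simp: abs_mult intro!: mult_left_le)
  qed
  then have sum: "(?f has_sum infsum ?f (X \<times> Y)) (X \<times> Y)"
    using abs_summable_summable has_sum_infsum by blast
  have "((\<lambda>(x, y). g x * h y * \<sigma> x y) has_sum infsum ?f (X \<times> Y)) (A \<times> B)"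
  proof (rule has_sum_fibres[OF sum])
    show "(\<lambda>(P, Q). (e P, d Q)) ` (X \<times> Y) \<subseteq> A \<times> B" using a(2) b(2) by auto
    fix xy assume "xy \<in> A \<times> B"
    then obtain x y where xy: "xy = (x, y)" "x \<in> A" "y \<in> B" by auto
    have set: "{PQ \<in> X \<times> Y. (\<lambda>(P, Q). (e P, d Q)) PQ = (x, y)} = {P \<in> X. e P = x} \<times> {Q \<in> Y. d Q = y}"
      by auto
    have "((\<lambda>PQ. (\<lambda>(P, Q). a P * b Q) PQ * \<sigma> x y) has_sum (g x * h y * \<sigma> x y)) ({P \<in> X. e P = x} \<times> {Q \<in> Y. d Q = y})"
      using a(1) b(1) by (intro has_sum_cmult_left has_sum_product_nonneg a(3) b(3) xy) auto
    then show "(?f has_sum (\<lambda>(x, y). g x * h y * \<sigma> x y) xy) {PQ \<in> X \<times> Y. (\<lambda>(P, Q). (e P, d Q)) PQ = xy}"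
      unfolding xy(1) set prod.case by (rule has_sum_cong[THEN iffD1, rotated]) auto
  qed
  then have "infsum ?f (X \<times> Y) = (\<Sum>\<^sub>\<infinity>(x, y)\<in>A \<times> B. g x * h y * \<sigma> x y)"
    by (simp add: infsumI)
  with sum show ?thesis by simp
qed

text \<open>A \<open>has_sum\<close> value is a limit along finite subsets; finite sets that
  eventually contain each given element converge along that filter.\<close>

lemma tendsto_sum_exhausting:
  fixes f :: "'a \<Rightarrow> real"
  assumes "(f has_sum S) X" "\<forall>\<^sub>F z in F. finite (Y z) \<and> Y z \<subseteq> X"
    "\<And>x. x \<in> X \<Longrightarrow> \<forall>\<^sub>F z in F. x \<in> Y z"
  shows "((\<lambda>z. sum f (Y z)) \<longlongrightarrow> S) F"
proof (rule filterlim_compose[where g = "sum f"])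
  show "(sum f \<longlongrightarrow> S) (finite_subsets_at_top X)" using assms(1) by (simp add: has_sum_def)
  show "filterlim Y (finite_subsets_at_top X) F"
    unfolding filterlim_iff eventually_finite_subsets_at_top
  proof (intro allI impI)
    fix R assume "\<exists>X0. finite X0 \<and> X0 \<subseteq> X \<and> (\<forall>Z. finite Z \<and> X0 \<subseteq> Z \<and> Z \<subseteq> X \<longrightarrow> R Z)"
    then obtain X0 where X0: "finite X0" "X0 \<subseteq> X" "\<And>Z. finite Z \<and> X0 \<subseteq> Z \<and> Z \<subseteq> X \<Longrightarrow> R Z" by blast
    have "\<forall>\<^sub>F z in F. \<forall>x\<in>X0. x \<in> Y z"
      by (rule eventually_ball_finite[OF X0(1)]) (use X0(2) assms(3) in blast)
    with assms(2) show "\<forall>\<^sub>F z in F. R (Y z)"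
      by eventually_elim (use X0(3) in blast)
  qed
qed

section \<open>Finite sets of paths closed under the exchange of tails\<close>

context path_system
begin

text \<open>A graft only recombines starts, ends and arcs already present, so this set is closed
  under grafting. It is finite for finite \<open>Z\<close>, because a path repeats no vertex, hence
  no arc, and finitely many arcs admit finitely many such lists.\<close>

definition path_hull :: "('v \<times> 'e list \<times> 'v) set \<Rightarrow> ('v \<times> 'e list \<times> 'v) set" where
  "path_hull Z = {P. is_path D P \<and> src P \<in> src ` Z \<and> trg P \<in> trg ` Z \<and> set (arc_list P) \<subseteq> (\<Union>Q\<in>Z. set (arc_list Q))}"

lemma hull_path: "P \<in> path_hull Z \<Longrightarrow> is_path D P"
  by (simp add: path_hull_def)

lemma in_hull: "is_path D P \<Longrightarrow> P \<in> Z \<Longrightarrow> P \<in> path_hull Z"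
  by (auto simp: path_hull_def)

lemma finite_hull:
  assumes "finite Z"
  shows "finite (path_hull Z)"
proof (rule finite_subset)
  let ?A = "\<Union>Q\<in>Z. set (arc_list Q)"
  show "path_hull Z \<subseteq> src ` Z \<times> {p. set p \<subseteq> ?A \<and> distinct p} \<times> trg ` Z"
  proof
    fix P assume P: "P \<in> path_hull Z"
    then have "distinct (pre_digraph.awalk_verts D (src P) (arc_list P))"
      by (simp add: path_hull_def is_path_def pre_digraph.apath_def)
    then have "distinct (arc_list P)"
      unfolding pre_digraph.awalk_verts_conv by (auto simp: distinct_map split: if_splits)
    with P show "P \<in> src ` Z \<times> {p. set p \<subseteq> ?A \<and> distinct p} \<times> trg ` Z"
      by (auto simp: path_hull_def mem_Times_iff)
  qed
  show "finite (src ` Z \<times> {p. set p \<subseteq> ?A \<and> distinct p} \<times> trg ` Z)"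
    using assms by (intro finite_cartesian_product finite_imageI finite_subset_distinct) auto
qed

lemma graft_in_hull:
  assumes "P \<in> path_hull Z" "Q \<in> path_hull Z" "z \<in> V P" "z \<in> V Q"
  shows "graft D z P Q \<in> path_hull Z"
proof -
  have "is_path D (graft D z P Q)"
    using graft_path(1)[OF wf_D acyclic_D] assms hull_path by blast
  moreover have "set (arc_list (graft D z P Q)) \<subseteq> set (arc_list P) \<union> set (arc_list Q)"
    by (auto simp: graft_def dest: set_takeWhileD set_dropWhileD)
  ultimately show ?thesis
    using assms(1,2) unfolding path_hull_def by simp blast
qed

lemma eventually_in_hull:
  "is_path D P \<Longrightarrow> \<forall>\<^sub>F Z in finite_subsets_at_top UNIV. P \<in> path_hull Z"
  unfolding eventually_finite_subsets_at_top
  by (rule exI[of _ "{P}"]) (auto intro: in_hull)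

lemma eventually_finite_hull:
  "\<forall>\<^sub>F Z in finite_subsets_at_top UNIV. finite (path_hull Z)"
  by (rule eventually_mono[OF eventually_finite_subsets_at_top_weakI]) (auto intro: finite_hull)

lemma weight_nonneg:
  assumes "is_path D P"
  shows "0 \<le> weight P"
proof -
  have "set (arc_list P) \<subseteq> arcs D"
    using assms by (simp add: is_path_def pre_digraph.apath_def pre_digraph.awalk_def)
  then have "\<And>e. e \<in> set (arc_list P) \<Longrightarrow> 0 \<le> w e" using w_pos by (meson less_imp_le subsetD)
  then show ?thesis
    unfolding path_weight_def by (intro prod_list_nonneg) auto
qed

lemma weight_has_sum:
  assumes "path_weight w summable_on {p. pre_digraph.apath D x p y}"
  shows "(weight has_sum path_sum D w x y) {P. is_path D P \<and> src P = x \<and> trg P = y}"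
proof -
  have "bij_betw (\<lambda>p. (x, p, y)) {p. pre_digraph.apath D x p y} {P. is_path D P \<and> src P = x \<and> trg P = y}"
    by (rule bij_betwI[where g = "\<lambda>P. arc_list P"]) (auto simp: is_path_def)
  from has_sum_reindex_bij_betw[OF this, of weight] show ?thesis
    using has_sum_infsum[OF assms] by (simp add: path_sum_def)
qed

end

section \<open>Convergence of the matrix entries along the exhaustion\<close>

locale summable_path_system = path_system +
  assumes summable_u: "\<And>i y. i \<in> {1..r} \<Longrightarrow> y \<in> v ` {1..s} \<union> I \<Longrightarrow>
      path_weight w summable_on {p. pre_digraph.apath D (u i) p y}"
    and summable_v: "\<And>x j. x \<in> J \<Longrightarrow> j \<in> {1..s} \<Longrightarrow>
      path_weight w summable_on {p. pre_digraph.apath D x p (v j)}"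
    and summable_I: "\<And>i. i \<in> {1..r} \<Longrightarrow> (\<lambda>y. path_sum D w (u i) y) summable_on I"
    and summable_J: "\<And>j. j \<in> {1..s} \<Longrightarrow> (\<lambda>x. path_sum D w x (v j)) summable_on J"
begin

fun limit_entry :: "terminal \<Rightarrow> terminal \<Rightarrow> real" where
  "limit_entry (Src i) (Src j) = Q_two D w I leI (u i) (u j)"
| "limit_entry (Snk i) (Snk j) = Qt_two D w J leJ (v i) (v j)"
| "limit_entry (Src i) (Snk j) = path_sum D w (u i) (v j)"
| "limit_entry (Snk j) (Src i) = - path_sum D w (u i) (v j)"
| "limit_entry (Src i) SrcEnd = Q_one D w I (u i)"
| "limit_entry SrcEnd (Src i) = - Q_one D w I (u i)"
| "limit_entry (Snk j) SnkEnd = Qt_one D w J (v j)"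
| "limit_entry SnkEnd (Snk j) = - Qt_one D w J (v j)"
| "limit_entry _ _ = 0"

definition paths_to_I :: "nat \<Rightarrow> ('a \<times> 'b list \<times> 'a) set" where
  "paths_to_I i = {P. is_path D P \<and> src P = u i \<and> trg P \<in> I}"

definition paths_from_J :: "nat \<Rightarrow> ('a \<times> 'b list \<times> 'a) set" where
  "paths_from_J j = {P. is_path D P \<and> trg P = v j \<and> src P \<in> J}"

lemma paths_to_I_path: "P \<in> paths_to_I i \<Longrightarrow> is_path D P" "trg ` paths_to_I i \<subseteq> I"
  by (auto simp: paths_to_I_def)

lemma paths_from_J_path: "P \<in> paths_from_J j \<Longrightarrow> is_path D P" "src ` paths_from_J j \<subseteq> J"
  by (auto simp: paths_from_J_def)

lemma paths_to_I_fibre: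
  assumes "i \<in> {1..r}" "y \<in> I"
  shows "(weight has_sum path_sum D w (u i) y) {P \<in> paths_to_I i. trg P = y}"
proof -
  have "{P \<in> paths_to_I i. trg P = y} = {P. is_path D P \<and> src P = u i \<and> trg P = y}"
    using assms(2) by (auto simp: paths_to_I_def)
  then show ?thesis using weight_has_sum[OF summable_u[of i y]] assms by simp
qed

lemma paths_from_J_fibre:
  assumes "j \<in> {1..s}" "x \<in> J"
  shows "(weight has_sum path_sum D w x (v j)) {P \<in> paths_from_J j. src P = x}"
proof -
  have "{P \<in> paths_from_J j. src P = x} = {P. is_path D P \<and> src P = x \<and> trg P = v j}"
    using assms(2) by (auto simp: paths_from_J_def)
  then show ?thesis using weight_has_sum[OF summable_v[of x j]] assms by simp
qed

lemma paths_to_I_summable: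
  assumes "i \<in> {1..r}"
  shows "weight summable_on paths_to_I i"
proof (rule summable_on_fibres[where e = trg and A = I])
  show "(weight has_sum path_sum D w (u i) y) {P \<in> paths_to_I i. trg P = y}" if "y \<in> I" for y
    by (rule paths_to_I_fibre[OF assms that])
  show "(\<lambda>y. path_sum D w (u i) y) summable_on I" by (rule summable_I[OF assms])
qed (auto simp: paths_to_I_def intro: weight_nonneg)

lemma paths_from_J_summable:
  assumes "j \<in> {1..s}"
  shows "weight summable_on paths_from_J j"
proof (rule summable_on_fibres[where e = src and A = J])
  show "(weight has_sum path_sum D w x (v j)) {P \<in> paths_from_J j. src P = x}" if "x \<in> J" for x
    by (rule paths_from_J_fibre[OF assms that])
  show "(\<lambda>x. path_sum D w x (v j)) summable_on J" by (rule summable_J[OF assms])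
qed (auto simp: paths_from_J_def intro: weight_nonneg)

lemma Q_one_has_sum:
  assumes "i \<in> {1..r}"
  shows "(weight has_sum Q_one D w I (u i)) (paths_to_I i)"
proof -
  note sum = has_sum_infsum[OF paths_to_I_summable[OF assms]]
  have "((\<lambda>y. path_sum D w (u i) y) has_sum infsum weight (paths_to_I i)) I"
    by (rule has_sum_fibres[OF sum paths_to_I_path(2) paths_to_I_fibre[OF assms]])
  then have "infsum weight (paths_to_I i) = Q_one D w I (u i)"
    by (simp add: infsumI Q_one_def)
  with sum show ?thesis by simp
qed

lemma Qt_one_has_sum:
  assumes "j \<in> {1..s}"
  shows "(weight has_sum Qt_one D w J (v j)) (paths_from_J j)"
proof -
  note sum = has_sum_infsum[OF paths_from_J_summable[OF assms]]
  have "((\<lambda>x. path_sum D w x (v j)) has_sum infsum weight (paths_from_J j)) J"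
    by (rule has_sum_fibres[OF sum paths_from_J_path(2) paths_from_J_fibre[OF assms]])
  then have "infsum weight (paths_from_J j) = Qt_one D w J (v j)"
    by (simp add: infsumI Qt_one_def)
  with sum show ?thesis by simp
qed

lemma order_sgn_le_1: "\<bar>order_sgn R x y\<bar> \<le> 1"
  by (simp add: order_sgn_def)

lemma Q_two_has_sum:
  assumes "i \<in> {1..r}" "j \<in> {1..r}"
  shows "((\<lambda>(P, Q). weight P * weight Q * order_sgn leI (trg P) (trg Q)) has_sum Q_two D w I leI (u i) (u j))
    (paths_to_I i \<times> paths_to_I j)"
  unfolding Q_two_def
  by (intro has_sum_double_fibres paths_to_I_path(2) paths_to_I_fibre paths_to_I_summable order_sgn_le_1
      weight_nonneg assms) (auto dest: paths_to_I_path(1))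

lemma Qt_two_has_sum:
  assumes "i \<in> {1..s}" "j \<in> {1..s}"
  shows "((\<lambda>(P, Q). weight P * weight Q * order_sgn leJ (src Q) (src P)) has_sum Qt_two D w J leJ (v i) (v j))
    (paths_from_J i \<times> paths_from_J j)"
proof -
  \<comment> \<open>In \<open>Qt_two\<close> the first summation vertex belongs to the second
    argument, so the pairs arise with \<open>j\<close> before \<open>i\<close> and are swapped
    afterwards.\<close>
  have "((\<lambda>(P, Q). weight P * weight Q * order_sgn leJ (src P) (src Q)) has_sum Qt_two D w J leJ (v i) (v j))
      (paths_from_J j \<times> paths_from_J i)"
    unfolding Qt_two_def
    by (intro has_sum_double_fibres paths_from_J_path(2) paths_from_J_fibre paths_from_J_summable
        order_sgn_le_1 weight_nonneg assms) (auto dest: paths_from_J_path(1))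
  then show ?thesis
    by (subst has_sum_swap) (simp add: case_prod_unfold mult.commute mult.left_commute)
qed

lemma entry_skew: "entry Z b a = - entry Z a b"
  unfolding entry_def sum_negf[symmetric]
  by (subst sum.swap) (intro sum.cong refl, subst pairing_skew, simp)

abbreviation "exhaustion \<equiv> finite_subsets_at_top (UNIV :: ('a \<times> 'b list \<times> 'a) set)"

lemma tendsto_sum_hull:
  fixes f :: "_ \<Rightarrow> real"
  assumes "(f has_sum S) X" "\<And>P. P \<in> X \<Longrightarrow> is_path D P"
  shows "((\<lambda>Z. sum f (X \<inter> path_hull Z)) \<longlongrightarrow> S) exhaustion"
proof (rule tendsto_sum_exhausting[OF assms(1)])
  show "\<forall>\<^sub>F Z in exhaustion. finite (X \<inter> path_hull Z) \<and> X \<inter> path_hull Z \<subseteq> X"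
    using eventually_finite_hull by eventually_elim auto
  show "\<forall>\<^sub>F Z in exhaustion. P \<in> X \<inter> path_hull Z" if "P \<in> X" for P
    using that by (intro eventually_mono[OF eventually_in_hull[OF assms(2)[OF that]]]) auto
qed

lemma tendsto_sum_hull_product:
  fixes f :: "_ \<Rightarrow> real"
  assumes "(f has_sum S) (X \<times> Y)" "\<And>P. P \<in> X \<union> Y \<Longrightarrow> is_path D P"
  shows "((\<lambda>Z. sum f ((X \<inter> path_hull Z) \<times> (Y \<inter> path_hull Z))) \<longlongrightarrow> S) exhaustion"
proof (rule tendsto_sum_exhausting[OF assms(1)])
  show "\<forall>\<^sub>F Z in exhaustion. finite ((X \<inter> path_hull Z) \<times> (Y \<inter> path_hull Z)) \<and>
      (X \<inter> path_hull Z) \<times> (Y \<inter> path_hull Z) \<subseteq> X \<times> Y"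
    using eventually_finite_hull by eventually_elim auto
  fix PQ assume "PQ \<in> X \<times> Y"
  then obtain P Q where PQ: "PQ = (P, Q)" "P \<in> X" "Q \<in> Y" by auto
  show "\<forall>\<^sub>F Z in exhaustion. PQ \<in> (X \<inter> path_hull Z) \<times> (Y \<inter> path_hull Z)"
    using eventually_in_hull[OF assms(2), of P] eventually_in_hull[OF assms(2), of Q] PQ
    by (simp add: eventually_conj_iff)
qed

lemma entry_Src_Src:
  assumes "finite Z" "\<And>P. P \<in> Z \<Longrightarrow> is_path D P"
  shows "entry Z (Src i) (Src j) =
    (\<Sum>(P, Q)\<in>(paths_to_I i \<inter> Z) \<times> (paths_to_I j \<inter> Z). weight P * weight Q * order_sgn leI (trg P) (trg Q))"
proof -
  have "(\<Sum>(P, Q)\<in>(paths_to_I i \<inter> Z) \<times> (paths_to_I j \<inter> Z). weight P * weight Q * order_sgn leI (trg P) (trg Q))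
      = (\<Sum>(P, Q)\<in>(paths_to_I i \<inter> Z) \<times> (paths_to_I j \<inter> Z).
          terminal_weight (Src i) P * terminal_weight (Src j) Q * pairing (Src i) (Src j) P Q)"
    by (rule sum.cong) (auto simp: paths_to_I_def)
  also have "\<dots> = (\<Sum>(P, Q)\<in>slot Z (Src i) \<times> slot Z (Src j).
          terminal_weight (Src i) P * terminal_weight (Src j) Q * pairing (Src i) (Src j) P Q)"
    by (rule sum.mono_neutral_left) (use assms in \<open>auto simp: paths_to_I_def split: if_splits\<close>)
  finally show ?thesis by (simp only: entry_def sum.cartesian_product)
qed

lemma entry_Snk_Snk:
  assumes "finite Z" "\<And>P. P \<in> Z \<Longrightarrow> is_path D P"
  shows "entry Z (Snk i) (Snk j) =
    (\<Sum>(P, Q)\<in>(paths_from_J i \<inter> Z) \<times> (paths_from_J j \<inter> Z). weight P * weight Q * order_sgn leJ (src Q) (src P))"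
proof -
  have "(\<Sum>(P, Q)\<in>(paths_from_J i \<inter> Z) \<times> (paths_from_J j \<inter> Z). weight P * weight Q * order_sgn leJ (src Q) (src P))
      = (\<Sum>(P, Q)\<in>(paths_from_J i \<inter> Z) \<times> (paths_from_J j \<inter> Z).
          terminal_weight (Snk i) P * terminal_weight (Snk j) Q * pairing (Snk i) (Snk j) P Q)"
    by (rule sum.cong) (auto simp: paths_from_J_def)
  also have "\<dots> = (\<Sum>(P, Q)\<in>slot Z (Snk i) \<times> slot Z (Snk j).
          terminal_weight (Snk i) P * terminal_weight (Snk j) Q * pairing (Snk i) (Snk j) P Q)"
    by (rule sum.mono_neutral_left) (use assms in \<open>auto simp: paths_from_J_def split: if_splits\<close>)
  finally show ?thesis by (simp only: entry_def sum.cartesian_product)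
qed

lemma entry_Src_SrcEnd:
  assumes "finite Z" "\<And>P. P \<in> Z \<Longrightarrow> is_path D P"
  shows "entry Z (Src i) SrcEnd = (\<Sum>P\<in>paths_to_I i \<inter> Z. weight P)"
proof -
  have "entry Z (Src i) SrcEnd = (\<Sum>P\<in>slot Z (Src i). weight P * of_bool (trg P \<in> I))"
    by (simp add: entry_def)
  also have "\<dots> = (\<Sum>P\<in>paths_to_I i \<inter> Z. weight P * of_bool (trg P \<in> I))"
    by (rule sum.mono_neutral_right) (use assms in \<open>auto simp: paths_to_I_def split: if_splits\<close>)
  finally show ?thesis by (simp add: paths_to_I_def)
qed

lemma entry_Snk_SnkEnd:
  assumes "finite Z" "\<And>P. P \<in> Z \<Longrightarrow> is_path D P"
  shows "entry Z (Snk j) SnkEnd = (\<Sum>P\<in>paths_from_J j \<inter> Z. weight P)"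
proof -
  have "entry Z (Snk j) SnkEnd = (\<Sum>P\<in>slot Z (Snk j). terminal_weight (Snk j) P * of_bool (src P \<in> J))"
    by (simp add: entry_def)
  also have "\<dots> = (\<Sum>P\<in>paths_from_J j \<inter> Z. terminal_weight (Snk j) P * of_bool (src P \<in> J))"
    by (rule sum.mono_neutral_right) (use assms in \<open>auto simp: paths_from_J_def split: if_splits\<close>)
  finally show ?thesis by (simp add: paths_from_J_def)
qed

text \<open>The kernel is the indicator of equality and collapses the double sum to common paths.
  Such a path starts at \<open>u i\<close>, outside \<open>J\<close>, so its sink label contributes
  1 and the weight is counted once.\<close>

lemma entry_Src_Snk:
  assumes "finite Z" "\<And>P. P \<in> Z \<Longrightarrow> is_path D P" "i \<in> {1..r}" "j \<in> {1..s}"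
  shows "entry Z (Src i) (Snk j) = (\<Sum>P\<in>{P. is_path D P \<and> src P = u i \<and> trg P = v j} \<inter> Z. weight P)"
proof -
  have "entry Z (Src i) (Snk j) = (\<Sum>P\<in>slot Z (Src i). if P \<in> slot Z (Snk j) then weight P * terminal_weight (Snk j) P else 0)"
  proof -
    have "(\<Sum>Q\<in>slot Z (Snk j). terminal_weight (Src i) P * terminal_weight (Snk j) Q * pairing (Src i) (Snk j) P Q)
        = (if P \<in> slot Z (Snk j) then weight P * terminal_weight (Snk j) P else 0)" for P
    proof -
      have "finite (slot Z (Snk j))" using assms(1) by simp
      then show ?thesis
        by (simp add: of_bool_def if_distrib[where f = "\<lambda>x. _ * x"] cong: if_cong del: slot.simps terminal_weight.simps(2))
    qed
    then show ?thesis by (simp only: entry_def)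
  qed
  also have "\<dots> = (\<Sum>P\<in>slot Z (Src i) \<inter> slot Z (Snk j). weight P * terminal_weight (Snk j) P)"
    using assms(1) by (simp add: sum.inter_restrict del: slot.simps(2) terminal_weight.simps)
  also have "slot Z (Src i) \<inter> slot Z (Snk j) = {P. is_path D P \<and> src P = u i \<and> trg P = v j} \<inter> Z"
    using assms(2-4) by auto
  finally show ?thesis
    using u_notin_J[OF assms(3)] by simp
qed

lemma tendsto_entry:
  assumes "a \<in> set (terminals \<alpha> \<beta>)" "b \<in> set (terminals \<alpha> \<beta>)"
  shows "((\<lambda>Z. entry (path_hull Z) a b) \<longlongrightarrow> limit_entry a b) exhaustion"
proof -
  have SS: "((\<lambda>Z. entry (path_hull Z) (Src i) (Src j)) \<longlongrightarrow> Q_two D w I leI (u i) (u j)) exhaustion"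
    if "i \<in> {1..r}" "j \<in> {1..r}" for i j
    by (rule Lim_transform_eventually[OF tendsto_sum_hull_product[OF Q_two_has_sum[OF that]]])
       (use eventually_finite_hull in \<open>auto simp: paths_to_I_def elim!: eventually_mono intro: entry_Src_Src[unfolded paths_to_I_def, symmetric] hull_path\<close>)
  have KK: "((\<lambda>Z. entry (path_hull Z) (Snk i) (Snk j)) \<longlongrightarrow> Qt_two D w J leJ (v i) (v j)) exhaustion"
    if "i \<in> {1..s}" "j \<in> {1..s}" for i j
    by (rule Lim_transform_eventually[OF tendsto_sum_hull_product[OF Qt_two_has_sum[OF that]]])
       (use eventually_finite_hull in \<open>auto simp: paths_from_J_def elim!: eventually_mono intro: entry_Snk_Snk[unfolded paths_from_J_def, symmetric] hull_path\<close>)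
  have SE: "((\<lambda>Z. entry (path_hull Z) (Src i) SrcEnd) \<longlongrightarrow> Q_one D w I (u i)) exhaustion"
    if "i \<in> {1..r}" for i
    by (rule Lim_transform_eventually[OF tendsto_sum_hull[OF Q_one_has_sum[OF that]]])
       (use eventually_finite_hull in \<open>auto simp: paths_to_I_def elim!: eventually_mono intro: entry_Src_SrcEnd[unfolded paths_to_I_def, symmetric] hull_path\<close>)
  have KE: "((\<lambda>Z. entry (path_hull Z) (Snk j) SnkEnd) \<longlongrightarrow> Qt_one D w J (v j)) exhaustion"
    if "j \<in> {1..s}" for j
    by (rule Lim_transform_eventually[OF tendsto_sum_hull[OF Qt_one_has_sum[OF that]]])
       (use eventually_finite_hull in \<open>auto simp: paths_from_J_def elim!: eventually_mono intro: entry_Snk_SnkEnd[unfolded paths_from_J_def, symmetric] hull_path\<close>)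
  have SK: "((\<lambda>Z. entry (path_hull Z) (Src i) (Snk j)) \<longlongrightarrow> path_sum D w (u i) (v j)) exhaustion"
    if "i \<in> {1..r}" "j \<in> {1..s}" for i j
  proof (rule Lim_transform_eventually[OF tendsto_sum_hull[OF weight_has_sum]])
    show "path_weight w summable_on {p. pre_digraph.apath D (u i) p (v j)}"
      using that by (intro summable_u) auto
    show "\<forall>\<^sub>F Z in exhaustion. (\<Sum>P\<in>{P. is_path D P \<and> src P = u i \<and> trg P = v j} \<inter> path_hull Z. weight P)
        = entry (path_hull Z) (Src i) (Snk j)"
      using eventually_finite_hull by eventually_elim (simp add: entry_Src_Snk[OF _ hull_path that])
  qed auto
  \<comment> \<open>Skew symmetry supplies the transposed entries, so one order of each kind of
    label pair suffices.\<close>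
  have neg: "((\<lambda>Z. entry (path_hull Z) d c) \<longlongrightarrow> - L) exhaustion"
    if "((\<lambda>Z. entry (path_hull Z) c d) \<longlongrightarrow> L) exhaustion" for c d L
    using tendsto_minus[OF that] by (simp add: entry_skew[of _ d c])
  have zero: "((\<lambda>Z. entry (path_hull Z) c d) \<longlongrightarrow> 0) exhaustion" if "\<And>P Q. pairing c d P Q = 0" for c d
    using that by (simp add: entry_def)
  have idx: "a = Src i \<Longrightarrow> i \<in> {1..r}" "a = Snk i \<Longrightarrow> i \<in> {1..s}"
    "b = Src i \<Longrightarrow> i \<in> {1..r}" "b = Snk i \<Longrightarrow> i \<in> {1..s}" for i
    using assms by (auto simp: set_terminals split: if_splits)
  show ?thesis
    by (cases a; cases b) (simp_all only: limit_entry.simps; (intro SS KK SE KE SK neg idx zero; simp))+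
qed

end

lemma tendsto_pf_list:
  assumes "even (length xs)"
    and "\<And>a b. a \<in> set xs \<Longrightarrow> b \<in> set xs \<Longrightarrow> ((\<lambda>z. A z a b) \<longlongrightarrow> B a b) F"
  shows "((\<lambda>z. pf_list (A z) xs) \<longlongrightarrow> pf_list B xs) F"
proof -
  define n where "n = length xs div 2"
  have n: "length xs = 2 * n" using assms(1) by (simp add: n_def)
  have "((\<lambda>z. A z (xs ! \<sigma> (2 * i)) (xs ! \<sigma> (2 * i + 1))) \<longlongrightarrow> B (xs ! \<sigma> (2 * i)) (xs ! \<sigma> (2 * i + 1))) F"
    if "\<sigma> permutes {..<2 * n}" "i < n" for \<sigma> i
    using permutes_lessThan_less[OF that(1), of "2 * i"] permutes_lessThan_less[OF that(1), of "2 * i + 1"] that(2) n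
    by (intro assms(2)) auto
  then show ?thesis
    unfolding pf_list_def pf_sum_def n Let_def
    by (intro tendsto_divide tendsto_sum tendsto_mult tendsto_const tendsto_prod) auto
qed

section \<open>From finite sets of paths to the generating functions\<close>

context summable_path_system
begin

text \<open>The sums over families inside the hulls equal finite Pfaffians and converge to the
  limiting one. Their terms are nonnegative, so every finite partial sum stays below this limit;
  that yields summability and one inequality, while the hull sums, being partial sums, give the
  other.\<close>

lemma gen_fun_eq_pf_list:
  assumes ev: "even (length (terminals \<alpha> \<beta>))"
  shows "gen_fun w {F \<in> P_zero D J r u s v I.
      (odd (num_paths F (u ` {1..r}) I) \<longleftrightarrow> \<alpha>) \<and> (odd (num_paths F J (v ` {1..s})) \<longleftrightarrow> \<beta>)}
    = pf_list limit_entry (terminals \<alpha> \<beta>)"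
proof -
  define FF where "FF = {F \<in> P_zero D J r u s v I.
      (odd (num_paths F (u ` {1..r}) I) \<longleftrightarrow> \<alpha>) \<and> (odd (num_paths F J (v ` {1..s})) \<longleftrightarrow> \<beta>)}"
  define wt where "wt F = (\<Prod>P\<in>F. weight P)" for F
  let ?L = "pf_list limit_entry (terminals \<alpha> \<beta>)"
  let ?S = "\<lambda>Z. sum wt {F \<in> FF. F \<subseteq> path_hull Z}"
  have FF: "finite F \<and> (\<forall>P\<in>F. is_path D P)" if "F \<in> FF" for F
  proof -
    have "F \<in> P_zero D J r u s v I" using that by (simp add: FF_def)
    then obtain f where "routing f" "fam f = F" by (rule P_zero_is_fam)
    then show ?thesis using finite_fam fam_ends(1) by blast
  qed
  then have wt_nonneg: "0 \<le> wt F" if "F \<in> FF" for F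
    unfolding wt_def using that by (intro prod_nonneg) (auto intro: weight_nonneg)
  have lim: "(?S \<longlongrightarrow> ?L) exhaustion"
  proof (rule Lim_transform_eventually[OF tendsto_pf_list[OF ev tendsto_entry]])
    show "\<forall>\<^sub>F Z in exhaustion. pf_list (entry (path_hull Z)) (terminals \<alpha> \<beta>) = ?S Z"
      using eventually_finite_hull
    proof eventually_elim
      case (elim Z)
      have "{F. F \<in> P_zero D J r u s v I \<and> F \<subseteq> path_hull Z \<and>
          (odd (num_paths F (u ` {1..r}) I) \<longleftrightarrow> \<alpha>) \<and> (odd (num_paths F J (v ` {1..s})) \<longleftrightarrow> \<beta>)}
          = {F \<in> FF. F \<subseteq> path_hull Z}"
        by (auto simp: FF_def)
      moreover have "pf_list (entry (path_hull Z)) (terminals \<alpha> \<beta>) =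
        (\<Sum>F | F \<in> P_zero D J r u s v I \<and> F \<subseteq> path_hull Z \<and>
          (odd (num_paths F (u ` {1..r}) I) \<longleftrightarrow> \<alpha>) \<and> (odd (num_paths F J (v ` {1..s})) \<longleftrightarrow> \<beta>). wt F)"
        unfolding wt_def by (rule pf_list_entry_eq_sum[OF elim hull_path graft_in_hull ev])
      ultimately show ?case by simp
    qed
  qed
  have fin: "\<forall>\<^sub>F Z in exhaustion. finite {F \<in> FF. F \<subseteq> path_hull Z}"
    using eventually_finite_hull
    by eventually_elim (rule finite_subset[of _ "Pow _"], auto)
  have le: "sum wt GG \<le> ?L" if "finite GG" "GG \<subseteq> FF" for GG
  proof (rule tendsto_lowerbound[OF lim])
    \<comment> \<open>Finitely many families consist of finitely many paths, so all of them
      eventually lie in the hull.\<close>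
    have "\<forall>\<^sub>F Z in exhaustion. \<forall>F\<in>GG. \<forall>P\<in>F. P \<in> path_hull Z"
      using that FF by (intro eventually_ball_finite ballI eventually_in_hull) blast+
    with fin show "\<forall>\<^sub>F Z in exhaustion. sum wt GG \<le> ?S Z"
      by eventually_elim (rule sum_mono2, use that wt_nonneg in auto)
  qed simp
  have summable: "wt summable_on FF"
  proof (rule nonneg_bdd_above_summable_on[OF wt_nonneg])
    show "bdd_above (sum wt ` {F. F \<subseteq> FF \<and> finite F})"
      using le by (intro bdd_aboveI2[where M = ?L]) auto
  qed
  have "infsum wt FF = ?L"
  proof (rule antisym)
    show "infsum wt FF \<le> ?L"
      using le by (intro infsum_le_finite_sums[OF summable])
    show "?L \<le> infsum wt FF"
    proof (rule tendsto_upperbound[OF lim])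
      show "\<forall>\<^sub>F Z in exhaustion. ?S Z \<le> infsum wt FF"
        using fin by eventually_elim (rule finite_sum_le_infsum[OF summable], use wt_nonneg in auto)
    qed simp
  qed
  then show ?thesis
    unfolding gen_fun_def FF_def[symmetric] wt_def by (simp add: case_prod_unfold)
qed

lemma length_terminals: "length (terminals \<alpha> \<beta>) = r + of_bool \<alpha> + s + of_bool \<beta>"
  by (simp add: terminals_def del: upt_Suc)

text \<open>The sinks begin at position \<open>r + of_bool \<alpha>\<close> and decrease from
  \<open>s\<close>, which is the reversed indexing \<open>v (s - j)\<close> of the zero-based
  matrices.\<close>

lemma nth_terminals:
  assumes "i < r + of_bool \<alpha> + s + of_bool \<beta>"
  shows "terminals \<alpha> \<beta> ! i =
    (if i < r then Src (i + 1) else if i < r + of_bool \<alpha> then SrcEnd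
     else if i < r + of_bool \<alpha> + s then Snk (s - (i - r - of_bool \<alpha>)) else SnkEnd)"
  using assms by (auto simp: terminals_def nth_append rev_nth simp del: upt_Suc)

end

theorem theorem4p3:
  fixes D :: "('v, 'e) pre_digraph" and w :: "'e \<Rightarrow> real"
    and r s :: nat and u v :: "nat \<Rightarrow> 'v"
    and I J :: "'v set" and leI leJ :: "'v rel"
    and Q Qt H QI QtJ :: "real mat"
  assumes "wf_digraph D"
    and "acyclic (arcs_ends D)"
    and "\<forall>e\<in>arcs D. w e > 0"
    and "u ` {1..r} \<subseteq> verts D" and "inj_on u {1..r}"
    and "v ` {1..s} \<subseteq> verts D" and "inj_on v {1..s}"
    and "I \<subseteq> verts D" and "linear_order_on I leI"
    and "J \<subseteq> verts D" and "linear_order_on J leJ"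
    and "J \<inter> u ` {1..r} = {}" and "v ` {1..s} \<inter> I = {}"
    and "D_compatible D (order_concat leJ (seq_order r u)) (order_concat (seq_order s v) leI)"
    and "D_separated D J (u ` {1..r}) (v ` {1..s}) I"
    (* all sums are well defined *)
    and "\<forall>i\<in>{1..r}. \<forall>y\<in>v ` {1..s} \<union> I. path_weight w summable_on {p. pre_digraph.apath D (u i) p y}"
    and "\<forall>x\<in>J. \<forall>j\<in>{1..s}. path_weight w summable_on {p. pre_digraph.apath D x p (v j)}"
    and "\<forall>i\<in>{1..r}. (\<lambda>y. path_sum D w (u i) y) summable_on I"
    and "\<forall>j\<in>{1..s}. (\<lambda>x. path_sum D w x (v j)) summable_on J"
    (* matrix indices start at 0, sequence indices at 1 *)
    and "Q = mat r r (\<lambda>(i, j). Q_two D w I leI (u (i + 1)) (u (j + 1)))"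
    and "Qt = mat s s (\<lambda>(i, j). Qt_two D w J leJ (v (s - i)) (v (s - j)))"
    and "H = mat r s (\<lambda>(i, j). path_sum D w (u (i + 1)) (v (s - j)))"
    and "QI = mat r 1 (\<lambda>(i, _). Q_one D w I (u (i + 1)))"
    and "QtJ = mat s 1 (\<lambda>(j, _). Qt_one D w J (v (s - j)))"
  shows "(even (r + s) \<longrightarrow>
       G_parity D w J r u s v I even even =
         pfaffian (four_block_mat Q H (- transpose_mat H) Qt) \<and>
       G_parity D w J r u s v I odd odd =
         pfaffian (four_block_mat
           (four_block_mat Q QI (- transpose_mat QI) (0\<^sub>m 1 1))
           (four_block_mat H (0\<^sub>m r 1) (0\<^sub>m 1 s) (0\<^sub>m 1 1))
           (four_block_mat (- transpose_mat H) (0\<^sub>m s 1) (0\<^sub>m 1 r) (0\<^sub>m 1 1))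
           (four_block_mat Qt QtJ (- transpose_mat QtJ) (0\<^sub>m 1 1)))) \<and>
     (odd (r + s) \<longrightarrow>
       G_parity D w J r u s v I even odd =
         pfaffian (four_block_mat
           (four_block_mat Q H (- transpose_mat H) Qt)
           (0\<^sub>m r 1 @\<^sub>r QtJ)
           (- transpose_mat (0\<^sub>m r 1 @\<^sub>r QtJ))
           (0\<^sub>m 1 1)) \<and>
       G_parity D w J r u s v I odd even =
         pfaffian (four_block_mat
           (four_block_mat Q QI (- transpose_mat QI) (0\<^sub>m 1 1))
           (H @\<^sub>r 0\<^sub>m 1 s)
           (- transpose_mat (H @\<^sub>r 0\<^sub>m 1 s))
           Qt))"
proof -
  interpret summable_path_system D w r s u v I J leI leJ
    by (intro summable_path_system.intro path_system.intro summable_path_system_axioms.intro)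
       (rule assms(1,2,5,7,9,11-15) bspec[OF assms(3)] bspec[OF bspec[OF assms(16)]]
          bspec[OF bspec[OF assms(17)]] bspec[OF assms(18)] bspec[OF assms(19)] | assumption)+
  note mats = assms(20-24)
  have G: "G_parity D w J r u s v I even even = pf_list limit_entry (terminals False False)"
    "G_parity D w J r u s v I odd odd = pf_list limit_entry (terminals True True)" if "even (r + s)"
    using that gen_fun_eq_pf_list[of False False] gen_fun_eq_pf_list[of True True]
    by (simp_all add: G_parity_def length_terminals)
  have G': "G_parity D w J r u s v I even odd = pf_list limit_entry (terminals False True)"
    "G_parity D w J r u s v I odd even = pf_list limit_entry (terminals True False)" if "odd (r + s)"
    using that gen_fun_eq_pf_list[of False True] gen_fun_eq_pf_list[of True False]
    by (simp_all add: G_parity_def length_terminals)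
  \<comment> \<open>Each of the four block matrices is compared entrywise with
    \<open>limit_entry\<close>; the zero blocks are the label pairs caught by its default
    clause.\<close>
  have "pfaffian (four_block_mat Q H (- transpose_mat H) Qt) = pf_list limit_entry (terminals False False)"
    if "even (r + s)"
    by (rule pfaffian_eq_pf_list)
       (use that in \<open>auto simp: mats length_terminals nth_terminals append_rows_def\<close>)
  moreover have "pfaffian (four_block_mat
           (four_block_mat Q QI (- transpose_mat QI) (0\<^sub>m 1 1))
           (four_block_mat H (0\<^sub>m r 1) (0\<^sub>m 1 s) (0\<^sub>m 1 1))
           (four_block_mat (- transpose_mat H) (0\<^sub>m s 1) (0\<^sub>m 1 r) (0\<^sub>m 1 1))
           (four_block_mat Qt QtJ (- transpose_mat QtJ) (0\<^sub>m 1 1))) = pf_list limit_entry (terminals True True)"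
    if "even (r + s)"
    by (rule pfaffian_eq_pf_list)
       (use that in \<open>auto simp: mats length_terminals nth_terminals append_rows_def\<close>)
  moreover have "pfaffian (four_block_mat
           (four_block_mat Q H (- transpose_mat H) Qt)
           (0\<^sub>m r 1 @\<^sub>r QtJ)
           (- transpose_mat (0\<^sub>m r 1 @\<^sub>r QtJ))
           (0\<^sub>m 1 1)) = pf_list limit_entry (terminals False True)"
    if "odd (r + s)"
    by (rule pfaffian_eq_pf_list)
       (use that in \<open>auto simp: mats length_terminals nth_terminals append_rows_def\<close>)
  moreover have "pfaffian (four_block_mat
           (four_block_mat Q QI (- transpose_mat QI) (0\<^sub>m 1 1))
           (H @\<^sub>r 0\<^sub>m 1 s)
           (- transpose_mat (H @\<^sub>r 0\<^sub>m 1 s))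
           Qt) = pf_list limit_entry (terminals True False)"
    if "odd (r + s)"
    by (rule pfaffian_eq_pf_list)
       (use that in \<open>auto simp: mats length_terminals nth_terminals append_rows_def\<close>)
  ultimately show ?thesis using G G' by simp
qed

end
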